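(* Let $\theta_0=1,\theta_1,\ldots,\theta_{m-1}$ ($m\ge3$) be a unimodular partition of the unit circle, with associated map $\Phi:[0,1)\to[0,1)$ and associated set of matrices $\Sigma=\{A_0,\ldots,A_{m-1}\}$ with joint spectral radius $\rho(\Sigma)$. The function $\Phi$ is H\"older continuous of exponent $$\alpha=\frac{\log(m-1)}{2\log(\rho(\Sigma))}.$$ If the finiteness conjecture holds for $\Sigma$ (i.e., there exist $k\ge1$ and $A\in\Sigma^k$ with $\rho(\Sigma)=\rho(A)^{1/k}$), then $\alpha$ is the best H\"older exponent (i.e., $\Phi$ is not H\"older continuous of exponent $\beta$, for any $\beta>\alpha$).
   Context: $S^1=\{z\in\mathbb{C}:|z|=1\}$ is the boundary of the Poincar\'e disk. A pythagorean triple is $\mathbf{t}=(t_1,t_2,t_3)\in\mathbb{Z}^3$ with $t_3>0$, $\gcd(t_1,t_2,t_3)=1$, $t_1^2+t_2^2=t_3^2$; it is identified with the point $\theta=(t_1+t_2i)/t_3\in S^1\cap\mathbb{Q}(i)$. Let $L=\mathrm{diag}(1,1,-1)$ and $\langle \mathbf{x},\mathbf{y}\rangle=\mathbf{x}^\top L\mathbf{y}$. For distinct pythagorean triples $\mathbf{t},\mathbf{t}'$, the closed arc $[\mathbf{t},\mathbf{t}']$ going counterclockwise from $\mathbf{t}$ to $\mathbf{t}'$ is unimodular if $\mathbf{w}=(L\mathbf{t}'\times L\mathbf{t})/\langle\mathbf{t}',\mathbf{t}\rangle\in\mathbb{Z}^3$. A unimodular partition of $S^1$ is a counterclockwise cyclically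 ordered $m$-tuple $\mathbf{t}_0,\ldots,\mathbf{t}_{m-1}$ of pythagorean triples, $m\ge3$, such that each arc $[\mathbf{t}_a,\mathbf{t}_{a+1}]$ is unimodular (indices modulo $m$); $\theta_a\in S^1$ is the point identified with $\mathbf{t}_a$, and it is assumed that $\theta_0=1$. Let $I_a=[\theta_a,\theta_{a+1})$ be the half-open counterclockwise arc, and let $\mathscr{A}_a$ be the hyperbolic reflection of the Poincar\'e disk in the geodesic with ideal endpoints $\theta_a,\theta_{a+1}$, acting on $S^1$ by $\mathscr{A}_a*z=\frac{(\theta_a+\theta_{a+1})z-2\theta_a\theta_{a+1}}{2z-(\theta_a+\theta_{a+1})}$. The map $B:S^1\to S^1$ is $B(\sigma)=\mathscr{A}_a*\sigma$ for $\sigma\in I_a$. The circle is identified with $[0,1)$ via $\exp(2\pi i x)\leftrightarrow x$, so that $B$ is viewed as a map $[0,1)\to[0,1)$ (and $I_a\subset[0,1)$); let $T:[0,1)\to[0,1)$, $T(x)=-(m-1)x \pmod 1$. $\Phi$ is the unique homeomorphism of $[0,1)$ (with the topology inherited from $\mathbb{R}$) such that $\Phi\circ B=T\circ\Phi$; explicitly $\Phi=\psi^{-1}\circ\varphi$, where $\varphi(x)=a_0a_1a_2\ldots$ with $B^t(x)\in I_{a_t}$, and $\psi(x)=a_0a_1a_2\ldots$ with $T^t(x)\in J_{a_t}$, $J_a=[a/m,(a+1)/m)$ (the maps $\varphi,\psi$ are injective with the same range in $\{0,\ldots,m-1\}^{\omega}$). Matrices: as an element of $\mathrm{GL}_2\mathbb{C}/\{\pm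 I\}$, $\mathscr{A}_a$ is represented by $(\theta_a-\theta_{a+1})^{-1}\begin{pmatrix}-\theta_a-\theta_{a+1} & 2\theta_a\theta_{a+1}\\ -2 & \theta_a+\theta_{a+1}\end{pmatrix}$. With $C=2^{-1/2}\begin{pmatrix}1&-i\\-i&1\end{pmatrix}$, the matrix $A_a=C^{-1}\mathscr{A}_aC$ has (up to sign, which is irrelevant) integer entries and determinant $-1$; $\Sigma=\{A_0,\ldots,A_{m-1}\}$, after any choice of signs. $\Sigma^k$ is the set of all products of $k$ elements of $\Sigma$, repetitions allowed; $\rho(A)$ is the spectral radius of a matrix $A$, and the joint spectral radius is $\rho(\Sigma)=\lim_{k\to\infty}\max\{\|A\|^{1/k}:A\in\Sigma^k\}$ for any operator norm. *)

theory Defs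
  imports "HOL-Analysis.Analysis"
begin

definition pythagorean_triple :: "int^3 \<Rightarrow> bool" where
  "pythagorean_triple t \<longleftrightarrow>
     t $ 3 > 0 \<and> gcd (t $ 1) (gcd (t $ 2) (t $ 3)) = 1 \<and> (t $ 1)\<^sup>2 + (t $ 2)\<^sup>2 = (t $ 3)\<^sup>2"

definition triple_point :: "int^3 \<Rightarrow> complex" where
  "triple_point t = (of_int (t $ 1) + of_int (t $ 2) * \<i>) / of_int (t $ 3)"

definition real_triple :: "int^3 \<Rightarrow> real^3" where
  "real_triple t = (\<chi> i. real_of_int (t $ i))"

definition lorentz_matrix :: "real^3^3" where
  "lorentz_matrix = vector [vector [1, 0, 0], vector [0, 1, 0], vector [0, 0, -1]]"

definition lorentz_form :: "real^3 \<Rightarrow> real^3 \<Rightarrow> real" where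
  "lorentz_form x y = x \<bullet> (lorentz_matrix *v y)"

text \<open>For distinct pythagorean triples the Lorentz product in the denominator is nonzero.\<close>

definition unimodular_arc :: "int^3 \<Rightarrow> int^3 \<Rightarrow> bool" where
  "unimodular_arc t t' \<longleftrightarrow> t \<noteq> t' \<and>
     (let w = (1 / lorentz_form (real_triple t') (real_triple t)) *\<^sub>R
              cross3 (lorentz_matrix *v real_triple t') (lorentz_matrix *v real_triple t)
      in \<forall>i. w $ i \<in> \<int>)"

text \<open>
  Tuples indexed by the integers modulo \<open>m\<close> are functions on \<open>nat\<close> of which only the values
  below \<open>m\<close> matter. The tuple is counterclockwise cyclically ordered when the
  counterclockwise angles measured from its first point are strictly increasing.
\<close>

definition unimodular_partition :: "nat \<Rightarrow> (nat \<Rightarrow> int^3) \<Rightarrow> bool" where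
  "unimodular_partition m t \<longleftrightarrow>
     m \<ge> 3 \<and>
     (\<forall>a<m. pythagorean_triple (t a)) \<and>
     strict_mono_on {..<m} (\<lambda>a. Arg2pi (triple_point (t a) / triple_point (t 0))) \<and>
     (\<forall>a<m. unimodular_arc (t a) (t (Suc a mod m)))"

text \<open>The half-open counterclockwise arc \<open>[p, q)\<close> of the unit circle, for \<open>p \<noteq> q\<close>.\<close>

definition ccw_arc :: "complex \<Rightarrow> complex \<Rightarrow> complex set" where
  "ccw_arc p q = {z \<in> sphere 0 1. Arg2pi (z / p) < Arg2pi (q / p)}"

definition part_arc :: "nat \<Rightarrow> (nat \<Rightarrow> int^3) \<Rightarrow> nat \<Rightarrow> complex set" where
  "part_arc m t a = ccw_arc (triple_point (t a)) (triple_point (t (Suc a mod m)))"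

text \<open>
  The action on the unit circle of the reflection in the geodesic with ideal endpoints
  \<open>p\<close>, \<open>q\<close>; the pole \<open>(p + q) / 2\<close> is inside the disk.
\<close>

definition reflection :: "complex \<Rightarrow> complex \<Rightarrow> complex \<Rightarrow> complex" where
  "reflection p q z = ((p + q) * z - 2 * p * q) / (2 * z - (p + q))"

definition circle_map :: "nat \<Rightarrow> (nat \<Rightarrow> int^3) \<Rightarrow> complex \<Rightarrow> complex" where
  "circle_map m t z =
     (let a = (THE a. a < m \<and> z \<in> part_arc m t a)
      in reflection (triple_point (t a)) (triple_point (t (Suc a mod m))) z)"

text \<open>The identification of \<open>[0, 1)\<close> with the unit circle and its inverse.\<close>

definition to_circle :: "real \<Rightarrow> complex" where
  "to_circle x = exp (2 * pi * \<i> * x)"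

definition from_circle :: "complex \<Rightarrow> real" where
  "from_circle z = Arg2pi z / (2 * pi)"

definition interval_map :: "nat \<Rightarrow> (nat \<Rightarrow> int^3) \<Rightarrow> real \<Rightarrow> real" where
  "interval_map m t x = from_circle (circle_map m t (to_circle x))"

definition T_map :: "nat \<Rightarrow> real \<Rightarrow> real" where
  "T_map m x = frac (- (real m - 1) * x)"

definition B_coding :: "nat \<Rightarrow> (nat \<Rightarrow> int^3) \<Rightarrow> real \<Rightarrow> (nat \<Rightarrow> nat)" where
  "B_coding m t x =
     (\<lambda>n. THE a. a < m \<and> to_circle ((interval_map m t ^^ n) x) \<in> part_arc m t a)"

definition T_coding :: "nat \<Rightarrow> real \<Rightarrow> (nat \<Rightarrow> nat)" where
  "T_coding m x =
     (\<lambda>n. THE a. a < m \<and> (T_map m ^^ n) x \<in> {real a / real m ..< (real a + 1) / real m})"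

definition Phi :: "nat \<Rightarrow> (nat \<Rightarrow> int^3) \<Rightarrow> real \<Rightarrow> real" where
  "Phi m t x = inv_into {0..<1} (T_coding m) (B_coding m t x)"

definition reflection_matrix :: "complex \<Rightarrow> complex \<Rightarrow> complex^2^2" where
  "reflection_matrix p q =
     vector [vector [(- p - q) / (p - q), 2 * p * q / (p - q)],
             vector [- 2 / (p - q), (p + q) / (p - q)]]"

definition cayley_matrix :: "complex^2^2" where
  "cayley_matrix = (1 / sqrt 2) *\<^sub>R vector [vector [1, - \<i>], vector [- \<i>, 1]]"

definition A_matrix :: "nat \<Rightarrow> (nat \<Rightarrow> int^3) \<Rightarrow> nat \<Rightarrow> complex^2^2" where
  "A_matrix m t a =
     matrix_inv cayley_matrix **
     reflection_matrix (triple_point (t a)) (triple_point (t (Suc a mod m))) **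
     cayley_matrix"

text \<open>The signs \<open>\<epsilon> a\<close>, meant to be \<open>1\<close> or \<open>-1\<close>, select representatives up to sign.\<close>

definition Sigma_set :: "nat \<Rightarrow> (nat \<Rightarrow> int^3) \<Rightarrow> (nat \<Rightarrow> real) \<Rightarrow> (complex^2^2) set" where
  "Sigma_set m t \<epsilon> = (\<lambda>a. \<epsilon> a *\<^sub>R A_matrix m t a) ` {..<m}"

primrec set_power :: "(complex^2^2) set \<Rightarrow> nat \<Rightarrow> (complex^2^2) set" where
  "set_power S 0 = {mat 1}"
| "set_power S (Suc k) = {A ** B | A B. A \<in> S \<and> B \<in> set_power S k}"

definition spectral_radius :: "complex^2^2 \<Rightarrow> real" where
  "spectral_radius A = Max {cmod c | c. \<exists>v. v \<noteq> 0 \<and> A *v v = c *s v}"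

text \<open>
  The operator norm is the one induced by the Euclidean norm; for finite \<open>S\<close> the limit exists and
  does not depend on the choice of the norm.
\<close>

definition joint_spectral_radius :: "(complex^2^2) set \<Rightarrow> real" where
  "joint_spectral_radius S =
     lim (\<lambda>k. Max {root k (onorm ((*v) A)) | A. A \<in> set_power S k})"

definition finiteness_property :: "(complex^2^2) set \<Rightarrow> bool" where
  "finiteness_property S \<longleftrightarrow>
     (\<exists>k\<ge>1. \<exists>A\<in>set_power S k. joint_spectral_radius S = root k (spectral_radius A))"

definition holder_continuous_on :: "real \<Rightarrow> real set \<Rightarrow> (real \<Rightarrow> real) \<Rightarrow> bool" where
  "holder_continuous_on \<alpha> S f \<longleftrightarrow>
     \<alpha> > 0 \<and> (\<exists>K. \<forall>x\<in>S. \<forall>y\<in>S. \<bar>f x - f y\<bar> \<le> K * \<bar>x - y\<bar> powr \<alpha>)"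

end

theory Submission
  imports Defs
begin

text \<open>
  For a word \<open>w\<close> of length \<open>n\<close> let \<open>g\<close> be the composition of its reflections. On the circle
  \<open>|g z - g z'| = |z - z'| / (J z * J z')\<close>, where \<open>J z\<close> is the factor by which the matrix of \<open>g\<close> stretches
  the vector of \<open>z\<close>; hence cylinders of the reflection map have length at least of order
  \<open>norm(w)^(-2)\<close>, while the corresponding cylinders of the linear map have length of order \<open>(m - 1)^(-n)\<close>.
  The reflections have no common fixed point, so the maximal norm of words of length \<open>n\<close> is
  multiplicative up to constants and therefore comparable with \<open>\<rho>^n\<close>; it is unbounded because of
  the parabolic products of neighbouring reflections, so \<open>\<rho> > 1\<close>. This gives the Hoelder exponent at
  each endpoint of the partition, where an orbit is followed until it leaves the two adjacent arcs,
  and then for arbitrary pairs by following them until their codes differ.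

  Conversely, a linear map can contract at most one small arc of directions, so among three fixed points
  in the complement of the last arc of a reduced word two are stretched at full rate. Their images
  under \<open>g\<close> are at distance of order at most \<open>norm(w)^(-2)\<close> with \<open>\<Phi>\<close>-images at distance of order at
  least \<open>(m - 1)^(-n)\<close>, so that a Hoelder exponent \<open>\<beta>\<close> forces \<open>\<rho>^(2 \<beta>) \<le> m - 1\<close>.
\<close>

section \<open>Reflections of the circle\<close>

text \<open>The obstacle is parabolic: near a partition endpoint arbitrarily close points can have
  different first letters, so comparing lengths of cylinders alone does not control the distance of
  their images. Hence the estimate at endpoints comes first, and general pairs are joined through an
  endpoint between them. Knowing the maximal norm up to constants, rather than only the limit of its
  roots, is what yields the exponent \<alpha> itself and not just every smaller one. For m = 3 only
  two arcs remain outside the last arc of a reduced word, so three probes cannot lie in three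
  different arcs; two of them share an arc and are told apart by their second letter.\<close>

lemma finite_positive_lower_bound:
  fixes f :: "'a \<Rightarrow> real"
  assumes "finite S" "\<And>s. s \<in> S \<Longrightarrow> f s > 0"
  obtains \<delta> where "\<delta> > 0" "\<And>s. s \<in> S \<Longrightarrow> \<delta> \<le> f s"
proof
  show "Min (insert 1 (f ` S)) > 0" using assms by (subst Min_gr_iff) auto
  show "Min (insert 1 (f ` S)) \<le> f s" if "s \<in> S" for s using assms(1) that by (intro Min_le) auto
qed

lemma cnj_unit: "cmod p = 1 \<Longrightarrow> cnj p = 1 / p"
  by (metis complex_cnj_cnj complex_cnj_one complex_norm_square div_by_1 divide_eq_eq mult.commute nonzero_eq_divide_eq norm_zero of_real_1 one_power2 zero_neq_one)

text \<open>By \<open>reflection_diff\<close> this is the power -1/2 of the modulus of the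
  derivative of the reflection. The root makes chords scale by a product of one factor per end, and
  each factor is the modulus of an affine function of z.\<close>

definition dilation :: "complex \<Rightarrow> complex \<Rightarrow> complex \<Rightarrow> real" where
  "dilation p q z = cmod (2 * z - (p + q)) / cmod (p - q)"

locale ideal_geodesic =
  fixes p q :: complex
  assumes p1: "cmod p = 1" and q1: "cmod q = 1" and pq: "p \<noteq> q"
begin

lemma norm_mid: "cmod (p + q) < 2"
proof -
  have "(cmod (p + q))\<^sup>2 + (cmod (p - q))\<^sup>2 = 2 * (cmod p)\<^sup>2 + 2 * (cmod q)\<^sup>2"
    unfolding cmod_power2 by (simp add: power2_eq_square algebra_simps)
  moreover have "(cmod (p - q))\<^sup>2 > 0" using pq by simp
  ultimately have "(cmod (p + q))\<^sup>2 < 2 * 1\<^sup>2 + 2 * 1\<^sup>2" unfolding p1 q1 by linarith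
  then have "(cmod (p + q))\<^sup>2 < 2\<^sup>2" by simp
  then show ?thesis by (rule power_less_imp_less_base) simp
qed

lemma norm_denom: "cmod z = 1 \<Longrightarrow> cmod (2 * z - (p + q)) \<ge> 2 - cmod (p + q)"
  using norm_triangle_ineq2[of "2 * z" "p + q"] by (simp add: norm_mult)

lemma denom: "cmod z = 1 \<Longrightarrow> 2 * z - (p + q) \<noteq> 0"
  using norm_denom[of z] norm_mid by auto

lemma dilation_lower: "cmod z = 1 \<Longrightarrow> dilation p q z \<ge> (2 - cmod (p + q)) / cmod (p - q)"
  unfolding dilation_def by (intro divide_right_mono norm_denom) auto

lemma dilation_pos: "cmod z = 1 \<Longrightarrow> dilation p q z > 0"
  unfolding dilation_def using denom pq by simp

text \<open>On the circle conjugation is inversion, which turns the numerator into a unimodular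
  multiple of the conjugated denominator.\<close>

lemma norm_reflection: assumes z: "cmod z = 1" shows "cmod (reflection p q z) = 1"
proof -
  have nz: "p \<noteq> 0" "q \<noteq> 0" "z \<noteq> 0" using p1 q1 z by auto
  have "(p + q) * z - 2 * p * q = - (p * q * z * cnj (2 * z - (p + q)))"
    using nz by (simp add: cnj_unit[OF p1] cnj_unit[OF q1] cnj_unit[OF z] field_simps)
  then have "cmod ((p + q) * z - 2 * p * q) = cmod (2 * z - (p + q))"
    using p1 q1 z by (simp add: norm_mult del: complex_cnj_diff complex_cnj_mult)
  then show ?thesis
    unfolding reflection_def norm_divide using denom[OF z] by simp
qed

text \<open>For Moebius maps f(z) - f(w) = det (z - w) / ((cz + d)(cw + d)); the determinant is -(p
  - q)^2 here, which the denominator of \<open>dilation\<close> absorbs.\<close>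

lemma reflection_diff:
  assumes "cmod z = 1" "cmod w = 1"
  shows "cmod (reflection p q z - reflection p q w) * (dilation p q z * dilation p q w) = cmod (z - w)"
proof -
  have d: "2 * z - (p + q) \<noteq> 0" "2 * w - (p + q) \<noteq> 0" using denom assms by auto
  have "(reflection p q z - reflection p q w) * ((2 * z - (p + q)) * (2 * w - (p + q))) =
     - ((p - q) * (p - q) * (z - w))"
    unfolding reflection_def using d by (simp add: divide_simps) (simp add: algebra_simps)
  then have "cmod (reflection p q z - reflection p q w) * (cmod (2 * z - (p + q)) * cmod (2 * w - (p + q)))
      = cmod (p - q) * cmod (p - q) * cmod (z - w)"
    by (metis norm_minus_cancel norm_mult)
  then show ?thesis
    unfolding dilation_def using pq by (simp add: field_simps)
qed

lemma reflection_denom: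
  assumes z: "cmod z = 1"
  shows "2 * reflection p q z - (p + q) = (p - q)\<^sup>2 / (2 * z - (p + q))"
  unfolding reflection_def using denom[OF z] by (simp add: divide_simps) (simp add: algebra_simps power2_eq_square)

lemma dilation_reflection:
  assumes z: "cmod z = 1"
  shows "dilation p q (reflection p q z) * dilation p q z = 1"
  unfolding dilation_def reflection_denom[OF z] using denom[OF z] pq
  by (simp add: norm_divide norm_mult power2_eq_square)

lemma reflection_reflection:
  assumes z: "cmod z = 1"
  shows "reflection p q (reflection p q z) = z"
proof -
  have d: "2 * z - (p + q) \<noteq> 0" using denom[OF z] .
  have "reflection p q (reflection p q z) =
      ((p + q) * reflection p q z - 2 * p * q) / ((p - q)\<^sup>2 / (2 * z - (p + q)))"
    unfolding reflection_def[of p q "reflection p q z"] reflection_denom[OF z] ..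
  also have "(p + q) * reflection p q z - 2 * p * q = z * (p - q)\<^sup>2 / (2 * z - (p + q))"
    unfolding reflection_def using d by (simp add: divide_simps) (simp add: algebra_simps power2_eq_square)
  finally show ?thesis using d pq by simp
qed

lemma reflection_left: "reflection p q p = p"
  unfolding reflection_def using pq by (simp add: divide_simps) (simp add: algebra_simps)

lemma reflection_right: "reflection p q q = q"
  unfolding reflection_def using pq by (simp add: divide_simps) (simp add: algebra_simps)

lemma reflection_fixed:
  assumes z: "cmod z = 1" and "reflection p q z = z" shows "z = p \<or> z = q"
proof -
  have "(p + q) * z - 2 * p * q = z * (2 * z - (p + q))"
    using assms(2) denom[OF z] unfolding reflection_def by (simp add: field_simps)
  then have "2 * ((z - p) * (z - q)) = 0" by (simp add: algebra_simps)
  then have "(z - p) * (z - q) = 0" by simp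
  then show ?thesis by auto
qed

end

lemma reflection_commute: "reflection p q = reflection q p"
  unfolding reflection_def by (auto simp: fun_eq_iff ac_simps)

text \<open>
  The coordinate \<open>\<i> (z + r) / (z - r)\<close>, which is \<open>cot (\<pi> (x - r))\<close> on the angle scale, sends the
  ideal endpoint \<open>r\<close> to infinity; there a reflection with endpoint \<open>r\<close> is a point reflection.
\<close>

lemma to_circle_cot:
  assumes "to_circle x \<noteq> to_circle r"
  shows "\<i> * (to_circle x + to_circle r) / (to_circle x - to_circle r) = of_real (cot (pi * (x - r)))"
proof -
  \<comment> \<open>Splitting the points on the circle as x = v u and r = v / u leaves only 2 cos
    and 2 i sin of the half difference.\<close>
  define u where "u = exp (\<i> * of_real (pi * (x - r)))"
  define v where "v = exp (\<i> * of_real (pi * (x + r)))"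
  have x: "to_circle x = v * u" 
    unfolding to_circle_def u_def v_def exp_add[symmetric] by (simp add: algebra_simps)
  have r: "to_circle r = v / u" 
    unfolding to_circle_def u_def v_def exp_diff[symmetric] by (simp add: algebra_simps)
  have nz: "u \<noteq> 0" "v \<noteq> 0" unfolding u_def v_def by auto
  have inv: "1 / u = exp (- (\<i> * of_real (pi * (x - r))))" unfolding u_def by (simp add: exp_minus divide_simps)
  have c: "u + 1 / u = 2 * of_real (cos (pi * (x - r)))" "u - 1 / u = 2 * \<i> * of_real (sin (pi * (x - r)))"
    unfolding inv unfolding u_def cos_of_real[symmetric] sin_of_real[symmetric] cos_exp_eq sin_exp_eq
    by (auto simp: )
  have "u - 1 / u \<noteq> 0" using assms nz unfolding x r by (auto simp: field_simps)
  moreover have "\<i> * (to_circle x + to_circle r) / (to_circle x - to_circle r) = \<i> * (u + 1 / u) / (u - 1 / u)"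
  proof -
    have "to_circle x + to_circle r = v * (u + 1 / u)" "to_circle x - to_circle r = v * (u - 1 / u)"
      unfolding x r by (auto simp: algebra_simps)
    then show ?thesis using nz by simp
  qed
  ultimately show ?thesis unfolding c cot_def by simp
qed

lemma cot_reflection:
  assumes pr: "to_circle p \<noteq> to_circle r" and xr: "to_circle x \<noteq> to_circle r"
    and y: "to_circle y = reflection (to_circle r) (to_circle p) (to_circle x)"
    and d: "2 * to_circle x - (to_circle r + to_circle p) \<noteq> 0"
  shows "cot (pi * (y - r)) = 2 * cot (pi * (p - r)) - cot (pi * (x - r))"
    and "to_circle y \<noteq> to_circle r"
proof -
  define P R X Y where "P = to_circle p" "R = to_circle r" "X = to_circle x" "Y = to_circle y"
  note D = P_R_X_Y_def
  \<comment> \<open>Both expressions have the same denominator, which therefore cancels in the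
    coordinate of \<open>Y\<close>.\<close>
  have Y: "Y - R = (P - R) * (X - R) / (2 * X - (R + P))"
     "Y + R = ((P + 3 * R) * X - 3 * R * P - R * R) / (2 * X - (R + P))"
    using y d unfolding D[symmetric] reflection_def 
    by (simp_all add: divide_simps) (simp_all add: algebra_simps)
  have nz: "P \<noteq> R" "X \<noteq> R" using pr xr unfolding D by auto
  show yr: "to_circle y \<noteq> to_circle r"
    using Y(1) nz d unfolding D[symmetric] by auto
  have "\<i> * (Y + R) / (Y - R) = 2 * (\<i> * (P + R) / (P - R)) - \<i> * (X + R) / (X - R)"
    unfolding Y using nz d unfolding D[symmetric] 
    by (simp add: divide_simps) (simp add: algebra_simps)
  then have "complex_of_real (cot (pi * (y - r))) = of_real (2 * cot (pi * (p - r)) - cot (pi * (x - r)))"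
    unfolding D to_circle_cot[OF yr] to_circle_cot[OF pr] to_circle_cot[OF xr] by simp
  then show "cot (pi * (y - r)) = 2 * cot (pi * (p - r)) - cot (pi * (x - r))" by (simp only: of_real_eq_iff)
qed

lemma cot_less_iff:
  assumes "0 < x" "x < pi" "0 < y" "y < pi"
  shows "cot x < cot y \<longleftrightarrow> y < x"
proof -
  have less: "cot v < cot u" if "0 < u" "u < v" "v < pi" for u v :: real
  proof -
    have s: "sin u > 0" "sin v > 0" "sin (v - u) > 0" using that by (auto intro!: sin_gt_zero)
    have "cot u - cot v = sin (v - u) / (sin u * sin v)"
      unfolding cot_def sin_diff using s by (simp add: field_simps)
    also have "\<dots> > 0" using s by simp
    finally show ?thesis by simp
  qed
  show ?thesis using less[of x y] less[of y x] assms by (cases x y rule: linorder_cases) auto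
qed

lemma cot_add_pi: "cot (x + pi) = cot (x :: real)"
  unfolding cot_def by simp

section \<open>The angle parameter of the circle\<close>

lemma norm_to_circle [simp]: "cmod (to_circle x) = 1"
  unfolding to_circle_def by (simp add: norm_exp_eq_Re)

lemma to_circle_0 [simp]: "to_circle 0 = 1" and to_circle_1 [simp]: "to_circle 1 = 1"
  unfolding to_circle_def using exp_two_pi_i by (auto simp: mult.commute)

lemma to_circle_from_circle: "cmod z = 1 \<Longrightarrow> to_circle (from_circle z) = z"
  unfolding to_circle_def from_circle_def using Arg2pi_eq[of z]
  by (auto simp: field_simps)

lemma from_circle_bounds: "0 \<le> from_circle z" "from_circle z < 1"
  unfolding from_circle_def using Arg2pi_ge_0[of z] Arg2pi_lt_2pi[of z] by auto

lemma Arg2pi_to_circle: 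
  assumes "0 \<le> x" "x < 1" shows "Arg2pi (to_circle x) = 2 * pi * x"
  by (rule Arg2pi_unique[of 1]) (use assms in \<open>auto simp: to_circle_def mult_ac\<close>)

lemma from_circle_to_circle: 
  assumes "0 \<le> x" "x < 1" shows "from_circle (to_circle x) = x"
  unfolding from_circle_def Arg2pi_to_circle[OF assms] by simp

lemma to_circle_inj: 
  assumes "0 \<le> x" "x < 1" "0 \<le> y" "y < 1" "to_circle x = to_circle y" shows "x = y"
  using from_circle_to_circle assms by metis

section \<open>Distances on the circle\<close>

text \<open>Applied to a difference this is the metric of the circle of length 1. It is the right
  distance for the linear map, which is affine only modulo 1.\<close>

definition int_dist :: "real \<Rightarrow> real" where
  "int_dist s = \<bar>s - of_int (round s)\<bar>"

lemma int_dist_le: "int_dist s \<le> \<bar>s - of_int k\<bar>"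
  unfolding int_dist_def by (metis round_diff_minimal)

lemma int_dist_le_abs: "int_dist s \<le> \<bar>s\<bar>"
  using int_dist_le[of s 0] by simp

lemma int_dist_nonneg: "int_dist s \<ge> 0"
  unfolding int_dist_def by simp

lemma int_dist_le_half: "int_dist s \<le> 1 / 2"
  unfolding int_dist_def using of_int_round_abs_le[of s] by (simp add: abs_minus_commute)

lemma int_dist_witness: obtains k :: int where "int_dist s = \<bar>s - of_int k\<bar>"
  unfolding int_dist_def by blast

lemma int_dist_unique: "\<bar>s - of_int k\<bar> \<le> 1 / 2 \<Longrightarrow> int_dist s = \<bar>s - of_int k\<bar>"
proof -
  assume a: "\<bar>s - of_int k\<bar> \<le> 1 / 2"
  obtain l where l: "int_dist s = \<bar>s - of_int l\<bar>" by (rule int_dist_witness)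
  show ?thesis
  proof (cases "l = k")
    case False
    then have "\<bar>of_int l - of_int k\<bar> \<ge> (1 :: real)" by linarith
    then show ?thesis using l a int_dist_le_half[of s] by linarith
  qed (use l in auto)
qed

lemma int_dist_minus: "int_dist (- s) = int_dist s"
proof (rule antisym)
  have "int_dist (- r) \<le> int_dist r" for r
  proof -
    obtain l where l: "int_dist r = \<bar>r - of_int l\<bar>" by (rule int_dist_witness)
    then show ?thesis using int_dist_le[of "- r" "- l"] by simp
  qed
  from this[of s] this[of "- s"] show "int_dist (- s) \<le> int_dist s" "int_dist s \<le> int_dist (- s)" by simp_all
qed

lemma int_dist_triangle: "int_dist (s + r) \<le> int_dist s + int_dist r"
proof -
  obtain l where l: "int_dist s = \<bar>s - of_int l\<bar>" by (rule int_dist_witness)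
  obtain k where k: "int_dist r = \<bar>r - of_int k\<bar>" by (rule int_dist_witness)
  show ?thesis using int_dist_le[of "s + r" "l + k"] l k by simp
qed

lemma chord_eq: "cmod (to_circle x - to_circle y) = 2 * \<bar>sin (pi * (x - y))\<bar>"
proof -
  have *: "to_circle x = cis (2 * pi * x)" for x
    unfolding to_circle_def cis_conv_exp by (simp add: algebra_simps)
  have "(cmod (to_circle x - to_circle y))\<^sup>2 = (2 * \<bar>sin (pi * (x - y))\<bar>)\<^sup>2"
  proof -
    have "(cmod (to_circle x - to_circle y))\<^sup>2 = (cos (2 * pi * x) - cos (2 * pi * y))\<^sup>2 + (sin (2 * pi * x) - sin (2 * pi * y))\<^sup>2"
      unfolding * cmod_power2 by simp
    also have "\<dots> = ((sin (2 * pi * x))\<^sup>2 + (cos (2 * pi * x))\<^sup>2) + ((sin (2 * pi * y))\<^sup>2 + (cos (2 * pi * y))\<^sup>2) - 2 * cos (2 * pi * x - 2 * pi * y)"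
      unfolding cos_diff by (simp add: power2_eq_square algebra_simps)
    also have "\<dots> = 2 - 2 * cos (2 * (pi * (x - y)))" by (simp add: algebra_simps)
    also have "\<dots> = 4 * (sin (pi * (x - y)))\<^sup>2" unfolding cos_double_sin by simp
    finally show ?thesis by (simp add: power_mult_distrib)
  qed
  then show ?thesis by (rule power2_eq_imp_eq) auto
qed

lemma chord_le: "cmod (to_circle x - to_circle y) \<le> 2 * pi * \<bar>x - y\<bar>"
  unfolding chord_eq using abs_sin_x_le_abs_x[of "pi * (x - y)"] by (simp add: abs_mult)

lemma abs_sin_pi_abs: "\<bar>sin (pi * t)\<bar> = \<bar>sin (pi * \<bar>t\<bar>)\<bar>"
  by (cases "t \<ge> 0") auto

lemma chord_ge: "cmod (to_circle x - to_circle y) \<ge> 4 * int_dist (x - y)"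
proof -
  obtain k where k: "int_dist (x - y) = \<bar>x - y - of_int k\<bar>" by (rule int_dist_witness)
  define r where "r = \<bar>x - y - of_int k\<bar>"
  have r: "0 \<le> r" "r \<le> 1 / 2" using int_dist_le_half[of "x - y"] k unfolding r_def by auto
  have "\<bar>sin (pi * (x - y))\<bar> = \<bar>sin (pi * (x - y) - of_int k * pi)\<bar>"
  proof -
    have s: "sin (of_int k * pi) = 0" by (simp add: sin_times_pi_eq_0)
    then have "\<bar>cos (of_int k * pi)\<bar> = 1" by (rule sin_zero_abs_cos_one)
    then show ?thesis unfolding sin_diff s by (simp add: abs_mult)
  qed
  also have "\<dots> = \<bar>sin (pi * (x - y - of_int k))\<bar>" by (simp add: algebra_simps)
  also have "\<dots> = \<bar>sin (pi * r)\<bar>" unfolding r_def by (rule abs_sin_pi_abs)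
  also have "\<dots> \<ge> 2 * r"
  proof -
    \<comment> \<open>Jordan's inequality: a concave graph lies above its chord from 0 to pi /
      2.\<close>
    have "concave_on {0..pi / 2} (sin :: real \<Rightarrow> real)"
      by (rule f''_le0_imp_concave[where f' = cos and f'' = "\<lambda>x. - sin x"])
         (auto intro!: derivative_eq_intros sin_ge_zero)
    from concave_onD[OF this, of "2 * r" 0 "pi / 2"] r have "2 * r \<le> sin (pi * r)" by (simp add: mult.commute)
    then show ?thesis by simp
  qed
  finally show ?thesis unfolding chord_eq using k r_def by simp
qed

section \<open>The reflections of an ideal polygon\<close>

text \<open>Since \<open>\<tau> m = 1\<close> is identified with \<open>\<tau> 0 = 0\<close>, the right endpoint of arc \<open>a\<close> is \<open>\<tau> (Suc a)\<close> without reduction modulo \<open>m\<close>.\<close>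

locale circle_partition =
  fixes m :: nat and \<tau> :: "nat \<Rightarrow> real"
  assumes m3: "m \<ge> 3" and \<tau>_0 [simp]: "\<tau> 0 = 0" and \<tau>_m [simp]: "\<tau> m = 1"
    and \<tau>_Suc: "\<And>a. a < m \<Longrightarrow> \<tau> a < \<tau> (Suc a)"
begin

lemma m_pos: "0 < m"
  using m3 by simp

lemma \<tau>_less: "a < b \<Longrightarrow> b \<le> m \<Longrightarrow> \<tau> a < \<tau> b"
proof (induction b)
  case (Suc b)
  then show ?case using \<tau>_Suc[of b] by (cases "a = b") auto
qed simp

lemma \<tau>_le: "a \<le> b \<Longrightarrow> b \<le> m \<Longrightarrow> \<tau> a \<le> \<tau> b"
  using \<tau>_less[of a b] by (cases "a = b") auto

lemma \<tau>_ge_0: "a \<le> m \<Longrightarrow> 0 \<le> \<tau> a"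
  using \<tau>_le[of 0 a] by simp

lemma \<tau>_le_1: "a \<le> m \<Longrightarrow> \<tau> a \<le> 1"
  using \<tau>_le[of a m] by simp

lemma \<tau>_less_1: "a < m \<Longrightarrow> \<tau> a < 1"
  using \<tau>_less[of a m] by simp

definition \<theta> :: "nat \<Rightarrow> complex" where
  "\<theta> a = to_circle (\<tau> a)"

abbreviation R :: "nat \<Rightarrow> complex \<Rightarrow> complex" where
  "R a \<equiv> reflection (\<theta> a) (\<theta> (Suc a))"

abbreviation J :: "nat \<Rightarrow> complex \<Rightarrow> real" where
  "J a \<equiv> dilation (\<theta> a) (\<theta> (Suc a))"

lemma norm_\<theta> [simp]: "cmod (\<theta> a) = 1"
  unfolding \<theta>_def by simp

lemma \<theta>_mod: "a < m \<Longrightarrow> \<theta> (Suc a mod m) = \<theta> (Suc a)"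
  unfolding \<theta>_def by (cases "Suc a = m") auto

lemma \<theta>_neq:
  assumes "a < b" "b \<le> m" "a \<noteq> 0 \<or> b \<noteq> m" shows "\<theta> a \<noteq> \<theta> b"
proof
  assume eq: "\<theta> a = \<theta> b"
  show False
  proof (cases "b = m")
    case True
    then show False using to_circle_inj[of "\<tau> a" 0] eq assms \<tau>_less[of 0 a] \<tau>_ge_0[of a] \<tau>_less_1[of a] 
      unfolding \<theta>_def by auto
  next
    case False
    then show False using to_circle_inj[of "\<tau> a" "\<tau> b"] eq assms \<tau>_less[of a b] 
       \<tau>_ge_0[of a] \<tau>_less_1[of a] \<tau>_ge_0[of b] \<tau>_less_1[of b]
      unfolding \<theta>_def by auto
  qed
qed

lemma \<theta>_Suc_neq:
  assumes "a < m" shows "\<theta> a \<noteq> \<theta> (Suc a)"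
proof (rule \<theta>_neq)
  show "a \<noteq> 0 \<or> Suc a \<noteq> m" using m3 by auto
qed (use assms in auto)

lemma geodesic: "a < m \<Longrightarrow> ideal_geodesic (\<theta> a) (\<theta> (Suc a))"
  by unfold_locales (simp_all add: \<theta>_Suc_neq)

section \<open>The reflection map on the interval\<close>

definition letter :: "real \<Rightarrow> nat" where
  "letter x = (THE a. a < m \<and> \<tau> a \<le> x \<and> x < \<tau> (Suc a))"

lemma letter_eqI:
  assumes "a < m" "\<tau> a \<le> x" "x < \<tau> (Suc a)"
  shows "letter x = a"
  unfolding letter_def
proof (rule the_equality)
  fix b assume b: "b < m \<and> \<tau> b \<le> x \<and> x < \<tau> (Suc b)"
  show "b = a"
  proof (rule ccontr)
    assume "b \<noteq> a"
    then consider "Suc b \<le> a" | "Suc a \<le> b" by linarith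
    then show False using \<tau>_le[of "Suc b" a] \<tau>_le[of "Suc a" b] assms b by cases auto
  qed
qed (use assms in auto)

lemma letter:
  assumes "0 \<le> x" "x < 1"
  shows letter_less: "letter x < m" and letter_le: "\<tau> (letter x) \<le> x" and letter_gt: "x < \<tau> (Suc (letter x))"
proof -
  have "\<exists>a<n. \<tau> a \<le> x \<and> x < \<tau> (Suc a)" if "x < \<tau> n" for n
    using that
  proof (induction n)
    case 0 then show ?case using assms by simp
  next
    case (Suc n)
    then show ?case by (cases "x < \<tau> n") (auto intro: less_SucI)
  qed
  from this[of m] assms obtain a where "a < m" "\<tau> a \<le> x" "x < \<tau> (Suc a)" by auto
  moreover from this have "letter x = a" by (rule letter_eqI)
  ultimately show "letter x < m" "\<tau> (letter x) \<le> x" "x < \<tau> (Suc (letter x))" by auto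
qed

lemma letter_\<tau>: "a < m \<Longrightarrow> letter (\<tau> a) = a"
  by (rule letter_eqI) (auto simp: \<tau>_Suc)

definition step :: "real \<Rightarrow> real" where
  "step x = from_circle (R (letter x) (to_circle x))"

lemma step_bounds: "0 \<le> step x" "step x < 1"
  unfolding step_def by (rule from_circle_bounds)+

lemma norm_R: "a < m \<Longrightarrow> cmod z = 1 \<Longrightarrow> cmod (R a z) = 1"
  by (rule ideal_geodesic.norm_reflection[OF geodesic])

lemma to_circle_step:
  "0 \<le> x \<Longrightarrow> x < 1 \<Longrightarrow> to_circle (step x) = R (letter x) (to_circle x)"
  unfolding step_def by (rule to_circle_from_circle) (auto intro: norm_R letter_less)

lemma R_R: "a < m \<Longrightarrow> cmod z = 1 \<Longrightarrow> R a (R a z) = z"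
  by (rule ideal_geodesic.reflection_reflection[OF geodesic])

lemma R_left: "a < m \<Longrightarrow> R a (\<theta> a) = \<theta> a"
  by (rule ideal_geodesic.reflection_left[OF geodesic])

lemma R_right: "a < m \<Longrightarrow> R a (\<theta> (Suc a)) = \<theta> (Suc a)"
  by (rule ideal_geodesic.reflection_right[OF geodesic])

definition open_arc :: "nat \<Rightarrow> real set" where
  "open_arc a = {\<tau> a<..<\<tau> (Suc a)}"

text \<open>Seen from its left endpoint, an arc is a half-line of the cotangent coordinate, because
  the cotangent decreases over one period. Points before \<open>\<tau> a\<close> are first moved by
  a full turn.\<close>

lemma cot_arc:
  assumes a: "a < m" and x: "0 \<le> x" "x < 1" and n: "to_circle x \<noteq> \<theta> a" "to_circle x \<noteq> \<theta> (Suc a)"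
  shows "x \<in> open_arc a \<Longrightarrow> cot (pi * (\<tau> (Suc a) - \<tau> a)) < cot (pi * (x - \<tau> a))"
    and "x \<notin> open_arc a \<Longrightarrow> cot (pi * (x - \<tau> a)) < cot (pi * (\<tau> (Suc a) - \<tau> a))"
proof -
  have b: "0 \<le> \<tau> a" "\<tau> a < 1" "\<tau> a < \<tau> (Suc a)" "\<tau> (Suc a) \<le> 1"
    using a by (auto intro: \<tau>_ge_0 \<tau>_less_1 \<tau>_Suc \<tau>_le_1)
  have xn: "x \<noteq> \<tau> a" "x \<noteq> \<tau> (Suc a)" using n unfolding \<theta>_def by auto
  have d: "\<tau> (Suc a) - \<tau> a < 1"
    using b a m3 \<tau>_less[of 0 a] \<tau>_less_1[of "Suc 0"] by (cases "a = 0") auto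
  have less: "cot (pi * u) < cot (pi * v)" if "0 < v" "v < u" "u < 1" for u v
    using that by (subst cot_less_iff) auto
  show "cot (pi * (\<tau> (Suc a) - \<tau> a)) < cot (pi * (x - \<tau> a))" if "x \<in> open_arc a"
    using that b d unfolding open_arc_def by (intro less) auto
  show "cot (pi * (x - \<tau> a)) < cot (pi * (\<tau> (Suc a) - \<tau> a))" if "x \<notin> open_arc a"
  proof (cases "x < \<tau> a")
    case True
    \<comment> \<open>Only x = 0 and an arc ending at 1 could make the shifted point hit the right
      endpoint.\<close>
    have "x \<noteq> 0 \<or> \<tau> (Suc a) \<noteq> 1" using n unfolding \<theta>_def by auto
    then have "\<tau> (Suc a) < x + 1" using b x by auto
    moreover have "cot (pi * (x - \<tau> a)) = cot (pi * (x + 1 - \<tau> a))"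
      using cot_add_pi[of "pi * (x - \<tau> a)"] by (simp add: algebra_simps)
    ultimately show ?thesis using less[of "\<tau> (Suc a) - \<tau> a" "x + 1 - \<tau> a"] b True by simp
  next
    case False
    then have "\<tau> (Suc a) < x" using that xn unfolding open_arc_def by auto
    then show ?thesis using b x by (intro less) auto
  qed
qed

text \<open>By \<open>cot_reflection\<close> the map is the point reflection in the end of the
  half-line of \<open>cot_arc\<close>, so it exchanges the half-line with its complement.\<close>

lemma open_arc_swap:
  assumes a: "a < m" and x: "0 \<le> x" "x < 1" and n: "to_circle x \<noteq> \<theta> a" "to_circle x \<noteq> \<theta> (Suc a)"
    and y: "0 \<le> y" "y < 1" and yx: "to_circle y = R a (to_circle x)"
  shows "to_circle y \<noteq> \<theta> a" "to_circle y \<noteq> \<theta> (Suc a)" "y \<in> open_arc a \<longleftrightarrow> x \<notin> open_arc a"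
proof -
  have xy: "to_circle x = R a (to_circle y)" unfolding yx using R_R[OF a] by simp
  show n': "to_circle y \<noteq> \<theta> a" "to_circle y \<noteq> \<theta> (Suc a)"
    using xy n R_left[OF a] R_right[OF a] by auto
  have "cot (pi * (y - \<tau> a)) = 2 * cot (pi * (\<tau> (Suc a) - \<tau> a)) - cot (pi * (x - \<tau> a))"
    using n \<theta>_Suc_neq[OF a] yx ideal_geodesic.denom[OF geodesic[OF a], of "to_circle x"] unfolding \<theta>_def
    by (intro cot_reflection(1)) auto
  then show "y \<in> open_arc a \<longleftrightarrow> x \<notin> open_arc a"
    using cot_arc[OF a x n] cot_arc[OF a y n'] by (cases "x \<in> open_arc a"; cases "y \<in> open_arc a") simp_all
qed

lemma step_\<tau>: "a < m \<Longrightarrow> step (\<tau> a) = \<tau> a"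
  unfolding step_def letter_\<tau> using R_left[of a]
  by (simp add: letter_\<tau> \<theta>_def from_circle_to_circle \<tau>_ge_0 \<tau>_less_1)

lemma step_leaves:
  assumes x: "0 \<le> x" "x < 1" and "x \<noteq> \<tau> (letter x)"
  shows "to_circle (step x) \<noteq> \<theta> (letter x)" "to_circle (step x) \<noteq> \<theta> (Suc (letter x))"
    "letter (step x) \<noteq> letter x"
proof -
  let ?a = "letter x"
  note l = letter[OF x]
  have xa: "x \<in> open_arc ?a" using l assms(3) unfolding open_arc_def by auto
  have n: "to_circle x \<noteq> \<theta> ?a" 
    using to_circle_inj[of x "\<tau> ?a"] x assms(3) \<tau>_ge_0[of ?a] \<tau>_less_1[of ?a] l unfolding \<theta>_def by auto
  have n': "to_circle x \<noteq> \<theta> (Suc ?a)" 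
  proof (cases "Suc ?a = m")
    case True
    then show ?thesis using to_circle_inj[of x 0] x l assms(3) \<tau>_ge_0[of ?a] unfolding \<theta>_def by auto
  next
    case False
    then have "Suc ?a < m" using l by simp
    then show ?thesis using to_circle_inj[of x "\<tau> (Suc ?a)"] x l \<tau>_ge_0[of "Suc ?a"] \<tau>_less_1[of "Suc ?a"] 
      unfolding \<theta>_def by auto
  qed
  note s = open_arc_swap[OF l(1) x n n' step_bounds[of x] to_circle_step[OF x]]
  show "to_circle (step x) \<noteq> \<theta> ?a" "to_circle (step x) \<noteq> \<theta> (Suc ?a)" using s by auto
  show "letter (step x) \<noteq> ?a"
  proof
    assume e: "letter (step x) = ?a"
    have "step x \<noteq> \<tau> ?a" using s(1) unfolding \<theta>_def by auto
    then have "step x \<in> open_arc ?a" using letter[OF step_bounds[of x]] unfolding e open_arc_def by auto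
    then show False using s(3) xa by simp
  qed
qed

text \<open>A point inside an arc is reflected out of it, so only the fixed left endpoint can repeat
  its letter.\<close>

lemma letter_step_same:
  assumes "0 \<le> x" "x < 1" "letter (step x) = letter x"
  shows "x = \<tau> (letter x)" "step x = x"
proof -
  show "x = \<tau> (letter x)" using step_leaves(3)[OF assms(1,2)] assms(3) by blast
  then show "step x = x" using step_\<tau>[OF letter_less[OF assms(1,2)]] by simp
qed

lemma Suc_mod_neq: "a < m \<Longrightarrow> Suc a mod m \<noteq> a"
  using m3 by (cases "Suc a = m") auto

lemma \<tau>_mod_circle: "a < m \<Longrightarrow> to_circle (\<tau> (Suc a mod m)) = \<theta> (Suc a)"
  using \<theta>_mod[of a] unfolding \<theta>_def by simp

text \<open>The right neighbour begins at this fixed point, where the orbit would stop. Its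
  exclusion supplies the hypothesis \<open>nxt\<close> of \<open>T_coding_surj\<close>.\<close>

lemma step_avoids_right:
  assumes x: "0 \<le> x" "x < 1" shows "step x \<noteq> \<tau> (Suc (letter x) mod m)"
proof
  let ?a = "letter x"
  assume e: "step x = \<tau> (Suc ?a mod m)"
  have a: "?a < m" using letter[OF x] by simp
  show False
  proof (cases "x = \<tau> ?a")
    case True
    then have "step x = \<tau> ?a" using step_\<tau>[OF a] by simp
    then show False using e letter_\<tau>[OF a] letter_\<tau>[of "Suc ?a mod m"] Suc_mod_neq[OF a] m_pos by simp
  next
    case False
    then show False using step_leaves(2)[OF x False] e \<tau>_mod_circle[OF a] by simp
  qed
qed

text \<open>The difference of the two sides is half the translation length in
  \<open>no_alternation\<close>. It is positive because, with at least three arcs, the outer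
  endpoints of two neighbours differ, and the one of the right neighbour comes first
  counterclockwise from the common endpoint.\<close>

lemma cot_gap:
  assumes a: "a < m"
  shows "cot (pi * (\<tau> a - \<tau> (Suc a))) < cot (pi * (\<tau> (Suc (Suc a mod m)) - \<tau> (Suc a)))"
proof -
  have less: "cot (pi * u) < cot (pi * v)" if "0 < v" "v < u" "u < 1" for u v
    using that by (subst cot_less_iff) auto
  show ?thesis
  proof (cases "Suc a = m")
    case True
    have "cot (pi * (\<tau> a - 1)) = cot (pi * \<tau> a)" "cot (pi * (\<tau> 1 - 1)) = cot (pi * \<tau> 1)"
      using cot_add_pi[of "pi * (\<tau> a - 1)"] cot_add_pi[of "pi * (\<tau> 1 - 1)"] by (simp_all add: algebra_simps)
    moreover have "cot (pi * \<tau> a) < cot (pi * \<tau> 1)"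
      using True m3 \<tau>_less[of 0 1] \<tau>_less[of 1 a] \<tau>_less_1[of a] by (intro less) auto
    ultimately show ?thesis using True by simp
  next
    case False
    then have a': "Suc a < m" using a by simp
    have "cot (pi * (\<tau> a - \<tau> (Suc a))) = cot (pi * (\<tau> a - \<tau> (Suc a) + 1))"
      using cot_add_pi[of "pi * (\<tau> a - \<tau> (Suc a))"] by (simp add: algebra_simps)
    moreover have "\<tau> (Suc (Suc a)) < \<tau> a + 1"
    proof (cases "a = 0")
      case True
      then show ?thesis using \<tau>_less_1[of 2] m3 by (simp add: numeral_2_eq_2)
    next
      case False
      then show ?thesis using \<tau>_less[of 0 a] \<tau>_le_1[of "Suc (Suc a)"] a' by simp
    qed
    ultimately show ?thesis using a' \<tau>_Suc[of "Suc a"] \<tau>_Suc[of a] less[of "\<tau> (Suc (Suc a)) - \<tau> (Suc a)" "\<tau> a - \<tau> (Suc a) + 1"] by simp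
  qed
qed

lemma cot_arc_le:
  assumes a: "a < m" and x: "\<tau> a \<le> x" "x < \<tau> (Suc a)"
  shows "cot (pi * (x - \<tau> (Suc a))) \<le> cot (pi * (\<tau> a - \<tau> (Suc a)))"
proof -
  have *: "cot (pi * (u - \<tau> (Suc a))) = cot (pi * (u - \<tau> (Suc a) + 1))" for u
    using cot_add_pi[of "pi * (u - \<tau> (Suc a))"] by (simp add: algebra_simps)
  have "\<tau> (Suc a) < \<tau> a + 1"
    using \<tau>_less[of 0 a] \<tau>_le_1[of "Suc a"] a \<tau>_less_1[of 1] m3 by (cases "a = 0") auto
  then show ?thesis
    using cot_less_iff[of "pi * (x - \<tau> (Suc a) + 1)" "pi * (\<tau> a - \<tau> (Suc a) + 1)"] x
    unfolding * by (cases "x = \<tau> a") auto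
qed

text \<open>
  In the coordinate with the common endpoint at infinity, two steps alternating between adjacent
  arcs are a translation by a fixed amount, so the orbit cannot stay in the two arcs.
\<close>

lemma no_alternation:
  assumes a: "a < m" and x: "0 \<le> x" "x < 1"
    and even: "\<And>k. letter ((step ^^ (2 * k)) x) = a"
    and odd: "\<And>k. letter ((step ^^ Suc (2 * k)) x) = Suc a mod m"
  shows False
proof -
  define b where "b = Suc a mod m"
  define r where "r = \<tau> (Suc a)"
  define X where "X n = (step ^^ n) x" for n
  define f where "f y = cot (pi * (y - r))" for y
  have b: "b < m" using m_pos unfolding b_def by simp
  have ab: "a \<noteq> b" using Suc_mod_neq[OF a] unfolding b_def by simp
  have X: "0 \<le> X n" "X n < 1" for n
    unfolding X_def by (cases n; use x step_bounds in simp)+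
  have XS: "X (Suc n) = step (X n)" for n unfolding X_def by simp
  have la: "letter (X (2 * k)) = a" and lb: "letter (X (Suc (2 * k))) = b" for k
    using even odd unfolding X_def b_def by auto
  have lS: "letter (X (Suc n)) \<noteq> letter (X n)" for n
  proof (cases "even n")
    case True
    then obtain k where "n = 2 * k" by blast
    then show ?thesis using la lb ab by simp
  next
    case False
    then obtain k where k: "n = Suc (2 * k)" using oddE by fastforce
    show ?thesis using la[of "Suc k"] lb[of k] ab k by simp
  qed
  have rb: "to_circle r = \<theta> b" "to_circle r = \<theta> (Suc a)" using \<theta>_mod[OF a] unfolding r_def b_def \<theta>_def by auto
  have Xr: "to_circle (X n) \<noteq> to_circle r" for n
  proof
    assume "to_circle (X n) = to_circle r"
    then have e: "X n = \<tau> b" 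
      using to_circle_inj[OF X, of "\<tau> b"] b \<tau>_ge_0[of b] \<tau>_less_1[of b] unfolding rb(1) \<theta>_def by simp
    then show False using lS[of n] step_\<tau>[OF b] unfolding XS by simp
  qed
  have fe: "f (X (Suc (2 * k))) = 2 * f (\<tau> a) - f (X (2 * k))" for k
  proof -
    have "to_circle (X (Suc (2 * k))) = reflection (to_circle r) (to_circle (\<tau> a)) (to_circle (X (2 * k)))"
      using to_circle_step[OF X, of "2 * k"] la[of k] rb(2) reflection_commute[of "\<theta> a"] unfolding XS \<theta>_def by simp
    then show ?thesis
      using Xr[of "2 * k"] ideal_geodesic.denom[OF geodesic[OF a], of "to_circle (X (2 * k))"] \<theta>_Suc_neq[OF a]
      unfolding f_def by (intro cot_reflection(1)) (auto simp: rb(2) add.commute simp flip: \<theta>_def)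
  qed
  have fo: "f (X (2 * Suc k)) = 2 * f (\<tau> (Suc b)) - f (X (Suc (2 * k)))" for k
  proof -
    have "to_circle (X (2 * Suc k)) = reflection (to_circle r) (to_circle (\<tau> (Suc b))) (to_circle (X (Suc (2 * k))))"
      using to_circle_step[OF X, of "Suc (2 * k)"] lb[of k] rb(1) XS[of "Suc (2 * k)"] unfolding \<theta>_def by simp
    then show ?thesis
      using Xr[of "Suc (2 * k)"] ideal_geodesic.denom[OF geodesic[OF b], of "to_circle (X (Suc (2 * k)))"] \<theta>_Suc_neq[OF b]
      unfolding f_def by (intro cot_reflection(1)) (auto simp: rb(1) simp flip: \<theta>_def)
  qed
  define g where "g = f (\<tau> (Suc b)) - f (\<tau> a)"
  have g: "g > 0" using cot_gap[OF a] unfolding g_def f_def r_def b_def by simp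
  have "f (X (2 * k)) = f (X 0) + 2 * real k * g" for k
    by (induction k) (simp, simp only: fo fe, simp add: g_def algebra_simps)
  \<comment> \<open>The even iterates lie in arc \<open>a\<close>, which bounds the coordinate from
    above and contradicts its linear growth.\<close>
  moreover have "f (X (2 * k)) \<le> f (\<tau> a)" for k
    using cot_arc_le[OF a, of "X (2 * k)"] letter[OF X, of "2 * k"] unfolding la f_def r_def by simp
  moreover obtain k where k: "f (\<tau> a) - f (X 0) < real k * (2 * g)"
    using g ex_less_of_nat_mult[of "2 * g"] by auto
  ultimately have "f (X 0) + 2 * real k * g \<le> f (\<tau> a)" by metis
  with k show False by (simp add: mult_ac)
qed

end

section \<open>Growth of words in the reflections\<close>

context circle_partition
begin

text \<open>The head of a word acts last, so that prefixes of a code become inverse branches in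
  \<open>act_code_word\<close>.\<close>

primrec act :: "nat list \<Rightarrow> complex \<Rightarrow> complex" where
  "act [] z = z"
| "act (a # w) z = R a (act w z)"

primrec growth :: "nat list \<Rightarrow> complex \<Rightarrow> real" where
  "growth [] z = 1"
| "growth (a # w) z = J a (act w z) * growth w z"

definition words :: "nat \<Rightarrow> nat list set" where
  "words n = {w. set w \<subseteq> {..<m} \<and> length w = n}"

lemma Nil_words [simp]: "[] \<in> words n \<longleftrightarrow> n = 0"
  unfolding words_def by auto

lemma Cons_words [simp]: "a # w \<in> words n \<longleftrightarrow> a < m \<and> w \<in> words (n - 1) \<and> n > 0"
  unfolding words_def by auto

lemma append_words: "u \<in> words k \<Longrightarrow> v \<in> words n \<Longrightarrow> u @ v \<in> words (k + n)"
  unfolding words_def by auto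

lemma words_induct [consumes 1, case_names Nil Cons]:
  assumes "w \<in> words n" "Q 0 []"
    and "\<And>n a w. a < m \<Longrightarrow> w \<in> words n \<Longrightarrow> Q n w \<Longrightarrow> Q (Suc n) (a # w)"
  shows "Q n w"
  using assms(1)
proof (induction w arbitrary: n)
  case Nil
  then show ?case using assms(2) by simp
next
  case (Cons a w)
  then obtain n' where "n = Suc n'" by (cases n) auto
  then show ?case using Cons assms(3) by simp
qed

lemma finite_words: "finite (words n)"
  unfolding words_def using finite_lists_length_eq[of "{..<m}" n] by simp

lemma words_nonempty: "words n \<noteq> {}"
proof -
  have "replicate n 0 \<in> words n" using m_pos unfolding words_def by auto
  then show ?thesis by blast
qed

lemma J_pos: "a < m \<Longrightarrow> cmod z = 1 \<Longrightarrow> J a z > 0"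
  by (rule ideal_geodesic.dilation_pos[OF geodesic])

lemma norm_act: "w \<in> words n \<Longrightarrow> cmod z = 1 \<Longrightarrow> cmod (act w z) = 1"
  by (induction rule: words_induct) (auto intro: norm_R)

lemma growth_pos: "w \<in> words n \<Longrightarrow> cmod z = 1 \<Longrightarrow> growth w z > 0"
  by (induction rule: words_induct) (auto intro!: mult_pos_pos J_pos norm_act)

lemma act_append: "act (u @ v) z = act u (act v z)"
  by (induction u) auto

lemma growth_append: "growth (u @ v) z = growth u (act v z) * growth v z"
  by (induction u) (auto simp: act_append)

lemma act_diff:
  assumes "w \<in> words n" "cmod z = 1" "cmod z' = 1"
  shows "cmod (act w z - act w z') * (growth w z * growth w z') = cmod (z - z')"
  using assms(1)
proof (induction rule: words_induct)
  case (Cons n a w)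
  have "cmod (R a (act w z) - R a (act w z')) * (J a (act w z) * J a (act w z')) = cmod (act w z - act w z')"
    using norm_act[OF Cons(2)] assms by (intro ideal_geodesic.reflection_diff[OF geodesic[OF Cons(1)]]) auto
  then show ?case using Cons(3) by (simp add: mult_ac)
qed simp

text \<open>\<open>act w\<close> is a Moebius map and \<open>growth w\<close> the modulus of its
  normalised denominator. Being affine, the denominator is determined by its values at two
  points.\<close>

lemma growth_affine:
  assumes "w \<in> words n"
  obtains c d where "\<And>z. cmod z = 1 \<Longrightarrow> growth w z = cmod (c * z + d)"
proof -
  \<comment> \<open>The induction needs the numerator as well; the multiplied form avoids dividing
    by \<open>c * z + d\<close>.\<close>
  have "\<exists>a b c d. \<forall>z. cmod z = 1 \<longrightarrow> act w z * (c * z + d) = a * z + b \<and> growth w z = cmod (c * z + d)"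
    using assms
  proof (induction rule: words_induct)
    case Nil
    show ?case by (rule exI[of _ 1], rule exI[of _ 0], rule exI[of _ 0], rule exI[of _ 1]) simp
  next
    case (Cons n e w)
    then obtain a b c d where IH: "\<And>z. cmod z = 1 \<Longrightarrow> act w z * (c * z + d) = a * z + b"
      "\<And>z. cmod z = 1 \<Longrightarrow> growth w z = cmod (c * z + d)" by blast
    define p q where pq: "p = \<theta> e" "q = \<theta> (Suc e)"
    have ne: "p - q \<noteq> 0" unfolding pq using \<theta>_Suc_neq[OF Cons(1)] by simp
    define c' d' a' b' where "c' = (2 * a - (p + q) * c) / (p - q)" "d' = (2 * b - (p + q) * d) / (p - q)"
      "a' = ((p + q) * a - 2 * p * q * c) / (p - q)" "b' = ((p + q) * b - 2 * p * q * d) / (p - q)"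
    note D = this
    have "act (e # w) z * (c' * z + d') = a' * z + b' \<and> growth (e # w) z = cmod (c' * z + d')" if z: "cmod z = 1" for z
    proof -
      let ?y = "act w z" and ?k = "c * z + d"
      have den: "2 * ?y - (p + q) \<noteq> 0"
        unfolding pq by (rule ideal_geodesic.denom[OF geodesic[OF Cons(1)] norm_act[OF Cons(2) z]])
      have k: "c' * z + d' = (2 * (a * z + b) - (p + q) * ?k) / (p - q)" 
        "a' * z + b' = ((p + q) * (a * z + b) - 2 * p * q * ?k) / (p - q)"
        unfolding D add_divide_distrib[symmetric] times_divide_eq_left by (simp_all add: algebra_simps)
      have k': "c' * z + d' = (2 * ?y - (p + q)) * ?k / (p - q)"
          "a' * z + b' = ((p + q) * ?y - 2 * p * q) * ?k / (p - q)"
        unfolding k IH(1)[OF z, symmetric] by (simp_all add: algebra_simps)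
      have "reflection p q ?y * (c' * z + d') = a' * z + b'"
        unfolding k' reflection_def using den by simp
      moreover have "growth (e # w) z = cmod (c' * z + d')"
        unfolding k' using IH(2)[OF z] by (simp add: dilation_def pq norm_mult norm_divide)
      ultimately show ?thesis by (simp add: pq)
    qed
    then show ?case by blast
  qed
  then show ?thesis using that by blast
qed

text \<open>Linear interpolation of the affine denominator at the nodes z and z', followed by the
  triangle inequality.\<close>

lemma growth_ptolemy:
  assumes w: "w \<in> words n" and z: "cmod y = 1" "cmod z = 1" "cmod z' = 1"
  shows "cmod (z - z') * growth w y \<le> cmod (y - z') * growth w z + cmod (y - z) * growth w z'"
proof -
  obtain c d where g: "\<And>z. cmod z = 1 \<Longrightarrow> growth w z = cmod (c * z + d)" using growth_affine[OF w] by blast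
  have "(z - z') * (c * y + d) = (y - z') * (c * z + d) - (y - z) * (c * z' + d)" by (simp add: algebra_simps)
  then have "cmod ((z - z') * (c * y + d)) \<le> cmod ((y - z') * (c * z + d)) + cmod ((y - z) * (c * z' + d))"
    by (metis norm_triangle_ineq4)
  then show ?thesis using z by (simp add: g norm_mult)
qed

text \<open>The points \<open>\<i>\<close> and \<open>- \<i>\<close> correspond to the standard basis under the Cayley transform.\<close>

definition total_growth :: "nat list \<Rightarrow> real" where
  "total_growth w = growth w \<i> + growth w (- \<i>)"

lemma total_growth_pos: "w \<in> words n \<Longrightarrow> total_growth w > 0"
  unfolding total_growth_def by (intro add_pos_pos growth_pos) auto

lemma norm_diff_le_2: "cmod z = 1 \<Longrightarrow> cmod z' = 1 \<Longrightarrow> cmod (z - z') \<le> 2"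
  using norm_triangle_ineq4[of z z'] by simp

lemma growth_le_total:
  assumes w: "w \<in> words n" and z: "cmod z = 1"
  shows "growth w z \<le> total_growth w"
proof -
  \<comment> \<open>The nodes are antipodal, so their distance 2 cancels the bound 2 on the other
    chords.\<close>
  have "cmod (\<i> - - \<i>) * growth w z \<le> cmod (z - - \<i>) * growth w \<i> + cmod (z - \<i>) * growth w (- \<i>)"
    by (rule growth_ptolemy[OF w z]) auto
  also have "\<dots> \<le> 2 * growth w \<i> + 2 * growth w (- \<i>)"
    using growth_pos[OF w, of \<i>] growth_pos[OF w, of "- \<i>"] z
    by (intro add_mono mult_right_mono norm_diff_le_2) auto
  also have "cmod (\<i> - - \<i>) = 2" by (simp add: norm_mult)
  finally show ?thesis unfolding total_growth_def by simp
qed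

text \<open>Only on a small arc can a word expand much less than \<open>total_growth\<close> indicates.\<close>

lemma total_growth_two_points:
  assumes w: "w \<in> words n" and z: "cmod z = 1" "cmod z' = 1"
  shows "cmod (z - z') * total_growth w \<le> 4 * (growth w z + growth w z')"
proof -
  have "cmod (z - z') * growth w y \<le> 2 * growth w z + 2 * growth w z'" if "cmod y = 1" for y
  proof -
    have "cmod (y - z') * growth w z + cmod (y - z) * growth w z' \<le> 2 * growth w z + 2 * growth w z'"
      using growth_pos[OF w z(1)] growth_pos[OF w z(2)] that z
      by (intro add_mono mult_right_mono norm_diff_le_2) auto
    then show ?thesis using growth_ptolemy[OF w that z] by linarith
  qed
  from this[of \<i>] this[of "- \<i>"] show ?thesis unfolding total_growth_def by (simp add: algebra_simps)
qed

lemma chord_act_lower: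
  assumes w: "w \<in> words n" and z: "cmod z = 1" "cmod z' = 1"
  shows "cmod (z - z') \<le> cmod (act w z - act w z') * (total_growth w)\<^sup>2"
proof -
  have "growth w z * growth w z' \<le> total_growth w * total_growth w"
    using growth_le_total[OF w] growth_pos[OF w] total_growth_pos[OF w] z by (intro mult_mono) (auto intro: less_imp_le)
  then have "cmod (act w z - act w z') * (growth w z * growth w z') \<le> cmod (act w z - act w z') * (total_growth w * total_growth w)"
    by (intro mult_left_mono) auto
  then show ?thesis using act_diff[OF w z] by (simp add: power2_eq_square)
qed

section \<open>Maximal growth of words of given length\<close>

lemma total_growth_append:
  assumes u: "u \<in> words k" and v: "v \<in> words n"
  shows "total_growth (u @ v) \<le> total_growth u * total_growth v"
proof -
  have "growth (u @ v) z \<le> total_growth u * growth v z" if "cmod z = 1" for z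
    unfolding growth_append using growth_le_total[OF u norm_act[OF v that]] growth_pos[OF v that] 
    by (intro mult_right_mono) auto
  from this[of \<i>] this[of "- \<i>"] show ?thesis unfolding total_growth_def[of v] total_growth_def[of "u @ v"]
    by (simp add: algebra_simps)
qed

definition P :: "nat \<Rightarrow> real" where
  "P n = Max (total_growth ` words n)"

lemma total_growth_le_P: "w \<in> words n \<Longrightarrow> total_growth w \<le> P n"
  unfolding P_def using finite_words by auto

lemma P_attained: obtains w where "w \<in> words n" "total_growth w = P n"
proof -
  have "P n \<in> total_growth ` words n" unfolding P_def using finite_words words_nonempty by (intro Max_in) auto
  then show ?thesis using that by auto
qed

lemma P_pos: "P n > 0"
  by (rule P_attained[of n]) (metis total_growth_pos)

lemma P_add_le: "P (k + n) \<le> P k * P n"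
proof -
  obtain w where w: "w \<in> words (k + n)" "total_growth w = P (k + n)" by (rule P_attained)
  have "take k w \<in> words k" "drop k w \<in> words n"
    using w(1) set_take_subset[of k w] set_drop_subset[of k w] unfolding words_def by auto
  note t = this
  have "P (k + n) \<le> total_growth (take k w) * total_growth (drop k w)"
    using total_growth_append[OF t] w by simp
  also have "\<dots> \<le> P k * P n"
    using t total_growth_pos[OF t(2)] P_pos[of k] by (intro mult_mono total_growth_le_P) auto
  finally show ?thesis .
qed

text \<open>The first two reflections share only the fixed point \<open>\<theta> 1\<close>, which
  the third one moves.\<close>

lemma no_common_fixed_point:
  assumes z: "cmod z = 1" shows "\<exists>c<m. R c z \<noteq> z"
proof (rule ccontr)
  assume "\<not> ?thesis"
  then have *: "z = \<theta> c \<or> z = \<theta> (Suc c)" if "c < m" for c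
    using ideal_geodesic.reflection_fixed[OF geodesic[OF that] z] that by blast
  show False
    using *[of 0] *[of 1] *[of 2] \<theta>_neq[of 0 1] \<theta>_neq[of 0 2] \<theta>_neq[of 1 2] \<theta>_neq[of 1 3] m3
    by (auto simp: numeral_2_eq_2 numeral_3_eq_3)
qed

text \<open>Compactness: the sum of all displacements is continuous and positive on the circle, and
  some summand is at least the average.\<close>

lemma moved_uniformly:
  obtains \<delta> where "\<delta> > 0" "\<And>z. cmod z = 1 \<Longrightarrow> \<exists>c<m. cmod (R c z - z) \<ge> \<delta>"
proof -
  define f where "f z = (\<Sum>c<m. cmod (R c z - z))" for z
  have "continuous_on (sphere 0 1) f"
    unfolding f_def reflection_def using ideal_geodesic.denom[OF geodesic]
    by (intro continuous_intros) auto
  moreover have "sphere (0 :: complex) 1 \<noteq> {}" by simp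
  ultimately obtain y where "y \<in> sphere 0 1" "\<forall>z\<in>sphere 0 1. f y \<le> f z"
    using continuous_attains_inf[of "sphere (0 :: complex) 1" f] compact_sphere by blast
  then have y: "cmod y = 1" "\<And>z. cmod z = 1 \<Longrightarrow> f y \<le> f z" by simp_all
  obtain c where c: "c < m" "R c y \<noteq> y" using no_common_fixed_point[OF y(1)] by blast
  have "f y > 0" unfolding f_def using c by (intro sum_pos2[of _ c]) auto
  have "\<exists>c<m. cmod (R c z - z) \<ge> f y / m" if "cmod z = 1" for z
  proof (rule ccontr)
    assume "\<not> ?thesis"
    then have "f z < (\<Sum>c<m. f y / m)" unfolding f_def[of z] using m_pos by (intro sum_strict_mono) auto
    then show False using y(2)[OF that] m_pos by simp
  qed
  moreover have "f y / m > 0" using \<open>f y > 0\<close> m_pos by simp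
  ultimately show ?thesis using that by blast
qed

lemma J_lower: obtains \<kappa> where "\<kappa> > 0" "\<And>c z. c < m \<Longrightarrow> cmod z = 1 \<Longrightarrow> J c z \<ge> \<kappa>"
proof -
  define k where "k c = (2 - cmod (\<theta> c + \<theta> (Suc c))) / cmod (\<theta> c - \<theta> (Suc c))" for c
  have k: "k c > 0" if "c < m" for c
    unfolding k_def using \<theta>_Suc_neq[OF that] ideal_geodesic.norm_mid[OF geodesic[OF that]] by simp
  obtain \<kappa> where \<kappa>: "\<kappa> > 0" "\<And>c. c < m \<Longrightarrow> \<kappa> \<le> k c"
    using finite_positive_lower_bound[of "{..<m}" k] k by auto
  show ?thesis
  proof (rule that[OF \<kappa>(1)])
    fix c z assume cz: "c < m" "cmod z = 1"
    have "k c \<le> J c z" unfolding k_def by (rule ideal_geodesic.dilation_lower[OF geodesic[OF cz(1)] cz(2)])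
    then show "\<kappa> \<le> J c z" using \<kappa>(2)[OF cz(1)] by linarith
  qed
qed

text \<open>
  The reflections have no common fixed point, so inserting one more letter always avoids the small
  arc on which the left factor does not expand.
\<close>

lemma P_add_ge: obtains D where "D > 0" "\<And>k n. P k * P n \<le> D * P (k + n)"
proof -
  obtain \<delta> where \<delta>: "\<delta> > 0" "\<And>z. cmod z = 1 \<Longrightarrow> \<exists>c<m. cmod (R c z - z) \<ge> \<delta>" by (rule moved_uniformly) blast
  obtain \<kappa> where \<kappa>: "\<kappa> > 0" "\<And>c z. c < m \<Longrightarrow> cmod z = 1 \<Longrightarrow> J c z \<ge> \<kappa>" by (rule J_lower) blast
  \<comment> \<open>The 16 is 8 from halving the bound of \<open>total_growth_two_points\<close>
    times 2 from the choice of z; the second summand pays for an inserted letter.\<close>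
  define D where "D = 16 / \<delta> * (1 + P 1 / \<kappa>)"
  have "P k * P n \<le> D * P (k + n)" for k n
  proof -
    obtain u where u: "u \<in> words k" "total_growth u = P k" by (rule P_attained)
    obtain v where v: "v \<in> words n" "total_growth v = P n" by (rule P_attained)
    obtain z where z: "cmod z = 1" "growth v z \<ge> P n / 2"
    proof (cases "growth v \<i> \<ge> P n / 2")
      case False
      then have "growth v (- \<i>) \<ge> P n / 2" using v(2) unfolding total_growth_def by simp
      then show ?thesis by (intro that[of "- \<i>"]) auto
    qed (use that[of \<i>] in auto)
    define y where "y = act v z"
    have y: "cmod y = 1" unfolding y_def by (rule norm_act[OF v(1) z(1)])
    obtain c where c: "c < m" "cmod (R c y - y) \<ge> \<delta>" using \<delta>(2)[OF y] by blast
    have Ry: "cmod (R c y) = 1" by (rule norm_R[OF c(1) y])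
    have "\<delta> * P k \<le> cmod (R c y - y) * total_growth u" unfolding u(2) using c(2) P_pos[of k] by simp
    also have "\<dots> \<le> 4 * (growth u (R c y) + growth u y)" by (rule total_growth_two_points[OF u(1) Ry y])
    finally have "\<delta> * P k \<le> 4 * (growth u (R c y) + growth u y)" .
    moreover have "x / 8 \<le> h \<or> x / 8 \<le> g" if "(x :: real) \<le> 4 * (g + h)" for x g h
      using that by argo
    ultimately have "\<delta> * P k / 8 \<le> growth u y \<or> \<delta> * P k / 8 \<le> growth u (R c y)" by blast
    then have "\<delta> / 16 * (P k * P n) \<le> P (k + n) + P (k + n) * P 1 / \<kappa>"
    proof
      assume a: "\<delta> * P k / 8 \<le> growth u y"
      have "\<delta> * P k / 8 * (P n / 2) \<le> growth u y * growth v z"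
        using a z(2) \<delta>(1) P_pos[of k] P_pos[of n] by (intro mult_mono) (auto intro: less_imp_le growth_pos[OF u(1) y])
      also have "\<dots> = growth (u @ v) z" unfolding growth_append y_def ..
      also have "\<dots> \<le> P (k + n)" 
        using growth_le_total[OF append_words[OF u(1) v(1)] z(1)] total_growth_le_P[OF append_words[OF u(1) v(1)]] by linarith
      finally have "\<delta> / 16 * (P k * P n) \<le> P (k + n)" by (simp add: mult_ac)
      moreover have "P (k + n) * P 1 / \<kappa> \<ge> 0" using P_pos[of "k + n"] P_pos[of 1] \<kappa>(1) by simp
      ultimately show ?thesis by linarith
    next
      assume a: "\<delta> * P k / 8 \<le> growth u (R c y)"
      have cv: "c # v \<in> words (Suc n)" using c v by simp
      have "\<delta> * P k / 8 * (\<kappa> * (P n / 2)) \<le> growth u (R c y) * (J c y * growth v z)"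
        using a z(2) \<delta>(1) P_pos[of k] P_pos[of n] \<kappa>(2)[OF c(1) y] \<kappa>(1) growth_pos[OF u(1) Ry] by (intro mult_mono) auto
      also have "\<dots> = growth (u @ (c # v)) z" unfolding growth_append y_def by simp
      also have "\<dots> \<le> P (k + Suc n)" 
        using growth_le_total[OF append_words[OF u(1) cv] z(1)] total_growth_le_P[OF append_words[OF u(1) cv]] by linarith
      \<comment> \<open>The surplus letter is split off again at the cost of the constant
        \<open>P 1\<close>.\<close>
      also have "\<dots> \<le> P (k + n) * P 1" using P_add_le[of "k + n" 1] by simp
      finally have "\<delta> / 16 * (P k * P n) * \<kappa> \<le> P (k + n) * P 1" by (simp add: mult_ac)
      then have "\<delta> / 16 * (P k * P n) \<le> P (k + n) * P 1 / \<kappa>" using \<kappa>(1) by (simp add: pos_le_divide_eq)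
      then show ?thesis using P_pos[of "k + n"] by linarith
    qed
    then show ?thesis unfolding D_def using \<delta>(1) by (simp add: field_simps)
  qed
  moreover have "D > 0" unfolding D_def using \<delta>(1) \<kappa>(1) P_pos[of 1] by (intro mult_pos_pos add_pos_pos divide_pos_pos) auto
  ultimately show ?thesis using that by blast
qed

end

text \<open>Both \<open>real k * f n\<close> and \<open>real n * f k\<close> approximate
  \<open>f (k * n)\<close>, so f(n) / n is a Cauchy sequence; passing to the limit in one index
  keeps an error that is uniform in the other.\<close>

lemma quasi_additive_limit:
  fixes f :: "nat \<Rightarrow> real"
  assumes d: "\<And>k n. \<bar>f (k + n) - f k - f n\<bar> \<le> d"
  obtains L where "\<And>n. \<bar>f n - real n * L\<bar> \<le> d"
proof -
  have d0: "d \<ge> 0" using d[of 0 0] by linarith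
  have mult: "\<bar>f (k * n) - real k * f n\<bar> \<le> (real k - 1) * d" if "k \<ge> 1" for k n
    using that
  proof (induction k rule: dec_induct)
    case (step k)
    have "f (Suc k * n) - real (Suc k) * f n = (f (n + k * n) - f n - f (k * n)) + (f (k * n) - real k * f n)"
      by (simp add: algebra_simps)
    moreover have "\<bar>f (n + k * n) - f n - f (k * n)\<bar> \<le> d" by (rule d)
    moreover have "(real (Suc k) - 1) * d = (real k - 1) * d + d" by (simp add: algebra_simps)
    ultimately show ?case using step.IH by linarith
  qed simp
  \<comment> \<open>The shift by one avoids division by zero.\<close>
  define g where "g n = f (Suc n) / real (Suc n)" for n
  have close: "\<bar>real k * f n - real n * f k\<bar> \<le> (real k + real n) * d" if "k \<ge> 1" "n \<ge> 1" for k n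
    using mult[OF that(1), of n] mult[OF that(2), of k] d0
    unfolding mult.commute[of n k] left_diff_distrib distrib_right by linarith
  have gdiff: "\<bar>g k - g n\<bar> \<le> d / real (Suc k) + d / real (Suc n)" for k n
  proof -
    have "g k - g n = - (real (Suc k) * f (Suc n) - real (Suc n) * f (Suc k)) / (real (Suc k) * real (Suc n))"
      unfolding g_def by (simp add: field_simps)
    then have "\<bar>g k - g n\<bar> = \<bar>real (Suc k) * f (Suc n) - real (Suc n) * f (Suc k)\<bar> / (real (Suc k) * real (Suc n))"
      by (simp only: abs_divide abs_minus abs_mult abs_of_nat)
    also have "\<dots> \<le> (real (Suc k) + real (Suc n)) * d / (real (Suc k) * real (Suc n))"
      by (intro divide_right_mono close) auto
    also have "\<dots> = d / real (Suc k) + d / real (Suc n)" by (simp add: divide_simps) (simp add: algebra_simps)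
    finally show ?thesis .
  qed
  have "Cauchy g"
  proof (rule metric_CauchyI)
    fix e :: real assume "e > 0"
    have "(\<lambda>n. d / real (Suc n)) \<longlonglongrightarrow> 0" by (rule LIMSEQ_Suc[OF lim_const_over_n])
    then have "\<forall>\<^sub>F n in sequentially. d / real (Suc n) < e / 2"
      by (rule order_tendstoD(2)) (use \<open>e > 0\<close> in simp)
    then obtain N where N: "\<And>n. n \<ge> N \<Longrightarrow> d / real (Suc n) < e / 2"
      unfolding eventually_sequentially by blast
    show "\<exists>M. \<forall>m\<ge>M. \<forall>n\<ge>M. dist (g m) (g n) < e"
    proof (intro exI allI impI)
      fix m n assume "N \<le> m" "N \<le> n"
      then show "dist (g m) (g n) < e" using gdiff[of m n] N[of m] N[of n] unfolding dist_real_def by linarith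
    qed
  qed
  then obtain L where L: "g \<longlonglongrightarrow> L" using Cauchy_convergent_iff convergent_def by blast
  have "\<bar>f n - real n * L\<bar> \<le> d" for n
  proof (cases n)
    case 0
    then show ?thesis using d[of 0 0] by simp
  next
    case (Suc n')
    have up: "(\<lambda>k. d / real (Suc k) + d / real (Suc n')) \<longlonglongrightarrow> 0 + d / real (Suc n')"
      by (rule tendsto_add[OF LIMSEQ_Suc[OF lim_const_over_n] tendsto_const])
    have "(\<lambda>k. \<bar>g k - g n'\<bar>) \<longlonglongrightarrow> \<bar>L - g n'\<bar>" by (intro tendsto_intros L)
    from LIMSEQ_le[OF this up] have "\<bar>L - g n'\<bar> \<le> 0 + d / real (Suc n')"
      using gdiff[of _ n'] by blast
    then have "\<bar>L - g n'\<bar> \<le> d / real n" unfolding Suc by simp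
    then have "real n * \<bar>L - g n'\<bar> \<le> d" using Suc by (simp add: field_simps)
    moreover have "real n * \<bar>L - g n'\<bar> = \<bar>real n * (L - g n')\<bar>" by (simp add: abs_mult)
    moreover have "real n * (L - g n') = real n * L - f n" unfolding g_def Suc by (simp add: field_simps)
    ultimately show ?thesis by simp
  qed
  then show ?thesis using that by blast
qed

context circle_partition
begin

text \<open>The product of the reflections of arcs 0 and 1 fixes \<open>\<theta> 1\<close> and
  translates the cotangent coordinate centred there, so it drives the point 1 towards
  \<open>\<theta> 1\<close>. Bounded growth would keep the two points apart by
  \<open>chord_act_lower\<close>.\<close>

lemma P_unbounded: "\<not> (\<forall>n. P n \<le> K)"
proof
  assume K: "\<forall>n. P n \<le> K"
  define r where "r = \<tau> 1"
  define f where "f y = cot (pi * (y - r))" for y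
  define X where "X k = ((from_circle \<circ> R 1 \<circ> R 0 \<circ> to_circle) ^^ k) 0" for k
  have m: "0 < m" "Suc 0 < m" using m3 by auto
  have r: "to_circle r = \<theta> 1" unfolding r_def \<theta>_def ..
  have X: "0 \<le> X k" "X k < 1" for k unfolding X_def by (cases k; simp add: from_circle_bounds)+
  have "\<exists>w. w \<in> words (2 * k) \<and> to_circle (X k) = act w 1 \<and> act w (\<theta> 1) = \<theta> 1 
      \<and> to_circle (X k) \<noteq> \<theta> 1 \<and> f (X k) = f 0 + 2 * real k * (f (\<tau> 2) - f 0)" for k
  proof (induction k)
    case 0
    show ?case using \<theta>_neq[of 0 1] m3 by (intro exI[of _ "[]"]) (auto simp: X_def \<theta>_def)
  next
    case (Suc k)
    then obtain w where w: "w \<in> words (2 * k)" "to_circle (X k) = act w 1" "act w (\<theta> 1) = \<theta> 1"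
      "to_circle (X k) \<noteq> \<theta> 1" "f (X k) = f 0 + 2 * real k * (f (\<tau> 2) - f 0)" by blast
    define y where "y = from_circle (R 0 (to_circle (X k)))"
    have y: "to_circle y = R 0 (to_circle (X k))" 
      unfolding y_def by (rule to_circle_from_circle) (simp add: norm_R[OF m(1)])
    have XS: "X (Suc k) = from_circle (R 1 (to_circle y))" unfolding y unfolding X_def by simp
    then have tX: "to_circle (X (Suc k)) = R 1 (to_circle y)"
      unfolding XS using norm_R[OF m(2)] by (subst to_circle_from_circle) auto
    have y0: "f y = 2 * f 0 - f (X k)" "to_circle y \<noteq> to_circle r"
    proof -
      have "to_circle y = reflection (to_circle r) (to_circle 0) (to_circle (X k))"
        using y reflection_commute[of "\<theta> 0"] unfolding \<theta>_def r_def by simp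
      note c = cot_reflection[OF _ _ this]
      have n: "to_circle 0 \<noteq> to_circle r" using \<theta>_neq[of 0 1] m3 unfolding r by (simp add: \<theta>_def)
      have den: "2 * to_circle (X k) - (to_circle r + to_circle 0) \<noteq> 0"
        using ideal_geodesic.denom[OF geodesic[OF m(1)], of "to_circle (X k)"] unfolding r by (simp add: \<theta>_def add.commute)
      show "f y = 2 * f 0 - f (X k)" "to_circle y \<noteq> to_circle r" 
        unfolding f_def using c[OF n _ den] w(4) r by auto
    qed
    have x1: "f (X (Suc k)) = 2 * f (\<tau> 2) - f y" "to_circle (X (Suc k)) \<noteq> to_circle r"
    proof -
      have "to_circle (X (Suc k)) = reflection (to_circle r) (to_circle (\<tau> 2)) (to_circle y)"
        using tX unfolding \<theta>_def r_def by (simp add: numeral_2_eq_2)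
      note c = cot_reflection[OF _ y0(2) this]
      have n: "to_circle (\<tau> 2) \<noteq> to_circle r" using \<theta>_neq[of 1 2] m3 unfolding r by (auto simp: \<theta>_def)
      have den: "2 * to_circle y - (to_circle r + to_circle (\<tau> 2)) \<noteq> 0"
        using ideal_geodesic.denom[OF geodesic[OF m(2)], of "to_circle y"] unfolding r by (simp add: \<theta>_def numeral_2_eq_2)
      show "f (X (Suc k)) = 2 * f (\<tau> 2) - f y" "to_circle (X (Suc k)) \<noteq> to_circle r" 
        unfolding f_def using c[OF n den] by auto
    qed
    show ?case
    proof (intro exI[of _ "1 # 0 # w"] conjI)
      show "1 # 0 # w \<in> words (2 * Suc k)" using w(1) m by simp
      show "to_circle (X (Suc k)) = act (1 # 0 # w) 1" using tX y w(2) by simp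
      show "act (1 # 0 # w) (\<theta> 1) = \<theta> 1" using w(3) R_right[OF m(1)] R_left[OF m(2)] by simp
      show "to_circle (X (Suc k)) \<noteq> \<theta> 1" using x1(2) r by simp
      show "f (X (Suc k)) = f 0 + 2 * real (Suc k) * (f (\<tau> 2) - f 0)"
        unfolding x1 y0 w(5) by (simp add: algebra_simps)
    qed
  qed
  note W = this
  define g where "g = f (\<tau> 2) - f 0"
  have g: "g > 0" using cot_gap[of 0] m3 unfolding g_def f_def r_def by (simp add: numeral_2_eq_2)
  have dist: "cmod (1 - \<theta> 1) > 0" using \<theta>_neq[of 0 1] m3 by (simp add: \<theta>_def)
  define e where "e = cmod (1 - \<theta> 1)"
  have K0: "K > 0" using K P_pos[of 0] by (meson less_le_trans)
  have "\<bar>f (X k)\<bar> \<le> 2 * K\<^sup>2 / e" for k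
  proof -
    obtain w where w: "w \<in> words (2 * k)" "to_circle (X k) = act w 1" "act w (\<theta> 1) = \<theta> 1"
      "to_circle (X k) \<noteq> \<theta> 1" using W by blast
    have "e \<le> cmod (act w 1 - act w (\<theta> 1)) * (total_growth w)\<^sup>2"
      unfolding e_def by (rule chord_act_lower[OF w(1)]) auto
    also have "\<dots> \<le> cmod (to_circle (X k) - \<theta> 1) * K\<^sup>2"
      unfolding w(2,3) using total_growth_le_P[OF w(1)] K total_growth_pos[OF w(1)]
      by (intro mult_left_mono power_mono) (auto intro: order_trans less_imp_le)
    finally have e: "e \<le> cmod (to_circle (X k) - \<theta> 1) * K\<^sup>2" .
    have "\<bar>f (X k)\<bar> = cmod (complex_of_real (cot (pi * (X k - r))))" unfolding f_def norm_of_real ..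
    also have "\<dots> = cmod (\<i> * (to_circle (X k) + to_circle r) / (to_circle (X k) - to_circle r))"
    proof -
      have "to_circle (X k) \<noteq> to_circle r" using w(4) unfolding r .
      from to_circle_cot[OF this] show ?thesis by (rule arg_cong[OF sym])
    qed
    also have "\<dots> = cmod (to_circle (X k) + \<theta> 1) / cmod (to_circle (X k) - \<theta> 1)"
      unfolding r by (simp add: norm_mult norm_divide)
    also have "\<dots> \<le> 2 / cmod (to_circle (X k) - \<theta> 1)"
      using norm_triangle_ineq[of "to_circle (X k)" "\<theta> 1"] by (intro divide_right_mono) auto
    also have "\<dots> \<le> 2 * K\<^sup>2 / e"
      using e w(4) dist unfolding e_def by (simp add: field_simps)
    finally show ?thesis .
  qed
  moreover obtain k where "2 * K\<^sup>2 / e - f 0 < real k * (2 * g)"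
    using g ex_less_of_nat_mult[of "2 * g"] by auto
  moreover have "f (X k) = f 0 + real k * (2 * g)" for k
    using W[of k] unfolding g_def by auto
  ultimately show False by (smt (verit))
qed

text \<open>By \<open>P_add_le\<close> and \<open>P_add_ge\<close> the logarithm of \<open>P\<close>
  is additive up to a constant, which rules out polynomial factors beside
  \<open>\<rho> ^ n\<close>.\<close>

lemma P_exponential:
  obtains \<rho> C where "\<rho> > 1" "C > 0" "\<And>n. P n \<le> C * \<rho> ^ n" "\<And>n. \<rho> ^ n \<le> C * P n"
proof -
  obtain D where D: "D > 0" "\<And>k n. P k * P n \<le> D * P (k + n)" by (rule P_add_ge) blast
  have ln: "ln (P (k + n)) \<le> ln (P k) + ln (P n)" "ln (P k) + ln (P n) \<le> ln D + ln (P (k + n))" for k n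
  proof -
    have pos: "P k > 0" "P n > 0" "P (k + n) > 0" by (rule P_pos)+
    have "ln (P (k + n)) \<le> ln (P k * P n)" using P_add_le[of k n] pos by simp
    then show "ln (P (k + n)) \<le> ln (P k) + ln (P n)" using pos by (simp add: ln_mult)
    have "ln (P k * P n) \<le> ln (D * P (k + n))" using D(2)[of k n] pos D(1) by simp
    then show "ln (P k) + ln (P n) \<le> ln D + ln (P (k + n))" using pos D(1) by (simp add: ln_mult)
  qed
  obtain L where L: "\<And>n. \<bar>ln (P n) - real n * L\<bar> \<le> \<bar>ln D\<bar>"
  proof (rule quasi_additive_limit)
    show "\<bar>ln (P (k + n)) - ln (P k) - ln (P n)\<bar> \<le> \<bar>ln D\<bar>" for k n using ln[of k n] by linarith
  qed blast
  define C where "C = exp \<bar>ln D\<bar>"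
  have pow: "exp L ^ n = exp (real n * L)" for n by (simp add: exp_of_nat_mult)
  have up: "P n \<le> C * exp L ^ n" for n
  proof -
    have "P n = exp (ln (P n))" using P_pos by simp
    also have "\<dots> \<le> exp (\<bar>ln D\<bar> + real n * L)" using L[of n] by (subst exp_le_cancel_iff) linarith
    finally show ?thesis unfolding C_def pow exp_add .
  qed
  have low: "exp L ^ n \<le> C * P n" for n
  proof -
    have "exp (real n * L) \<le> exp (\<bar>ln D\<bar> + ln (P n))" using L[of n] by (subst exp_le_cancel_iff) linarith
    then show ?thesis unfolding C_def pow exp_add using P_pos by simp
  qed
  have "exp L > 1"
  proof (rule ccontr)
    assume "\<not> exp L > 1"
    then have "C * exp L ^ n \<le> C" for n unfolding C_def by (simp add: power_le_one)
    then show False using P_unbounded[of C] up order_trans by blast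
  qed
  then show ?thesis using that[of "exp L" C] up low unfolding C_def by simp
qed

end

section \<open>The linear expanding map\<close>

text \<open>Here s is the difference of two points and s' that of their images. A distance below 1/m
  is stretched to less than 1 - 1/m; if this exceeds 1/2 and wraps around, the new distance is still
  more than 1/m. So two consecutive distances below 1/m mean exact expansion, and a wrap costs at
  most the factor m.\<close>

lemma int_dist_step:
  assumes m: "m \<ge> (3 :: nat)" and s: "s' + (real m - 1) * s \<in> \<int>"
  shows int_dist_step_le: "int_dist s' \<le> (real m - 1) * int_dist s"
    and int_dist_step_eq: "int_dist s < 1 / m \<Longrightarrow> int_dist s' < 1 / m \<Longrightarrow> int_dist s' = (real m - 1) * int_dist s"
    and int_dist_step_ge: "int_dist s < 1 / m \<Longrightarrow> (real m - 1) * int_dist s \<le> m * int_dist s'"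
proof -
  obtain k where k: "int_dist s = \<bar>s - of_int k\<bar>" by (rule int_dist_witness)
  obtain l where l: "s' + (real m - 1) * s = of_int l" using s by (auto elim: Ints_cases)
  define K where "K = l - (int m - 1) * k"
  define t where "t = (real m - 1) * int_dist s"
  have "s' - of_int K = - ((real m - 1) * (s - of_int k))" using l unfolding K_def by (simp add: algebra_simps)
  then have t: "\<bar>s' - of_int K\<bar> = t" using m unfolding t_def k by (simp add: abs_mult)
  show le: "int_dist s' \<le> (real m - 1) * int_dist s" using int_dist_le[of s' K] t unfolding t_def by simp
  have *: "int_dist s' = t \<or> t < 1 \<and> int_dist s' > 1 / m" if h: "int_dist s < 1 / m"
  proof (cases "t \<le> 1 / 2")
    case True
    then show ?thesis using int_dist_unique[of s' K] t by simp
  next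
    case False
    have "t < (real m - 1) * (1 / m)" unfolding t_def using h m by (intro mult_strict_left_mono) auto
    then have t1: "t < 1 - 1 / m" using m by (simp add: field_simps)
    moreover have "1 / real m > 0" using m by simp
    ultimately have t2: "t < 1" by linarith
    have "int_dist s' = 1 - t"
    proof (cases "s' - of_int K \<ge> 0")
      case True
      with t2 have "\<bar>s' - of_int (K + 1)\<bar> = 1 - t" unfolding of_int_add of_int_1 using t t2 by linarith
      then show ?thesis using int_dist_unique[of s' "K + 1"] False by simp
    next
      case neg: False
      with t2 have "\<bar>s' - of_int (K - 1)\<bar> = 1 - t" unfolding of_int_diff of_int_1 using t t2 by linarith
      then show ?thesis using int_dist_unique[of s' "K - 1"] False by simp
    qed
    then show ?thesis using t1 t2 by simp
  qed
  show "int_dist s' = (real m - 1) * int_dist s" if "int_dist s < 1 / m" "int_dist s' < 1 / m"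
    using *[OF that(1)] that(2) unfolding t_def by linarith
  show "(real m - 1) * int_dist s \<le> m * int_dist s'" if h: "int_dist s < 1 / m"
    using *[OF h]
  proof
    assume "int_dist s' = t"
    then have "t \<le> m * int_dist s'" using int_dist_nonneg[of s'] m mult_right_mono[of 1 "real m" "int_dist s'"] by simp
    then show ?thesis unfolding t_def .
  next
    assume "t < 1 \<and> int_dist s' > 1 / m"
    then have "t \<le> m * int_dist s'" using m by (simp add: field_simps)
    then show ?thesis unfolding t_def .
  qed
qed

text \<open>A wrap before the last step would produce a distance above 1/m, so the factor m is lost
  only once and not at every step.\<close>

lemma int_dist_orbit_ge:
  assumes m: "m \<ge> (3 :: nat)"
    and s: "\<And>j. j < n \<Longrightarrow> s (Suc j) + (real m - 1) * s j \<in> \<int>"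
    and close: "\<And>j. j < n \<Longrightarrow> int_dist (s j) < 1 / m"
  shows "(real m - 1) ^ n * int_dist (s 0) \<le> m * int_dist (s n)"
proof (cases n)
  case 0
  then show ?thesis using int_dist_nonneg[of "s 0"] m mult_right_mono[of 1 "real m" "int_dist (s 0)"] by simp
next
  case (Suc n')
  have eq: "int_dist (s j) = (real m - 1) ^ j * int_dist (s 0)" if "j \<le> n'" for j
    using that
  proof (induction j)
    case (Suc j)
    then have j: "j < n" "Suc j < n" "j \<le> n'" using \<open>n = Suc n'\<close> by auto
    have "int_dist (s (Suc j)) = (real m - 1) * int_dist (s j)"
      by (rule int_dist_step_eq[OF m s[OF j(1)] close[OF j(1)] close[OF j(2)]])
    then show ?case using Suc.IH[OF j(3)] by simp
  qed simp
  have n': "n' < n" using Suc by simp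
  have "(real m - 1) * int_dist (s n') \<le> m * int_dist (s (Suc n'))"
    by (rule int_dist_step_ge[OF m s[OF n'] close[OF n']])
  then show ?thesis unfolding eq[OF order_refl] Suc power_Suc mult.assoc .
qed

lemma int_dist_orbit_le:
  assumes m: "m \<ge> (3 :: nat)"
    and s: "\<And>j. j < n \<Longrightarrow> s (Suc j) + (real m - 1) * s j \<in> \<int>"
  shows "int_dist (s n) \<le> (real m - 1) ^ n * int_dist (s 0)"
  using s
proof (induction n)
  case (Suc n)
  have "int_dist (s (Suc n)) \<le> (real m - 1) * int_dist (s n)" using int_dist_step_le[OF m Suc(2)[of n]] by simp
  also have "\<dots> \<le> (real m - 1) * ((real m - 1) ^ n * int_dist (s 0))"
    using Suc m by (intro mult_left_mono) auto
  finally show ?case by (simp add: mult_ac)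
qed simp

section \<open>Orbits and codes of the linear map\<close>

lemma T_map_diff_Ints: "T_map m x - T_map m y + (real m - 1) * (x - y) \<in> \<int>"
proof -
  have "T_map m x - T_map m y + (real m - 1) * (x - y) =
      of_int (\<lfloor>- (real m - 1) * y\<rfloor> - \<lfloor>- (real m - 1) * x\<rfloor>)"
    unfolding T_map_def frac_def by (simp add: algebra_simps)
  then show ?thesis by (metis Ints_of_int)
qed

lemma T_map_iterate_bounds:
  assumes "0 \<le> u" "u < 1" shows "0 \<le> (T_map m ^^ n) u" "(T_map m ^^ n) u < 1"
  by (cases n; use assms in \<open>simp add: T_map_def frac_lt_1\<close>)+

lemma T_interval_unique:
  assumes "y \<in> {real a / real m..<(real a + 1) / real m}" "y \<in> {real b / real m..<(real b + 1) / real m}" "0 < m"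
  shows "a = b"
proof -
  have "real a \<le> y * m" "y * m < real a + 1" "real b \<le> y * m" "y * m < real b + 1"
    using assms by (auto simp: field_simps)
  then show ?thesis by linarith
qed

lemma T_coding_eqI:
  assumes "0 < m" "\<And>n. a n < m" "\<And>n. (T_map m ^^ n) u \<in> {real (a n) / real m..<(real (a n) + 1) / real m}"
  shows "T_coding m u = a"
proof
  show "T_coding m u n = a n" for n
    unfolding T_coding_def
  proof (rule the_equality)
    show "b = a n" if "b < m \<and> (T_map m ^^ n) u \<in> {real b / real m..<(real b + 1) / real m}" for b
      using that by (intro T_interval_unique[OF _ assms(3) assms(1)]) auto
  qed (use assms in auto)
qed

lemma T_coding:
  assumes "0 < m" "0 \<le> u" "u < 1"
  shows "(T_map m ^^ n) u \<in> {real (T_coding m u n) / real m..<(real (T_coding m u n) + 1) / real m}"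
proof -
  define y where "y = (T_map m ^^ n) u"
  have y: "0 \<le> y" "y < 1" unfolding y_def by (rule T_map_iterate_bounds[OF assms(2,3)])+
  define a where "a = nat \<lfloor>y * m\<rfloor>"
  have "real a = of_int \<lfloor>y * m\<rfloor>" unfolding a_def using y by simp
  then have am: "real a \<le> y * m" "y * m < real a + 1" by linarith+
  have "y * m < 1 * real m" using y assms(1) by (intro mult_strict_right_mono) auto
  then have "real a < m" using am by linarith
  then have a: "a < m \<and> y \<in> {real a / real m..<(real a + 1) / real m}" using am assms(1) by (auto simp: field_simps)
  have "T_coding m u n = a" unfolding T_coding_def y_def[symmetric]
    using a T_interval_unique[OF _ _ assms(1)] by (intro the_equality) blast+
  then show ?thesis using a unfolding y_def by simp
qed

text \<open>
  On the interval with index \<open>a n\<close> the relation \<open>T u = u'\<close> reads \<open>(m - 1) u = a n + k n - u'\<close>,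
  where \<open>k n\<close> tells on which side of the interval \<open>u'\<close> lies; solving it forwards gives a series. The
  only way for \<open>u n\<close> to hit an excluded right endpoint is a code alternating between two neighbours.
\<close>

lemma T_coding_surj:
  fixes a :: "nat \<Rightarrow> nat"
  assumes m: "m \<ge> 3" and am: "\<And>n. a n < m"
    and same: "\<And>n. a (Suc n) = a n \<Longrightarrow> a (Suc (Suc n)) = a n"
    and nxt: "\<And>n. a (Suc n) = Suc (a n) mod m \<Longrightarrow> a (Suc (Suc n)) \<noteq> a (Suc n)"
    and alt: "\<And>n. \<exists>k. a (n + 2 * k) \<noteq> a n \<or> a (Suc (n + 2 * k)) \<noteq> Suc (a n) mod m"
  obtains u where "0 \<le> u" "u < 1" "T_coding m u = a"
proof -
  define M where "M = real m"
  have M: "M \<ge> 3" using m unfolding M_def by simp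
  have aM: "real (a n) \<le> M - 1" for n using am[of n] unfolding M_def by linarith
  define k :: "nat \<Rightarrow> real" where "k n = (if a n < a (Suc n) then 1 else 0)" for n
  \<comment> \<open>The relation \<open>rec\<close> solved for \<open>u n\<close> reads
    \<open>u n = d n + c * u (Suc n)\<close>, whence the geometric weights.\<close>
  define d where "d n = (real (a n) + k n) / (M - 1)" for n
  define c where "c = - 1 / (M - 1)"
  define u where "u n = (\<Sum>j. c ^ j * d (n + j))" for n
  have c: "\<bar>c\<bar> < 1" unfolding c_def using M by simp
  have d: "0 \<le> d n" "d n \<le> 2" for n
    using aM[of n] M unfolding d_def k_def by (auto simp: field_simps)
  have nb: "norm (c ^ j * d n) \<le> \<bar>c\<bar> ^ j * 2" for j n
    using d[of n] by (auto simp: abs_mult power_abs intro!: mult_left_mono)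
  have sg: "summable (\<lambda>j. \<bar>c\<bar> ^ j * 2)" using c by (intro summable_mult2 summable_geometric) simp
  have su: "summable (\<lambda>j. c ^ j * d (n + j))" for n
    by (rule summable_comparison_test'[OF sg nb])
  \<comment> \<open>The summand 1 gives the slack \<open>M\<close> for the base case of
    \<open>approx\<close>.\<close>
  define E where "E = (\<Sum>j. \<bar>c\<bar> ^ j * 2) + 1"
  have uE: "\<bar>u n\<bar> \<le> E - 1" for n
    using norm_suminf_le[OF nb sg, of "\<lambda>j. n + j"] unfolding u_def E_def by simp
  have E0: "E \<ge> 0" using uE[of 0] by linarith
  have rec: "(M - 1) * u n = real (a n) + k n - u (Suc n)" for n
  proof -
    have "u n - d n = (\<Sum>j. c ^ Suc j * d (n + Suc j))"
      using suminf_split_head[OF su[of n]] unfolding u_def by simp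
    also have "\<dots> = (\<Sum>j. c * (c ^ j * d (Suc n + j)))" by (simp add: mult_ac)
    also have "\<dots> = c * u (Suc n)" unfolding u_def by (rule suminf_mult[OF su])
    finally have "(M - 1) * u n = (M - 1) * d n + ((M - 1) * c) * u (Suc n)" by (simp add: algebra_simps)
    moreover have "(M - 1) * d n = real (a n) + k n" "(M - 1) * c = - 1" using M unfolding c_def d_def by auto
    ultimately show ?thesis by simp
  qed
  \<comment> \<open>A repeated letter makes the rest of the code constant, and \<open>u n\<close> is
    then the fixed point at the left end of its interval.\<close>
  have const: "M * u n = a n" if "a (Suc n) = a n" for n
  proof -
    have aj: "a (n + j) = a n \<and> a (Suc (n + j)) = a n" for j
    proof (induction j)
      case (Suc j)
      then show ?case using same[of "n + j"] by simp
    qed (use that in simp)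
    then have "d (Suc n + j) = d (n + j)" for j using aj[of "Suc j"] aj[of j] unfolding d_def k_def by simp
    then have "u (Suc n) = u n" unfolding u_def by simp
    then show ?thesis using rec[of n] that unfolding k_def by (simp add: algebra_simps)
  qed
  \<comment> \<open>Contraction towards the interval: a backward step divides the error by
    \<open>M - 1\<close>, which is at least 2.\<close>
  have approx: "real (a n) - E * M / 2 ^ j \<le> M * u n \<and> M * u n \<le> real (a n) + 1 + E * M / 2 ^ j" for n j
  proof (induction j arbitrary: n)
    case 0
    have "\<bar>M * u n\<bar> \<le> M * (E - 1)" using uE[of n] M by (simp add: abs_mult)
    then have "\<bar>M * u n\<bar> \<le> E * M - M" by (simp add: algebra_simps)
    then show ?case unfolding power_0 div_by_1 abs_le_iff using aM[of n] by linarith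
  next
    case (Suc j)
    define e where "e = E * M / 2 ^ j"
    have e: "e \<ge> 0" unfolding e_def using E0 M by simp
    have IH: "real (a (Suc n)) - e \<le> M * u (Suc n)" "M * u (Suc n) \<le> real (a (Suc n)) + 1 + e"
      using Suc[of "Suc n"] unfolding e_def by auto
    have r: "(M - 1) * (M * u n) = M * (real (a n) + k n) - M * u (Suc n)"
      using rec[of n] by (metis mult.left_commute right_diff_distrib)
    have half: "e \<le> (M - 1) * (e / 2)" using e M mult_right_mono[of 2 "M - 1" "e / 2"] by simp
    have "real (a n) - e / 2 \<le> M * u n \<and> M * u n \<le> real (a n) + 1 + e / 2"
    proof (cases "a (Suc n)" "a n" rule: linorder_cases)
      case equal
      then show ?thesis using const[of n] e by simp
    next
      case greater
      have "M * u (Suc n) \<ge> real (a n) + 1 - e" "M * u (Suc n) \<le> M + e" 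
        using greater IH aM[of "Suc n"] by auto
      then have "(M - 1) * (M * u n) \<le> (M - 1) * (real (a n) + 1) + e" "(M - 1) * (M * u n) \<ge> M * real (a n) - e"
        using r greater unfolding k_def by (simp_all add: algebra_simps)
      moreover have "M * real (a n) \<ge> (M - 1) * real (a n)" by (simp add: algebra_simps)
      ultimately have "(M - 1) * (M * u n) \<le> (M - 1) * (real (a n) + 1 + e / 2)" "(M - 1) * (M * u n) \<ge> (M - 1) * (real (a n) - e / 2)"
        using half unfolding right_diff_distrib distrib_left by linarith+
      then show ?thesis using M by simp
    next
      case less
      have "M * u (Suc n) \<ge> - e" "M * u (Suc n) \<le> real (a n) + e" 
        using less IH by auto
      then have "(M - 1) * (M * u n) \<le> M * real (a n) + e" "(M - 1) * (M * u n) \<ge> (M - 1) * real (a n) - e"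
        using r less unfolding k_def by (simp_all add: algebra_simps)
      moreover have "M * real (a n) \<le> (M - 1) * (real (a n) + 1)" using aM[of n] by (simp add: algebra_simps)
      ultimately have "(M - 1) * (M * u n) \<le> (M - 1) * (real (a n) + 1 + e / 2)" "(M - 1) * (M * u n) \<ge> (M - 1) * (real (a n) - e / 2)"
        using half unfolding right_diff_distrib distrib_left by linarith+
      then show ?thesis using M by simp
    qed
    then show ?case unfolding e_def by (simp add: mult.commute)
  qed
  define v where "v n = M * u n" for n
  have lim: "(\<lambda>j. E * M / 2 ^ j) \<longlonglongrightarrow> 0" by (rule LIMSEQ_divide_realpow_zero) simp
  have v_ge: "real (a n) \<le> v n" for n
  proof (rule LIMSEQ_le_const2)
    show "(\<lambda>j. real (a n) - E * M / 2 ^ j) \<longlonglongrightarrow> real (a n)" using tendsto_diff[OF tendsto_const lim, of "real (a n)"] by simp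
  qed (use approx[of n] v_def in auto)
  have v_le: "v n \<le> real (a n) + 1" for n
  proof (rule LIMSEQ_le_const)
    show "(\<lambda>j. real (a n) + 1 + E * M / 2 ^ j) \<longlonglongrightarrow> real (a n) + 1" using tendsto_add[OF tendsto_const lim, of "real (a n) + 1"] by simp
  qed (use approx[of n] v_def in auto)
  have vrec: "(M - 1) * v n = M * real (a n) + M * k n - v (Suc n)" for n
    unfolding v_def using rec[of n] by (metis distrib_left mult.left_commute right_diff_distrib)
  \<comment> \<open>From its right endpoint the point moves to the left endpoint of the right
    neighbour, and \<open>left\<close> brings it back: the alternation that \<open>alt\<close>
    forbids.\<close>
  have right: "a (Suc n) = Suc (a n) mod m \<and> v (Suc n) = a (Suc n)" if "v n = real (a n) + 1" for n
  proof -
    have *: "v (Suc n) = M * k n + real (a n) + 1 - M" using vrec[of n] unfolding that by (simp add: algebra_simps)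
    show ?thesis
    proof (cases "a n < a (Suc n)")
      case True
      then have e: "v (Suc n) = real (a n) + 1" using * unfolding k_def by simp
      then have "a (Suc n) = Suc (a n)" using True v_ge[of "Suc n"] by linarith
      then show ?thesis using am[of "Suc n"] e by simp
    next
      case False
      then have "v (Suc n) = real (a n) + 1 - M" using * unfolding k_def by simp
      then have "real (a (Suc n)) = 0" "real (a n) + 1 = M" "v (Suc n) = 0" using v_ge[of "Suc n"] aM[of n] by linarith+
      moreover from this have "Suc (a n) = m" unfolding M_def by linarith
      ultimately show ?thesis by simp
    qed
  qed
  have left: "a (Suc (Suc n)) = a n \<and> v (Suc (Suc n)) = real (a n) + 1"
    if "a (Suc n) = Suc (a n) mod m" "v (Suc n) = a (Suc n)" for n
  proof -
    have *: "v (Suc (Suc n)) = M * k (Suc n) + real (a (Suc n))" using vrec[of "Suc n"] unfolding that(2) by (simp add: algebra_simps)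
    show ?thesis
    proof (cases "a (Suc n) < a (Suc (Suc n))")
      case True
      then have e: "v (Suc (Suc n)) = M + real (a (Suc n))" using * unfolding k_def by simp
      then have z: "real (a (Suc n)) = 0" "real (a (Suc (Suc n))) + 1 = M" using v_le[of "Suc (Suc n)"] aM[of "Suc (Suc n)"] by linarith+
      then have "Suc (a (Suc (Suc n))) = m" unfolding M_def by linarith
      moreover have "Suc (a n) = m" using that(1) z(1) am[of n] by (metis Suc_lessI mod_less nat.distinct(1) of_nat_eq_0_iff)
      ultimately show ?thesis using z e by auto
    next
      case False
      then have e: "v (Suc (Suc n)) = real (a (Suc n))" using * unfolding k_def by simp
      have "a (Suc (Suc n)) \<noteq> a (Suc n)" using nxt[OF that(1)] .
      then have s: "a (Suc n) = Suc (a (Suc (Suc n)))" using False v_le[of "Suc (Suc n)"] e by linarith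
      then have "a (Suc n) = Suc (a n)" using that(1) am[of n]
        by (metis Suc_lessI mod_less mod_self nat.distinct(1))
      then show ?thesis using s e by simp
    qed
  qed
  have v_less: "v n < real (a n) + 1" for n
  proof (rule ccontr)
    assume "\<not> ?thesis"
    then have e: "v n = real (a n) + 1" using v_le[of n] by linarith
    have "a (n + 2 * j) = a n \<and> v (n + 2 * j) = real (a n) + 1" for j
    proof (induction j)
      case (Suc j)
      then have "a (Suc (n + 2 * j)) = Suc (a (n + 2 * j)) mod m" "v (Suc (n + 2 * j)) = a (Suc (n + 2 * j))"
        using right[of "n + 2 * j"] by auto
      from left[OF this] show ?case using Suc by simp
    qed (use e in simp)
    moreover from this have "a (Suc (n + 2 * j)) = Suc (a n) mod m" for j using right[of "n + 2 * j"] by auto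
    ultimately show False using alt[of n] by blast
  qed
  have u_in: "u n \<in> {real (a n) / real m..<(real (a n) + 1) / real m}" for n
    using v_ge[of n] v_less[of n] M unfolding v_def M_def[symmetric] by (simp add: field_simps)
  have u01: "0 \<le> u n" "u n < 1" for n
  proof -
    have "0 \<le> M * u n" "M * u n < M * 1" using v_ge[of n] v_less[of n] aM[of n] unfolding v_def by linarith+
    then show "0 \<le> u n" "u n < 1" using M by (simp_all add: zero_le_mult_iff)
  qed
  have "T_map m (u n) = u (Suc n)" for n
  proof -
    have "- (real m - 1) * u n = u (Suc n) + of_int (- int (a n) - (if a n < a (Suc n) then 1 else 0))"
      using rec[of n] unfolding k_def M_def[symmetric] by (auto simp: algebra_simps)
    then have "T_map m (u n) = frac (u (Suc n))" unfolding T_map_def by (metis frac_add_of_int_right)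
    then show ?thesis using u01[of "Suc n"] by (simp add: frac_eq)
  qed
  then have "(T_map m ^^ n) (u 0) = u n" for n by (induction n) auto
  then have "T_coding m (u 0) = a" using u_in am m by (intro T_coding_eqI) auto
  then show ?thesis using that[of "u 0"] u01 by blast
qed

section \<open>The conjugacy\<close>

lemma to_circle_add_int: "to_circle (x + of_int k) = to_circle x"
proof -
  have "to_circle (x + of_int k) = to_circle x * exp (2 * of_int k * of_real pi * \<i>)"
    unfolding to_circle_def exp_add[symmetric] by (simp add: algebra_simps)
  then show ?thesis using exp_integer_2pi[of "of_int k"] by (simp add: mult_ac)
qed

lemma chord_le_int_dist: "cmod (to_circle x - to_circle y) \<le> 2 * pi * int_dist (x - y)"
proof -
  obtain k where k: "int_dist (x - y) = \<bar>x - y - of_int k\<bar>" by (rule int_dist_witness)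
  have "cmod (to_circle x - to_circle (y + of_int k)) \<le> 2 * pi * \<bar>x - (y + of_int k)\<bar>" by (rule chord_le)
  then show ?thesis unfolding to_circle_add_int k by (simp add: algebra_simps)
qed

lemma int_dist_ge:
  assumes "g \<le> \<bar>s\<bar>" "\<bar>s\<bar> \<le> 1 - g" shows "g \<le> int_dist s"
proof -
  obtain k where k: "int_dist s = \<bar>s - of_int k\<bar>" by (rule int_dist_witness)
  consider "k = 0" | "k \<ge> 1" | "k \<le> -1" by linarith
  then show ?thesis
  proof cases
    case 2
    then have "real_of_int k \<ge> 1" by simp
    then show ?thesis using k assms by linarith
  next
    case 3
    then have "real_of_int k \<le> -1" by linarith
    then show ?thesis using k assms by linarith
  qed (use k assms in auto)
qed

lemma int_dist_pos:
  assumes "0 \<le> x" "x < 1" "0 \<le> y" "y < 1" "x \<noteq> y" shows "int_dist (x - y) > 0"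
proof -
  have "min \<bar>x - y\<bar> (1 - \<bar>x - y\<bar>) \<le> int_dist (x - y)" by (rule int_dist_ge) auto
  moreover have "min \<bar>x - y\<bar> (1 - \<bar>x - y\<bar>) > 0" using assms by auto
  ultimately show ?thesis by linarith
qed

text \<open>Equal codes keep the iterates within 1/m of each other, so a nonzero distance would grow
  exponentially without bound.\<close>

lemma T_coding_inj:
  assumes m: "m \<ge> (3 :: nat)" and u: "0 \<le> u" "u < 1" and v: "0 \<le> v" "v < 1"
    and eq: "T_coding m u = T_coding m v"
  shows "u = v"
proof (rule ccontr)
  assume "u \<noteq> v"
  define s where "s n = (T_map m ^^ n) u - (T_map m ^^ n) v" for n
  have h: "int_dist (s 0) > 0" unfolding s_def using int_dist_pos[OF u v \<open>u \<noteq> v\<close>] by simp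
  have m0: "0 < m" using m by simp
  have "(real m - 1) ^ n * int_dist (s 0) \<le> m * int_dist (s n)" for n
  proof (rule int_dist_orbit_ge[OF m])
    show "s (Suc j) + (real m - 1) * s j \<in> \<int>" for j unfolding s_def using T_map_diff_Ints by simp
    show "int_dist (s j) < 1 / m" for j
    proof -
      have "\<bar>s j\<bar> < 1 / m" using T_coding[OF m0 u, of j] T_coding[OF m0 v, of j] unfolding s_def eq 
        by (auto simp: add_divide_distrib)
      then show ?thesis using int_dist_le_abs[of "s j"] by linarith
    qed
  qed
  moreover have "m * int_dist (s n) \<le> real m * 1" for n using int_dist_le_half[of "s n"] by (intro mult_left_mono) auto
  ultimately have b: "(real m - 1) ^ n * int_dist (s 0) \<le> m" for n by (metis mult_1_right order_trans)
  obtain n where "m / int_dist (s 0) < (real m - 1) ^ n" using real_arch_pow[of "real m - 1"] m by auto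
  then show False using b[of n] h by (simp add: field_simps)
qed

lemma T_coding_funpow: "T_coding m ((T_map m ^^ n) u) k = T_coding m u (k + n)"
  unfolding T_coding_def by (simp add: funpow_add)

lemma T_map_fixed:
  assumes "b < m" shows "T_map m (real b / real m) = real b / real m"
proof -
  have "- (real m - 1) * (real b / real m) = real b / real m + of_int (- int b)"
    using assms by (simp add: field_simps)
  then have "T_map m (real b / real m) = frac (real b / real m)" unfolding T_map_def by (metis frac_add_of_int_right)
  then show ?thesis using assms by (simp add: frac_eq)
qed

context circle_partition
begin

section \<open>Codes of the reflection map and the conjugacy\<close>

definition code :: "real \<Rightarrow> nat \<Rightarrow> nat" where
  "code x n = letter ((step ^^ n) x)"

text \<open>The counterpart of \<open>Phi\<close> for an arbitrary partition of the circle;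
  \<open>Phi_phi\<close> identifies the two.\<close>

definition phi :: "real \<Rightarrow> real" where
  "phi x = inv_into {0..<1} (T_coding m) (code x)"

lemma orbit_bounds:
  assumes "0 \<le> x" "x < 1" shows "0 \<le> (step ^^ n) x" "(step ^^ n) x < 1"
  by (cases n; use assms step_bounds in simp)+

lemma code_less: "0 \<le> x \<Longrightarrow> x < 1 \<Longrightarrow> code x n < m"
  unfolding code_def by (intro letter_less orbit_bounds)

text \<open>This makes the \<open>inv_into\<close> in \<open>phi\<close> a true preimage. The
  conditions of \<open>T_coding_surj\<close> are geometric: only partition endpoints repeat a
  letter, a step never ends at the right endpoint of the arc it starts from, and two neighbours
  cannot alternate forever.\<close>

lemma code_in_range:
  assumes x: "0 \<le> x" "x < 1" shows "code x \<in> T_coding m ` {0..<1}"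
proof -
  let ?X = "\<lambda>n. (step ^^ n) x"
  obtain u where "0 \<le> u" "u < 1" "T_coding m u = code x"
  proof (rule T_coding_surj[OF m3, of "code x"])
    show "code x n < m" for n by (rule code_less[OF x])
    show "code x (Suc (Suc n)) = code x n" if "code x (Suc n) = code x n" for n
      using letter_step_same(2)[OF orbit_bounds[OF x, of n]] that unfolding code_def by simp
    show "code x (Suc (Suc n)) \<noteq> code x (Suc n)" if "code x (Suc n) = Suc (code x n) mod m" for n
    proof
      assume "code x (Suc (Suc n)) = code x (Suc n)"
      then have "?X (Suc n) = \<tau> (code x (Suc n))"
        using letter_step_same(1)[OF orbit_bounds[OF x, of "Suc n"]] unfolding code_def by simp
      then show False using step_avoids_right[OF orbit_bounds[OF x, of n]] that unfolding code_def by simp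
    qed
    show "\<exists>k. code x (n + 2 * k) \<noteq> code x n \<or> code x (Suc (n + 2 * k)) \<noteq> Suc (code x n) mod m" for n
    proof (rule ccontr)
      assume "\<not> ?thesis"
      then have a: "code x (n + 2 * k) = code x n" "code x (Suc (n + 2 * k)) = Suc (code x n) mod m" for k by blast+
      have c: "code x (n + j) = letter ((step ^^ j) (?X n))" for j
        unfolding code_def by (simp add: add.commute[of n] funpow_add)
      show False
      proof (rule no_alternation)
        show "code x n < m" by (rule code_less[OF x])
        show "0 \<le> ?X n" "?X n < 1" by (rule orbit_bounds[OF x])+
        show "letter ((step ^^ (2 * k)) (?X n)) = code x n" for k using a(1)[of k] c[of "2 * k"] by metis
        show "letter ((step ^^ Suc (2 * k)) (?X n)) = Suc (code x n) mod m" for k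
          using a(2)[of k] c[of "Suc (2 * k)"] by (metis add_Suc_right)
      qed
    qed
  qed blast
  then show ?thesis by force
qed

lemma phi:
  assumes x: "0 \<le> x" "x < 1"
  shows phi_ge_0: "0 \<le> phi x" and phi_less_1: "phi x < 1" and T_coding_phi: "T_coding m (phi x) = code x"
  using inv_into_into[OF code_in_range[OF x]] f_inv_into_f[OF code_in_range[OF x]] unfolding phi_def by auto

lemma phi_cong: "code x = code y \<Longrightarrow> phi x = phi y"
  unfolding phi_def by simp

lemma phi_orbit:
  assumes x: "0 \<le> x" "x < 1"
  shows "(T_map m ^^ n) (phi x) \<in> {real (code x n) / real m..<(real (code x n) + 1) / real m}"
  using T_coding[OF m_pos phi_ge_0[OF x] phi_less_1[OF x], of n] unfolding T_coding_phi[OF x] .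

lemma code_funpow: "code ((step ^^ n) x) k = code x (k + n)"
  unfolding code_def by (simp add: funpow_add)

lemma phi_funpow:
  assumes x: "0 \<le> x" "x < 1"
  shows "(T_map m ^^ n) (phi x) = phi ((step ^^ n) x)"
proof (rule T_coding_inj[OF m3])
  show "0 \<le> phi ((step ^^ n) x)" "phi ((step ^^ n) x) < 1" by (intro phi_ge_0 phi_less_1 orbit_bounds x)+
  show "0 \<le> (T_map m ^^ n) (phi x)" "(T_map m ^^ n) (phi x) < 1"
    by (intro T_map_iterate_bounds phi_ge_0 phi_less_1 x)+
  show "T_coding m ((T_map m ^^ n) (phi x)) = T_coding m (phi ((step ^^ n) x))"
    by (rule ext) (simp add: T_coding_funpow T_coding_phi x orbit_bounds code_funpow)
qed

lemma code_\<tau>: "b < m \<Longrightarrow> code (\<tau> b) n = b"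
proof -
  assume b: "b < m"
  have "(step ^^ n) (\<tau> b) = \<tau> b" by (induction n) (auto simp: step_\<tau> b)
  then show ?thesis unfolding code_def using letter_\<tau>[OF b] by simp
qed

lemma phi_\<tau>:
  assumes b: "b < m" shows "phi (\<tau> b) = b / m"
proof (rule T_coding_inj[OF m3])
  have r: "0 \<le> \<tau> b" "\<tau> b < 1" using \<tau>_ge_0 \<tau>_less_1 b by auto
  show "0 \<le> phi (\<tau> b)" "phi (\<tau> b) < 1" using phi[OF r] by auto
  show "0 \<le> real b / real m" "real b / real m < 1" using b by auto
  have "(T_map m ^^ n) (real b / real m) = real b / real m" for n by (induction n) (auto simp: T_map_fixed b)
  then have "T_coding m (real b / real m) = (\<lambda>_. b)"
    using b by (intro T_coding_eqI) (auto simp: divide_strict_right_mono)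
  then show "T_coding m (phi (\<tau> b)) = T_coding m (real b / real m)"
    unfolding T_coding_phi[OF r] using code_\<tau>[OF b] by auto
qed

definition code_word :: "real \<Rightarrow> nat \<Rightarrow> nat list" where
  "code_word x n = map (code x) [0..<n]"

lemma code_word_words: "0 \<le> x \<Longrightarrow> x < 1 \<Longrightarrow> code_word x n \<in> words n"
  unfolding code_word_def words_def using code_less by auto

text \<open>Reflections are involutions, so the letters of the orbit applied in reverse order undo
  it.\<close>

lemma act_code_word:
  assumes x: "0 \<le> x" "x < 1"
  shows "act (code_word x n) (to_circle ((step ^^ n) x)) = to_circle x"
proof (induction n)
  case (Suc n)
  note X = orbit_bounds[OF x, of n]
  have "R (code x n) (to_circle (step ((step ^^ n) x))) = to_circle ((step ^^ n) x)"
    unfolding to_circle_step[OF X] code_def by (rule R_R) (auto intro: letter_less X)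
  then show ?case using Suc unfolding code_word_def by (simp add: act_append)
qed (simp add: code_word_def)

section \<open>Geometry near a partition endpoint\<close>

lemma gap: obtains g where "g > 0" "\<And>a. a < m \<Longrightarrow> g \<le> \<tau> (Suc a) - \<tau> a"
  by (rule finite_positive_lower_bound[of "{..<m}" "\<lambda>a. \<tau> (Suc a) - \<tau> a"]) (auto simp: \<tau>_Suc)

lemma gap_\<tau>:
  assumes g: "\<And>a. a < m \<Longrightarrow> g \<le> \<tau> (Suc a) - \<tau> a" and ab: "a < b" "b \<le> m"
  shows "g \<le> \<tau> b - \<tau> a"
  using g[of a] \<tau>_le[of "Suc a" b] ab by auto

text \<open>The endpoint \<open>\<tau> a\<close> counts as far because its orbit stays in arc \<open>a\<close> forever.\<close>

definition far :: "nat \<Rightarrow> real \<Rightarrow> bool" where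
  "far a x \<longleftrightarrow> (letter x \<noteq> a \<and> letter x \<noteq> Suc a mod m) \<or> x = \<tau> a"

lemma far_dist:
  assumes g: "\<And>a. a < m \<Longrightarrow> g \<le> \<tau> (Suc a) - \<tau> a" and a: "a < m"
    and x: "0 \<le> x" "x < 1" and far: "far a x"
  shows "g \<le> int_dist (x - \<tau> (Suc a mod m))"
proof -
  note l = letter[OF x]
  note G = gap_\<tau>[OF g]
  have far': "letter x \<noteq> Suc a mod m" "letter x \<noteq> a \<or> x = \<tau> a"
    using far letter_\<tau>[OF a] Suc_mod_neq[OF a] unfolding far_def by auto
  show ?thesis
  proof (cases "Suc a = m")
    case True
    have "\<tau> 1 \<le> x" using far' l(2) \<tau>_le[of 1 "letter x"] l(1) True by simp
    moreover have "x \<le> \<tau> a"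
    proof (cases "x = \<tau> a")
      case False
      then have "Suc (letter x) \<le> a" using far' l(1) True by linarith
      then show ?thesis using \<tau>_le[of "Suc (letter x)" a] l(3) a by simp
    qed simp
    ultimately show ?thesis using G[of 0 1] G[of a m] a m3 True by (intro int_dist_ge) auto
  next
    case False
    then have b: "Suc a mod m = Suc a" "Suc a < m" using a by auto
    have "x \<le> \<tau> a \<or> \<tau> (Suc (Suc a)) \<le> x"
    proof (cases "letter x \<le> a")
      case True
      then have "x = \<tau> a \<or> Suc (letter x) \<le> a" using far' by linarith
      then show ?thesis using \<tau>_le[of "Suc (letter x)" a] l(3) a by auto
    next
      case False
      then have "Suc (Suc a) \<le> letter x" using far' b by linarith
      then show ?thesis using \<tau>_le[of "Suc (Suc a)" "letter x"] l by auto
    qed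
    then show ?thesis using G[of a "Suc a"] G[of "Suc a" "Suc (Suc a)"] G[of 0 "Suc a"] G[of "Suc a" m] b x
      by (intro int_dist_ge) auto
  qed
qed

text \<open>The two intervals that meet at the image of the endpoint have length 1/m. Distance
  exactly 1/m occurs only at the left end of the left interval, and an orbit whose image is there
  sits at \<open>\<tau> a\<close>, which counts as far.\<close>

lemma near_phi_dist:
  assumes a: "a < m" and x: "0 \<le> x" "x < 1" and near: "\<not> far a ((step ^^ n) x)"
  shows "int_dist ((T_map m ^^ n) (phi x) - real (Suc a mod m) / real m) < 1 / m"
proof -
  let ?b = "Suc a mod m" and ?X = "(step ^^ n) x" and ?u = "(T_map m ^^ n) (phi x)"
  note X = orbit_bounds[OF x]
  have u: "?u \<in> {real (code x n) / real m..<(real (code x n) + 1) / real m}" by (rule phi_orbit[OF x])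
  show ?thesis
  proof (cases "code x n = ?b")
    case True
    then have "\<bar>?u - real ?b / real m\<bar> < 1 / m" using u by (auto simp: add_divide_distrib)
    then show ?thesis using int_dist_le_abs[of "?u - real ?b / real m"] by linarith
  next
    case False
    then have c: "code x n = a" "?X \<noteq> \<tau> a" using near unfolding far_def code_def by auto
    have "?u \<noteq> real a / real m"
    proof
      assume "?u = real a / real m"
      then have "(T_map m ^^ Suc n) (phi x) = real a / real m" using T_map_fixed[OF a] by simp
      then have "real a / real m \<in> {real (code x (Suc n)) / real m..<(real (code x (Suc n)) + 1) / real m}"
        using phi_orbit[OF x, of "Suc n"] by simp
      moreover have "real a / real m \<in> {real a / real m..<(real a + 1) / real m}"
        using m_pos by (auto simp: divide_strict_right_mono)
      ultimately have "code x (Suc n) = a" using T_interval_unique m_pos by blast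
      then show False using letter_step_same(1)[OF X[of n]] c unfolding code_def by simp
    qed
    then have "\<bar>?u - real (Suc a) / real m\<bar> < 1 / m" using u unfolding c(1) by (auto simp: add_divide_distrib)
    \<comment> \<open>The integer absorbs the passage from 1 to 0 after the last arc.\<close>
    moreover obtain k :: int where "real ?b / real m = real (Suc a) / real m - of_int k"
    proof (cases "Suc a = m")
      case True
      then show ?thesis using that[of 1] by simp
    next
      case False
      then show ?thesis using that[of 0] a by simp
    qed
    ultimately show ?thesis using int_dist_le[of "?u - real ?b / real m" k] by simp
  qed
qed

text \<open>Both reflections fix the common endpoint, which can therefore serve as the second point
  in \<open>holder_transfer\<close>.\<close>

lemma act_fixes:
  assumes a: "a < m" and "set w \<subseteq> {a, Suc a mod m}"
  shows "act w (\<theta> (Suc a)) = \<theta> (Suc a)"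
  using assms(2)
proof (induction w)
  case (Cons c w)
  have "Suc a mod m < m" using m_pos by simp
  then have "R (Suc a mod m) (\<theta> (Suc a)) = \<theta> (Suc a)" using R_left[of "Suc a mod m"] \<theta>_mod[OF a] by metis
  then show ?case using Cons R_right[OF a] by auto
qed simp

text \<open>The shorter of the two arcs between points of different arcs of the partition contains an endpoint.\<close>

lemma separating_endpoint:
  assumes x: "0 \<le> x" "x < 1" and y: "0 \<le> y" "y < 1" and ne: "letter x \<noteq> letter y"
  obtains e where "e < m" "int_dist (x - \<tau> e) \<le> int_dist (x - y)" "int_dist (y - \<tau> e) \<le> int_dist (x - y)"
proof -
  have *: "\<exists>e<m. int_dist (x - \<tau> e) \<le> int_dist (x - y) \<and> int_dist (y - \<tau> e) \<le> int_dist (x - y)"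
    if x: "0 \<le> x" "x < 1" and y: "0 \<le> y" "y < 1" and less: "letter x < letter y" for x y
  proof -
    have m: "letter y < m" by (rule letter_less[OF y])
    have xe: "x < \<tau> (letter y)" "\<tau> (letter y) \<le> y"
      using letter_gt[OF x] letter_le[OF y] \<tau>_le[of "Suc (letter x)" "letter y"] less m by auto
    show ?thesis
    proof (cases "y - x \<le> 1 / 2")
      case True
      then have "int_dist (x - y) = y - x" using int_dist_unique[of "x - y" 0] xe by simp
      then show ?thesis using int_dist_le_abs[of "x - \<tau> (letter y)"] int_dist_le_abs[of "y - \<tau> (letter y)"] xe m
        by (intro exI[of _ "letter y"]) auto
    next
      case False
      then have "int_dist (x - y) = 1 - (y - x)" using int_dist_unique[of "x - y" "- 1"] x y by simp
      then show ?thesis using int_dist_le_abs[of x] int_dist_le[of y 1] x y m_pos by (intro exI[of _ 0]) auto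
    qed
  qed
  from ne consider "letter x < letter y" | "letter y < letter x" by linarith
  then show ?thesis
  proof cases
    case 1
    then show ?thesis using *[OF x y] that by blast
  next
    case 2
    moreover have "int_dist (y - x) = int_dist (x - y)" using int_dist_minus[of "x - y"] by simp
    ultimately show ?thesis using *[OF y x] that by auto
  qed
qed

end

section \<open>Hoelder continuity\<close>

lemma power2_powr: "0 < x \<Longrightarrow> (x\<^sup>2) powr b = x powr (2 * b)" for x :: real
proof -
  assume "0 < x"
  then have "x\<^sup>2 = x powr 2" by simp
  then show ?thesis by (simp only: powr_powr)
qed

text \<open>The constants come from \<open>P_exponential\<close>;
  \<open>joint_spectral_radius_generators\<close> identifies \<open>\<rho>\<close> with the joint
  spectral radius.\<close>

locale circle_growth = circle_partition +
  fixes \<rho> C :: real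
  assumes \<rho>_gt_1: "\<rho> > 1" and C_pos: "C > 0"
    and P_le: "\<And>n. P n \<le> C * \<rho> ^ n" and P_ge: "\<And>n. \<rho> ^ n \<le> C * P n"
begin

definition \<alpha> :: real where
  "\<alpha> = ln (real m - 1) / (2 * ln \<rho>)"

lemma \<alpha>_pos: "\<alpha> > 0"
  unfolding \<alpha>_def using m3 \<rho>_gt_1 by (intro divide_pos_pos) auto

text \<open>The equation that determines the exponent: squared norms of order
  \<open>\<rho> ^ (2 * n)\<close> are matched with the expansion of the linear map.\<close>

lemma \<rho>_power_\<alpha>: "(\<rho> ^ n) powr (2 * \<alpha>) = (real m - 1) ^ n"
proof -
  have l: "ln \<rho> > 0" using \<rho>_gt_1 by simp
  have "(\<rho> ^ n) powr (2 * \<alpha>) = exp (2 * \<alpha> * (real n * ln \<rho>))"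
    unfolding powr_def using \<rho>_gt_1 by (simp add: ln_realpow)
  also have "2 * \<alpha> * (real n * ln \<rho>) = real n * ln (real m - 1)" unfolding \<alpha>_def using l by simp
  also have "exp \<dots> = (real m - 1) ^ n" using m3 by (simp add: exp_of_nat_mult)
  finally show ?thesis .
qed

text \<open>Pulls an estimate at time n back to time 0. A chord shrinks at most by
  \<open>(C * \<rho> ^ n)\<^sup>2\<close>, whose power \<alpha> is a constant times
  \<open>(real m - 1) ^ n\<close> and cancels the expansion in the hypothesis on h.\<close>

lemma holder_transfer:
  fixes K h h' :: real
  assumes w: "w \<in> words n" and z: "cmod z = 1" "cmod z' = 1" and K: "K \<ge> 0"
    and h: "(real m - 1) ^ n * h \<le> m * h'" and h': "h' \<le> K * cmod (z - z') powr \<alpha>"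
  shows "h \<le> m * K * C powr (2 * \<alpha>) * cmod (act w z - act w z') powr \<alpha>"
proof -
  define d where "d = cmod (act w z - act w z')"
  have "total_growth w \<le> C * \<rho> ^ n" using total_growth_le_P[OF w] P_le[of n] by linarith
  then have "(total_growth w)\<^sup>2 \<le> (C * \<rho> ^ n)\<^sup>2" using total_growth_pos[OF w] by (intro power_mono) auto
  then have "cmod (z - z') \<le> d * (C * \<rho> ^ n)\<^sup>2"
    using chord_act_lower[OF w z] mult_left_mono[of "(total_growth w)\<^sup>2" "(C * \<rho> ^ n)\<^sup>2" d] unfolding d_def by simp
  then have "cmod (z - z') powr \<alpha> \<le> (d * (C * \<rho> ^ n)\<^sup>2) powr \<alpha>" using \<alpha>_pos by (intro powr_mono2) auto
  also have "\<dots> = d powr \<alpha> * ((C * \<rho> ^ n)\<^sup>2) powr \<alpha>"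
    by (rule powr_mult)
  also have "((C * \<rho> ^ n)\<^sup>2) powr \<alpha> = (C * \<rho> ^ n) powr (2 * \<alpha>)"
    using C_pos \<rho>_gt_1 by (intro power2_powr) simp
  also have "\<dots> = C powr (2 * \<alpha>) * (\<rho> ^ n) powr (2 * \<alpha>)"
    by (rule powr_mult)
  also have "\<dots> = C powr (2 * \<alpha>) * (real m - 1) ^ n" unfolding \<rho>_power_\<alpha> ..
  finally have "K * cmod (z - z') powr \<alpha> \<le> K * (d powr \<alpha> * (C powr (2 * \<alpha>) * (real m - 1) ^ n))"
    using K by (intro mult_left_mono) auto
  then have "m * h' \<le> m * (K * (d powr \<alpha> * (C powr (2 * \<alpha>) * (real m - 1) ^ n)))"
    using h' by (intro mult_left_mono) auto
  then have "(real m - 1) ^ n * h \<le> (real m - 1) ^ n * (m * K * C powr (2 * \<alpha>) * d powr \<alpha>)"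
    using h by (simp add: mult_ac)
  then show ?thesis using m3 unfolding d_def by simp
qed

lemma phi_holder_at_endpoint:
  obtains K where "K \<ge> 0" "\<And>e x. e < m \<Longrightarrow> 0 \<le> x \<Longrightarrow> x < 1 \<Longrightarrow>
    int_dist (phi x - phi (\<tau> e)) \<le> K * cmod (to_circle x - \<theta> e) powr \<alpha>"
proof -
  obtain g where g: "g > 0" "\<And>a. a < m \<Longrightarrow> g \<le> \<tau> (Suc a) - \<tau> a" by (rule gap) blast
  define K where "K = m * (1 / (4 * g) powr \<alpha>) * C powr (2 * \<alpha>)"
  have K: "K \<ge> 0" unfolding K_def by simp
  have *: "int_dist (phi x - phi (\<tau> (Suc a mod m))) \<le> K * cmod (to_circle x - \<theta> (Suc a)) powr \<alpha>"
    if a: "a < m" and x: "0 \<le> x" "x < 1" for a x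
  proof -
    define b where "b = Suc a mod m"
    have b: "b < m" unfolding b_def using m_pos by simp
    define s where "s n = (T_map m ^^ n) (phi x) - real b / real m" for n
    have s0: "s 0 = phi x - phi (\<tau> b)" unfolding s_def phi_\<tau>[OF b] by simp
    have sI: "s (Suc j) + (real m - 1) * s j \<in> \<int>" for j
      using T_map_diff_Ints[of m "(T_map m ^^ j) (phi x)" "real b / real m"] unfolding s_def T_map_fixed[OF b] by simp
    have near: "int_dist (s j) < 1 / m" if "\<not> far a ((step ^^ j) x)" for j
      using near_phi_dist[OF a x that] unfolding s_def b_def .
    have "int_dist (s 0) \<le> K * cmod (to_circle x - \<theta> (Suc a)) powr \<alpha>"
    proof (cases "\<exists>n. far a ((step ^^ n) x)")
      case False
      \<comment> \<open>An orbit that never becomes far expands forever, which leaves only distance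
        0.\<close>
      have "(real m - 1) ^ n * int_dist (s 0) \<le> m" for n
      proof -
        have "(real m - 1) ^ n * int_dist (s 0) \<le> m * int_dist (s n)"
          using near False by (intro int_dist_orbit_ge[of m n s] m3 sI) auto
        also have "\<dots> \<le> real m * 1" using int_dist_le_half[of "s n"] by (intro mult_left_mono) auto
        finally show ?thesis by simp
      qed
      note b = this
      have "int_dist (s 0) = 0"
      proof (rule ccontr)
        assume "int_dist (s 0) \<noteq> 0"
        then have h: "int_dist (s 0) > 0" using int_dist_nonneg[of "s 0"] by simp
        obtain n where "m / int_dist (s 0) < (real m - 1) ^ n" using real_arch_pow[of "real m - 1"] m3 by auto
        then show False using b[of n] h by (simp add: field_simps)
      qed
      then show ?thesis using K by simp
    next
      case True
      define n where "n = (LEAST n. far a ((step ^^ n) x))"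
      have n: "far a ((step ^^ n) x)" unfolding n_def using True by (rule LeastI_ex)
      have less: "\<not> far a ((step ^^ j) x)" if "j < n" for j using not_less_Least that unfolding n_def by blast
      note X = orbit_bounds[OF x]
      have "set (code_word x n) \<subseteq> {a, Suc a mod m}"
      proof
        fix c assume "c \<in> set (code_word x n)"
        then obtain j where "j < n" "c = code x j" unfolding code_word_def by auto
        then show "c \<in> {a, Suc a mod m}" using less[of j] unfolding code_def far_def by auto
      qed
      then have fixed: "act (code_word x n) (\<theta> (Suc a)) = \<theta> (Suc a)" by (rule act_fixes[OF a])
      \<comment> \<open>At the exit time the chord to the endpoint is bounded below, so the estimate
        is trivial there and \<open>holder_transfer\<close> pulls it back.\<close>
      have "4 * g \<le> 4 * int_dist ((step ^^ n) x - \<tau> b)" using far_dist[OF g(2) a X n] unfolding b_def by simp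
      also have "\<dots> \<le> cmod (to_circle ((step ^^ n) x) - to_circle (\<tau> b))" by (rule chord_ge)
      finally have "4 * g \<le> cmod (to_circle ((step ^^ n) x) - \<theta> (Suc a))"
        unfolding b_def \<tau>_mod_circle[OF a] .
      then have "(4 * g) powr \<alpha> \<le> cmod (to_circle ((step ^^ n) x) - \<theta> (Suc a)) powr \<alpha>"
        using g(1) \<alpha>_pos by (intro powr_mono2) auto
      moreover have "(4 * g) powr \<alpha> > 0" using g(1) by simp
      ultimately have "1 \<le> (1 / (4 * g) powr \<alpha>) * cmod (to_circle ((step ^^ n) x) - \<theta> (Suc a)) powr \<alpha>"
        by (simp add: field_simps)
      then have far: "int_dist (s n) \<le> (1 / (4 * g) powr \<alpha>) * cmod (to_circle ((step ^^ n) x) - \<theta> (Suc a)) powr \<alpha>"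
        using int_dist_le_half[of "s n"] by linarith
      have "(real m - 1) ^ n * int_dist (s 0) \<le> m * int_dist (s n)"
        using near less by (intro int_dist_orbit_ge[of m n s] m3 sI) auto
      from holder_transfer[OF code_word_words[OF x] _ _ _ this far]
      show ?thesis unfolding fixed act_code_word[OF x] K_def by simp
    qed
    then show ?thesis unfolding s0 b_def .
  qed
  show ?thesis
  proof (rule that[OF K])
    fix e x assume e: "e < m" and x: "0 \<le> x" "x < (1 :: real)"
    \<comment> \<open>The arc that ends at \<open>e\<close>, cyclically.\<close>
    define a where "a = (if e = 0 then m - 1 else e - 1)"
    have "a < m" "Suc a mod m = e" unfolding a_def using e m3 by auto
    then show "int_dist (phi x - phi (\<tau> e)) \<le> K * cmod (to_circle x - \<theta> e) powr \<alpha>"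
      using *[OF _ x, of a] \<theta>_mod[of a] by metis
  qed
qed

text \<open>Points of different arcs are compared through a separating endpoint. This gives a
  constant \<open>K1\<close> that does not depend on the time at which two codes first
  differ.\<close>

lemma phi_holder_circle:
  obtains K where "K \<ge> 0" "\<And>x y. 0 \<le> x \<Longrightarrow> x < 1 \<Longrightarrow> 0 \<le> y \<Longrightarrow> y < 1 \<Longrightarrow>
    int_dist (phi x - phi y) \<le> K * cmod (to_circle x - to_circle y) powr \<alpha>"
proof -
  obtain K0 where K0: "K0 \<ge> 0" "\<And>e x. e < m \<Longrightarrow> 0 \<le> x \<Longrightarrow> x < 1 \<Longrightarrow>
    int_dist (phi x - phi (\<tau> e)) \<le> K0 * cmod (to_circle x - \<theta> e) powr \<alpha>" by (rule phi_holder_at_endpoint) blast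
  define K1 where "K1 = 2 * K0 * pi powr \<alpha>"
  have K1: "K1 \<ge> 0" unfolding K1_def using K0 by simp
  have diff: "int_dist (phi x - phi y) \<le> K1 * cmod (to_circle x - to_circle y) powr \<alpha>"
    if x: "0 \<le> x" "x < 1" and y: "0 \<le> y" "y < 1" and ne: "letter x \<noteq> letter y" for x y
  proof -
    let ?c = "cmod (to_circle x - to_circle y)"
    obtain e where e: "e < m" "int_dist (x - \<tau> e) \<le> int_dist (x - y)" "int_dist (y - \<tau> e) \<le> int_dist (x - y)"
      by (rule separating_endpoint[OF x y ne])
    have close: "int_dist (phi v - phi (\<tau> e)) \<le> K0 * (pi powr \<alpha> * ?c powr \<alpha>)"
      if v: "0 \<le> v" "v < 1" "int_dist (v - \<tau> e) \<le> int_dist (x - y)" for v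
    proof -
      have "cmod (to_circle v - \<theta> e) \<le> 2 * pi * int_dist (v - \<tau> e)" unfolding \<theta>_def by (rule chord_le_int_dist)
      also have "\<dots> \<le> pi * (4 * int_dist (x - y))" using v(3) int_dist_nonneg[of "x - y"] by simp
      also have "\<dots> \<le> pi * ?c" by (intro mult_left_mono chord_ge) simp
      finally have "cmod (to_circle v - \<theta> e) powr \<alpha> \<le> (pi * ?c) powr \<alpha>" using \<alpha>_pos by (intro powr_mono2) auto
      then have "K0 * cmod (to_circle v - \<theta> e) powr \<alpha> \<le> K0 * (pi powr \<alpha> * ?c powr \<alpha>)"
        using K0(1) by (intro mult_left_mono) (auto simp: powr_mult)
      then show ?thesis using K0(2)[OF e(1) v(1,2)] by linarith
    qed
    have "int_dist (phi x - phi y) \<le> int_dist (phi x - phi (\<tau> e)) + int_dist (- (phi y - phi (\<tau> e)))"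
      using int_dist_triangle[of "phi x - phi (\<tau> e)" "- (phi y - phi (\<tau> e))"] by simp
    also have "\<dots> \<le> K0 * (pi powr \<alpha> * ?c powr \<alpha>) + K0 * (pi powr \<alpha> * ?c powr \<alpha>)"
      unfolding int_dist_minus using e x y by (intro add_mono close) auto
    finally show ?thesis unfolding K1_def by (simp add: mult_ac)
  qed
  define K where "K = m * K1 * C powr (2 * \<alpha>)"
  have K: "K \<ge> 0" unfolding K_def using K1 by simp
  have "int_dist (phi x - phi y) \<le> K * cmod (to_circle x - to_circle y) powr \<alpha>"
    if x: "0 \<le> x" "x < 1" and y: "0 \<le> y" "y < 1" for x y
  proof (cases "code x = code y")
    case True
    then have "int_dist (phi x - phi y) = 0" using phi_cong[OF True] int_dist_le_abs[of 0] int_dist_nonneg[of 0] by simp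
    then show ?thesis using K by simp
  next
    case False
    then have ex: "\<exists>n. code x n \<noteq> code y n" by auto
    define n where "n = (LEAST n. code x n \<noteq> code y n)"
    have n: "code x n \<noteq> code y n" unfolding n_def using ex by (rule LeastI_ex)
    have less: "code x j = code y j" if "j < n" for j using not_less_Least that unfolding n_def by blast
    then have cw: "code_word y n = code_word x n" unfolding code_word_def by auto
    note X = orbit_bounds[OF x] and Y = orbit_bounds[OF y]
    define s where "s n = (T_map m ^^ n) (phi x) - (T_map m ^^ n) (phi y)" for n
    have "(real m - 1) ^ n * int_dist (s 0) \<le> m * int_dist (s n)"
    proof (rule int_dist_orbit_ge[OF m3])
      show "s (Suc j) + (real m - 1) * s j \<in> \<int>" for j unfolding s_def using T_map_diff_Ints by simp
      show "int_dist (s j) < 1 / m" if "j < n" for j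
      proof -
        have "\<bar>s j\<bar> < 1 / m" using phi_orbit[OF x, of j] phi_orbit[OF y, of j] less[OF that] unfolding s_def
          by (auto simp: add_divide_distrib)
        then show ?thesis using int_dist_le_abs[of "s j"] by linarith
      qed
    qed
    then have h: "(real m - 1) ^ n * int_dist (s 0) \<le> m * int_dist (s n)" .
    have h': "int_dist (s n) \<le> K1 * cmod (to_circle ((step ^^ n) x) - to_circle ((step ^^ n) y)) powr \<alpha>"
      unfolding s_def phi_funpow[OF x] phi_funpow[OF y] using n unfolding code_def by (intro diff X Y)
    have "int_dist (s 0) \<le> K * cmod (act (code_word x n) (to_circle ((step ^^ n) x)) -
        act (code_word x n) (to_circle ((step ^^ n) y))) powr \<alpha>"
      unfolding K_def by (rule holder_transfer[OF code_word_words[OF x] _ _ K1 h h']) auto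
    then show ?thesis using act_code_word[OF y, of n] act_code_word[OF x, of n] unfolding cw s_def by simp
  qed
  then show ?thesis using that[OF K] by blast
qed

text \<open>
  Both images lie in the same or in adjacent intervals unless the arguments are a definite distance
  apart, so that the distance on the line is comparable with the distance on the circle.
\<close>

lemma phi_holder: "holder_continuous_on \<alpha> {0..<1} phi"
proof -
  obtain K0 where K0: "K0 \<ge> 0" "\<And>x y. 0 \<le> x \<Longrightarrow> x < 1 \<Longrightarrow> 0 \<le> y \<Longrightarrow> y < 1 \<Longrightarrow>
    int_dist (phi x - phi y) \<le> K0 * cmod (to_circle x - to_circle y) powr \<alpha>" by (rule phi_holder_circle) blast
  obtain g where g: "g > 0" "\<And>a. a < m \<Longrightarrow> g \<le> \<tau> (Suc a) - \<tau> a" by (rule gap) blast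
  have one: "\<bar>phi x - phi y\<bar> \<le> 1 / g powr \<alpha> * \<bar>x - y\<bar> powr \<alpha>"
    if x: "0 \<le> x" "x < 1" and y: "0 \<le> y" "y < 1" and less: "Suc (letter x) < letter y" for x y
  proof -
    have "x \<le> \<tau> (Suc (letter x))" "\<tau> (letter y) \<le> y" "g \<le> \<tau> (letter y) - \<tau> (Suc (letter x))"
      using letter_gt[OF x] letter_le[OF y] gap_\<tau>[OF g(2) less] letter_less[OF y] by auto
    then have "g powr \<alpha> \<le> \<bar>x - y\<bar> powr \<alpha>" using g(1) \<alpha>_pos by (intro powr_mono2) auto
    moreover have "\<bar>phi x - phi y\<bar> \<le> 1" using phi[OF x] phi[OF y] by auto
    moreover have "g powr \<alpha> > 0" using g(1) by simp
    ultimately have "1 \<le> 1 / g powr \<alpha> * \<bar>x - y\<bar> powr \<alpha>" "\<bar>phi x - phi y\<bar> \<le> 1" by (simp_all add: field_simps)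
    then show ?thesis by linarith
  qed
  define K1 where "K1 = 2 * K0 * (2 * pi) powr \<alpha>"
  define K where "K = 1 / g powr \<alpha> + K1"
  have K1: "K1 \<ge> 0" unfolding K1_def using K0(1) by simp
  have "\<bar>phi x - phi y\<bar> \<le> K * \<bar>x - y\<bar> powr \<alpha>" if x: "0 \<le> x" "x < 1" and y: "0 \<le> y" "y < 1" for x y
  proof -
    have "\<bar>phi x - phi y\<bar> \<le> 1 / g powr \<alpha> * \<bar>x - y\<bar> powr \<alpha> \<or> \<bar>phi x - phi y\<bar> \<le> K1 * \<bar>x - y\<bar> powr \<alpha>"
    proof (cases "Suc (letter x) < letter y \<or> Suc (letter y) < letter x")
      case True
      then show ?thesis using one[OF x y] one[OF y x] by (auto simp: abs_minus_commute)
    next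
      case False
      then have l: "\<bar>real (letter x) - real (letter y)\<bar> \<le> 1" by linarith
      have "\<bar>phi x * m - phi y * m\<bar> < 2"
      proof -
        have "real (letter x) \<le> phi x * m" "phi x * m < real (letter x) + 1"
          "real (letter y) \<le> phi y * m" "phi y * m < real (letter y) + 1"
          using phi_orbit[OF x, of 0] phi_orbit[OF y, of 0] m_pos by (auto simp: code_def field_simps)
        then show ?thesis using l by linarith
      qed
      then have "\<bar>phi x - phi y\<bar> * m < 2" by (simp add: abs_mult flip: left_diff_distrib)
      moreover have "\<bar>phi x - phi y\<bar> * 3 \<le> \<bar>phi x - phi y\<bar> * m" using m3 by (intro mult_left_mono) auto
      ultimately have s: "\<bar>phi x - phi y\<bar> * 3 < 2" by linarith
      \<comment> \<open>The images differ by less than 2 / m \<le> 2 / 3, and in this range the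
        circle distance is at least half the linear one.\<close>
      have "\<bar>phi x - phi y\<bar> / 2 \<le> int_dist (phi x - phi y)" by (rule int_dist_ge) (use s in auto)
      also have "\<dots> \<le> K0 * cmod (to_circle x - to_circle y) powr \<alpha>" by (rule K0(2)[OF x y])
      also have "\<dots> \<le> K0 * (2 * pi * \<bar>x - y\<bar>) powr \<alpha>"
        using K0(1) \<alpha>_pos by (intro mult_left_mono powr_mono2 chord_le) auto
      also have "\<dots> = K0 * ((2 * pi) powr \<alpha> * \<bar>x - y\<bar> powr \<alpha>)" by (subst powr_mult) auto
      finally have "\<bar>phi x - phi y\<bar> \<le> K1 * \<bar>x - y\<bar> powr \<alpha>" unfolding K1_def by simp
      then show ?thesis ..
    qed
    moreover have "1 / g powr \<alpha> * \<bar>x - y\<bar> powr \<alpha> \<ge> 0" "K1 * \<bar>x - y\<bar> powr \<alpha> \<ge> 0" using K1 by auto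
    ultimately show ?thesis unfolding K_def distrib_right by linarith
  qed
  then show ?thesis unfolding holder_continuous_on_def using \<alpha>_pos by (auto intro!: exI[of _ K])
qed

end

section \<open>Optimality of the exponent\<close>

context circle_partition
begin

section \<open>Orbits that follow a reduced word\<close>

lemma open_arc_bounds: "x \<in> open_arc b \<Longrightarrow> b < m \<Longrightarrow> 0 \<le> x \<and> x < 1"
  using \<tau>_ge_0[of b] \<tau>_le_1[of "Suc b"] unfolding open_arc_def by auto

lemma letter_open_arc: "x \<in> open_arc b \<Longrightarrow> b < m \<Longrightarrow> letter x = b"
  unfolding open_arc_def by (intro letter_eqI) auto

lemma open_arc_not_endpoint:
  assumes x: "x \<in> open_arc b" and b: "b < m" and c: "c \<le> m"
  shows "to_circle x \<noteq> \<theta> c"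
proof
  assume e: "to_circle x = \<theta> c"
  define c' where "c' = (if c = m then 0 else c)"
  have c': "c' < m" "to_circle x = to_circle (\<tau> c')" using e c m_pos unfolding c'_def \<theta>_def by auto
  then have "x = \<tau> c'" using to_circle_inj[of x "\<tau> c'"] open_arc_bounds[OF x b] \<tau>_ge_0[of c'] \<tau>_less_1[of c'] by auto
  then have "b = c'" using letter_open_arc[OF x b] letter_\<tau>[OF c'(1)] by simp
  then show False using x \<open>x = \<tau> c'\<close> unfolding open_arc_def by simp
qed

text \<open>Ping-pong: a reflection maps the complement of its closed arc into the open arc, and
  since consecutive letters differ, each letter meets a point outside its arc. The iterated map
  therefore undoes the word letter by letter.\<close>

lemma reduced_word_orbit:
  assumes w: "w \<in> words n" and b: "b < m" and x: "x \<in> open_arc b" and adj: "distinct_adj (w @ [b])"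
    and y: "y = from_circle (act w (to_circle x))"
  shows "y \<in> open_arc (hd (w @ [b]))" "(step ^^ n) y = x" "to_circle y = act w (to_circle x)"
proof -
  have "from_circle (act w (to_circle x)) \<in> open_arc (hd (w @ [b])) \<and> (step ^^ n) (from_circle (act w (to_circle x))) = x"
    using w adj
  proof (induction rule: words_induct)
    case Nil
    then show ?case using x open_arc_bounds[OF x b] by (simp add: from_circle_to_circle)
  next
    case (Cons n a w)
    let ?y = "from_circle (act w (to_circle x))" and ?c = "hd (w @ [b])"
    let ?x = "from_circle (R a (act w (to_circle x)))"
    have nw: "cmod (act w (to_circle x)) = 1" by (rule norm_act[OF Cons(2)]) simp
    have ty: "to_circle ?y = act w (to_circle x)" by (rule to_circle_from_circle[OF nw])
    have tx: "to_circle ?x = R a (act w (to_circle x))" by (rule to_circle_from_circle[OF norm_R[OF Cons(1) nw]])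
    have ac: "a \<noteq> ?c" "distinct_adj (w @ [b])" using Cons(4) by (auto simp: distinct_adj_Cons)
    have c: "?c < m" using Cons(2) b unfolding words_def by (cases w) auto
    have y: "?y \<in> open_arc ?c" "(step ^^ n) ?y = x" using Cons(3)[OF ac(2)] by auto
    have yb: "0 \<le> ?y" "?y < 1" using open_arc_bounds[OF y(1) c] by auto
    have "?y \<notin> open_arc a" using letter_open_arc[OF y(1) c] letter_open_arc[of ?y a] Cons(1) ac(1) by auto
    then have xa: "?x \<in> open_arc a"
      using open_arc_swap(3)[OF Cons(1) yb _ _ from_circle_bounds[of "R a (act w (to_circle x))"]] tx ty
        open_arc_not_endpoint[OF y(1) c, of a] open_arc_not_endpoint[OF y(1) c, of "Suc a"] Cons(1) by simp
    have "step ?x = from_circle (R a (R a (act w (to_circle x))))"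
      unfolding step_def tx letter_open_arc[OF xa Cons(1)] ..
    then have "step ?x = ?y" using R_R[OF Cons(1) nw] by simp
    then show ?case using xa y(2) by (simp add: funpow_Suc_right del: funpow.simps)
  qed
  then show "y \<in> open_arc (hd (w @ [b]))" "(step ^^ n) y = x" unfolding y by auto
  show "to_circle y = act w (to_circle x)" unfolding y by (rule to_circle_from_circle[OF norm_act[OF w]]) simp
qed

definition arc_mid :: "nat \<Rightarrow> real" where
  "arc_mid b = (\<tau> b + \<tau> (Suc b)) / 2"

lemma arc_mid: "b < m \<Longrightarrow> arc_mid b \<in> open_arc b"
  unfolding arc_mid_def open_arc_def using \<tau>_Suc[of b] by auto

text \<open>For distinct b and c this is the point of arc b that one step sends to the midpoint of
  arc c. Its code starts with b and c, so probes in the same arc remain distinguishable.\<close>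

definition probe :: "nat \<times> nat \<Rightarrow> real" where
  "probe = (\<lambda>(b, c). from_circle (R b (to_circle (arc_mid c))))"

definition probe_indices :: "(nat \<times> nat) set" where
  "probe_indices = {(b, c). b < m \<and> c < m \<and> b \<noteq> c}"

lemma probe:
  assumes "i \<in> probe_indices"
  shows "probe i \<in> open_arc (fst i)" "0 \<le> probe i" "probe i < 1" "code (probe i) 0 = fst i" "code (probe i) 1 = snd i"
proof -
  obtain b c where i: "i = (b, c)" "b < m" "c < m" "b \<noteq> c" using assms unfolding probe_indices_def by auto
  have *: "probe i \<in> open_arc b" "step (probe i) = arc_mid c"
    using reduced_word_orbit(1,2)[of "[b]" 1 c "arc_mid c" "probe i"] i arc_mid[OF i(3)] by (simp_all add: probe_def)
  show "probe i \<in> open_arc (fst i)" using * i by simp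
  show "0 \<le> probe i" "probe i < 1" using open_arc_bounds[OF *(1) i(2)] by auto
  show "code (probe i) 0 = fst i" "code (probe i) 1 = snd i"
    unfolding code_def using letter_open_arc * i arc_mid by auto
qed

lemma probe_separation:
  obtains \<delta> where "\<delta> > 0" "\<And>i j. i \<in> probe_indices \<Longrightarrow> j \<in> probe_indices \<Longrightarrow> i \<noteq> j \<Longrightarrow>
    \<delta> \<le> int_dist (phi (probe i) - phi (probe j)) \<and> \<delta> \<le> cmod (to_circle (probe i) - to_circle (probe j))"
proof -
  define f where "f = (\<lambda>(i, j). min (int_dist (phi (probe i) - phi (probe j))) (cmod (to_circle (probe i) - to_circle (probe j))))"
  define S where "S = {(i, j). i \<in> probe_indices \<and> j \<in> probe_indices \<and> i \<noteq> j}"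
  have fi: "finite probe_indices"
    by (rule finite_subset[of _ "{..<m} \<times> {..<m}"]) (auto simp: probe_indices_def)
  have S: "finite S" by (rule finite_subset[of _ "probe_indices \<times> probe_indices"]) (auto simp: S_def fi)
  have f: "f p > 0" if "p \<in> S" for p
  proof -
    obtain i j where p: "p = (i, j)" by (cases p)
    then have p: "p = (i, j)" "i \<in> probe_indices" "j \<in> probe_indices" "i \<noteq> j" using that unfolding S_def by auto
    note I = probe[OF p(2)] and J = probe[OF p(3)]
    have ne: "code (probe i) \<noteq> code (probe j)" using I(4,5) J(4,5) p(4) by (metis prod_eqI)
    then have "phi (probe i) \<noteq> phi (probe j)" using T_coding_phi[OF I(2,3)] T_coding_phi[OF J(2,3)] by metis
    then have "int_dist (phi (probe i) - phi (probe j)) > 0" using phi I J by (intro int_dist_pos) auto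
    moreover have "to_circle (probe i) \<noteq> to_circle (probe j)" using to_circle_inj[OF I(2,3) J(2,3)] ne by metis
    ultimately show ?thesis unfolding f_def p by simp
  qed
  obtain \<delta> where d: "\<delta> > 0" "\<And>p. p \<in> S \<Longrightarrow> \<delta> \<le> f p"
    using finite_positive_lower_bound[of S f, OF S f] by metis
  show ?thesis
  proof (rule that[OF d(1)])
    fix i j assume "i \<in> probe_indices" "j \<in> probe_indices" "i \<noteq> j"
    then have "(i, j) \<in> S" unfolding S_def by simp
    from d(2)[OF this] show "\<delta> \<le> int_dist (phi (probe i) - phi (probe j)) \<and> \<delta> \<le> cmod (to_circle (probe i) - to_circle (probe j))"
      unfolding f_def by simp
  qed
qed

text \<open>Among three separated probes at least two are expanded at full rate.\<close>

lemma expanded_probes: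
  assumes \<delta>: "\<And>i j. i \<in> probe_indices \<Longrightarrow> j \<in> probe_indices \<Longrightarrow> i \<noteq> j \<Longrightarrow>
      \<delta> \<le> cmod (to_circle (probe i) - to_circle (probe j))"
    and w: "w \<in> words n" and a: "a < m"
  obtains i j where "i \<in> probe_indices" "j \<in> probe_indices" "i \<noteq> j" "fst i \<noteq> a" "fst j \<noteq> a"
    "\<delta> * total_growth w / 8 \<le> growth w (to_circle (probe i))" "\<delta> * total_growth w / 8 \<le> growth w (to_circle (probe j))"
proof -
  define b where "b = Suc a mod m"
  have b: "b < m" "b \<noteq> a" unfolding b_def using m_pos Suc_mod_neq[OF a] by auto
  obtain c where c: "c < m" "c \<noteq> a" "c \<noteq> b"
  proof -
    have "card {a, b} < card {..<m}" using m3 b by simp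
    then have "\<not> {..<m} \<subseteq> {a, b}" by (metis card_mono finite.emptyI finite.insertI not_le)
    then show ?thesis using that by auto
  qed
  define ok where "ok i \<longleftrightarrow> \<delta> * total_growth w / 8 \<le> growth w (to_circle (probe i))" for i
  have two: "ok i \<or> ok j" if "i \<in> probe_indices" "j \<in> probe_indices" "i \<noteq> j" for i j
  proof -
    have "\<delta> * total_growth w \<le> cmod (to_circle (probe i) - to_circle (probe j)) * total_growth w"
      using \<delta>[OF that] total_growth_pos[OF w] by (intro mult_right_mono) auto
    also have "\<dots> \<le> 4 * (growth w (to_circle (probe i)) + growth w (to_circle (probe j)))"
      by (rule total_growth_two_points[OF w]) auto
    finally show ?thesis unfolding ok_def by argo
  qed
  \<comment> \<open>Only two arcs besides \<open>a\<close> are available when m = 3, hence two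
    probes in arc \<open>b\<close> and one in arc \<open>c\<close>.\<close>
  have i: "(b, a) \<in> probe_indices" "(b, c) \<in> probe_indices" "(c, a) \<in> probe_indices"
    using a b c unfolding probe_indices_def by auto
  have ne: "(b, a) \<noteq> (b, c)" "(b, a) \<noteq> (c, a)" "(b, c) \<noteq> (c, a)" using c by auto
  have "(ok (b, a) \<and> ok (b, c)) \<or> (ok (b, a) \<and> ok (c, a)) \<or> (ok (b, c) \<and> ok (c, a))"
    using two[OF i(1,2) ne(1)] two[OF i(1,3) ne(2)] two[OF i(2,3) ne(3)] by blast
  then show ?thesis
    using that[OF i(1,2) ne(1)] that[OF i(1,3) ne(2)] that[OF i(2,3) ne(3)] b(2) c(2) unfolding ok_def by auto
qed

text \<open>Cancellation respects growth because the dilations at a point and at its mirror image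
  are reciprocal.\<close>

lemma act_cancel:
  assumes "v \<in> words n" "a < m" "cmod z = 1"
  shows "act (u @ [a, a] @ v) z = act (u @ v) z" "growth (u @ [a, a] @ v) z = growth (u @ v) z"
proof -
  have n: "cmod (act v z) = 1" by (rule norm_act[OF assms(1,3)])
  have J: "J a (R a (act v z)) * J a (act v z) = 1"
    by (rule ideal_geodesic.dilation_reflection[OF geodesic[OF assms(2)] n])
  show "act (u @ [a, a] @ v) z = act (u @ v) z" by (simp add: act_append R_R[OF assms(2) n])
  show "growth (u @ [a, a] @ v) z = growth (u @ v) z"
    using J by (simp add: growth_append R_R[OF assms(2) n] act_append)
qed

lemma not_distinct_adj_split:
  assumes "\<not> distinct_adj w" obtains u a v where "w = u @ [a, a] @ v"
proof -
  have "\<exists>u a v. w = u @ [a, a] @ v" using assms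
  proof (induction w)
    case (Cons x w)
    show ?case
    proof (cases "distinct_adj w")
      case True
      then obtain v where "w = x # v" using Cons(2) by (cases w) (auto simp: distinct_adj_Cons)
      then show ?thesis by (intro exI[of _ "[]"]) auto
    next
      case False
      then obtain u a v where "w = u @ [a, a] @ v" using Cons by auto
      then show ?thesis by (intro exI[of _ "x # u"]) auto
    qed
  qed simp
  then show ?thesis using that by blast
qed

text \<open>Reduced words are treated with two expanded probes. Any other word has the growth of a
  word shorter by two letters, so induction on the length covers it.\<close>

lemma holder_bounds_growth:
  assumes \<beta>: "holder_continuous_on \<beta> {0..<1} phi"
  obtains D where "D > 0" "\<And>n. P n powr (2 * \<beta>) \<le> D * (real m - 1) ^ n"
proof -
  have b0: "\<beta> > 0" using \<beta> unfolding holder_continuous_on_def by simp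
  obtain K' where K': "\<And>x y. x \<in> {0..<1} \<Longrightarrow> y \<in> {0..<1} \<Longrightarrow> \<bar>phi x - phi y\<bar> \<le> K' * \<bar>x - y\<bar> powr \<beta>"
    using \<beta> unfolding holder_continuous_on_def by blast
  define K where "K = max K' 1"
  have K: "\<bar>phi x - phi y\<bar> \<le> K * \<bar>x - y\<bar> powr \<beta>" if "0 \<le> x" "x < 1" "0 \<le> y" "y < 1" for x y
    using K'[of x y] that mult_right_mono[of K' K "\<bar>x - y\<bar> powr \<beta>"] unfolding K_def by auto
  have K1: "K > 0" unfolding K_def by simp
  obtain \<delta> where \<delta>: "\<delta> > 0" "\<And>i j. i \<in> probe_indices \<Longrightarrow> j \<in> probe_indices \<Longrightarrow> i \<noteq> j \<Longrightarrow>
    \<delta> \<le> int_dist (phi (probe i) - phi (probe j)) \<and> \<delta> \<le> cmod (to_circle (probe i) - to_circle (probe j))"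
    by (rule probe_separation) blast
  obtain g where g: "g > 0" "\<And>a. a < m \<Longrightarrow> g \<le> \<tau> (Suc a) - \<tau> a" by (rule gap) blast
  \<comment> \<open>Comes from solving \<open>4 * g * \<bar>y i - y j\<bar> * (\<delta> * T /
    8)\<^sup>2 \<le> 2\<close> for the distance.\<close>
  define Q where "Q = 32 / (g * \<delta>\<^sup>2)"
  have Q: "Q > 0" unfolding Q_def using g \<delta> by simp
  define D1 where "D1 = K * Q powr \<beta> / \<delta>"
  have D1: "D1 > 0" unfolding D1_def using K1 Q \<delta> by simp
  have reduced: "total_growth w powr (2 * \<beta>) \<le> D1 * (real m - 1) ^ n"
    if w: "w \<in> words n" and ne: "w \<noteq> []" and adj: "distinct_adj w" for w n
  proof -
    define T where "T = total_growth w"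
    have T: "T > 0" unfolding T_def by (rule total_growth_pos[OF w])
    have lw: "last w < m" "hd w < m" using w ne last_in_set[OF ne] hd_in_set[OF ne] unfolding words_def by blast+
    obtain i j where ij: "i \<in> probe_indices" "j \<in> probe_indices" "i \<noteq> j" "fst i \<noteq> last w" "fst j \<noteq> last w"
      "\<delta> * T / 8 \<le> growth w (to_circle (probe i))" "\<delta> * T / 8 \<le> growth w (to_circle (probe j))"
      using expanded_probes[OF _ w lw(1), of \<delta>] \<delta>(2) unfolding T_def by blast
    define y where "y k = from_circle (act w (to_circle (probe k)))" for k
    have props: "y k \<in> open_arc (hd w)" "(step ^^ n) (y k) = probe k" "to_circle (y k) = act w (to_circle (probe k))"
      if "k \<in> probe_indices" "fst k \<noteq> last w" for k
    proof -
      have b: "fst k < m" using that(1) unfolding probe_indices_def by auto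
      have "distinct_adj (w @ [fst k])" using adj that(2) ne by (simp add: distinct_adj_append_iff)
      from reduced_word_orbit[OF w b probe(1)[OF that(1)] this y_def]
      show "y k \<in> open_arc (hd w)" "(step ^^ n) (y k) = probe k" "to_circle (y k) = act w (to_circle (probe k))"
        using ne by auto
    qed
    note I = props[OF ij(1,4)] and Jj = props[OF ij(2,5)]
    have Ib: "0 \<le> y i" "y i < 1" and Jb: "0 \<le> y j" "y j < 1"
      using open_arc_bounds[OF I(1) lw(2)] open_arc_bounds[OF Jj(1) lw(2)] by auto
    \<comment> \<open>Both points lie in one arc, whose complement has length at least
      \<open>g\<close>; so the circle distance is comparable with the linear one.\<close>
    have len: "\<bar>y i - y j\<bar> \<le> 1 - g"
    proof -
      have "\<tau> (Suc (hd w)) - \<tau> (hd w) \<le> 1 - g"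
      proof (cases "hd w = 0")
        case True
        then show ?thesis using gap_\<tau>[OF g(2), of 1 m] m3 by simp
      next
        case False
        then show ?thesis using gap_\<tau>[OF g(2), of 0 "hd w"] lw(2) \<tau>_le_1[of "Suc (hd w)"] by simp
      qed
      then show ?thesis using I(1) Jj(1) unfolding open_arc_def by auto
    qed
    have chord: "cmod (to_circle (y i) - to_circle (y j)) * (\<delta> * T / 8)\<^sup>2 \<le> 2"
    proof -
      have "(\<delta> * T / 8) * (\<delta> * T / 8) \<le> growth w (to_circle (probe i)) * growth w (to_circle (probe j))"
        using ij(6,7) \<delta>(1) T growth_pos[OF w, of "to_circle (probe i)"] by (intro mult_mono) auto
      then have "cmod (to_circle (y i) - to_circle (y j)) * (\<delta> * T / 8)\<^sup>2
          \<le> cmod (to_circle (y i) - to_circle (y j)) * (growth w (to_circle (probe i)) * growth w (to_circle (probe j)))"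
        unfolding power2_eq_square by (intro mult_left_mono) auto
      also have "\<dots> = cmod (to_circle (probe i) - to_circle (probe j))"
        unfolding I(3) Jj(3) by (rule act_diff[OF w]) auto
      also have "\<dots> \<le> 2" by (rule norm_diff_le_2) auto
      finally show ?thesis .
    qed
    have "g * \<bar>y i - y j\<bar> \<le> int_dist (y i - y j)"
    proof (rule int_dist_ge)
      have "\<bar>y i - y j\<bar> \<le> 1" "g \<le> 1" using len g(1) by linarith+
      then show "g * \<bar>y i - y j\<bar> \<le> \<bar>y i - y j\<bar>" by (simp add: mult_left_le_one_le g(1) less_imp_le)
      have "g * \<bar>y i - y j\<bar> \<le> g * 1" using \<open>\<bar>y i - y j\<bar> \<le> 1\<close> g(1) by (intro mult_left_mono) auto
      then show "\<bar>y i - y j\<bar> \<le> 1 - g * \<bar>y i - y j\<bar>" using len by linarith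
    qed
    then have "4 * g * \<bar>y i - y j\<bar> \<le> cmod (to_circle (y i) - to_circle (y j))" using chord_ge[of "y i" "y j"] by linarith
    then have "4 * g * \<bar>y i - y j\<bar> * (\<delta> * T / 8)\<^sup>2 \<le> cmod (to_circle (y i) - to_circle (y j)) * (\<delta> * T / 8)\<^sup>2"
      by (intro mult_right_mono) auto
    then have "4 * g * \<bar>y i - y j\<bar> * (\<delta> * T / 8)\<^sup>2 \<le> 2" using chord by linarith
    then have dist: "\<bar>y i - y j\<bar> \<le> Q / T\<^sup>2"
      unfolding Q_def using g(1) \<delta>(1) T by (simp add: field_simps power2_eq_square)
    have "\<delta> \<le> int_dist (phi (probe i) - phi (probe j))" using \<delta>(2)[OF ij(1,2,3)] by simp
    also have "\<dots> = int_dist ((T_map m ^^ n) (phi (y i)) - (T_map m ^^ n) (phi (y j)))"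
      unfolding phi_funpow[OF Ib] phi_funpow[OF Jb] I(2) Jj(2) ..
    also have "\<dots> \<le> (real m - 1) ^ n * int_dist (phi (y i) - phi (y j))"
      using int_dist_orbit_le[OF m3, of n "\<lambda>n. (T_map m ^^ n) (phi (y i)) - (T_map m ^^ n) (phi (y j))"] T_map_diff_Ints by simp
    also have "\<dots> \<le> (real m - 1) ^ n * (K * \<bar>y i - y j\<bar> powr \<beta>)"
      using m3 order_trans[OF int_dist_le_abs K[OF Ib Jb]] by (intro mult_left_mono) auto
    also have "\<dots> \<le> (real m - 1) ^ n * (K * (Q / T\<^sup>2) powr \<beta>)"
      using m3 K1 dist b0 by (intro mult_left_mono powr_mono2) auto
    also have "(Q / T\<^sup>2) powr \<beta> = Q powr \<beta> / T powr (2 * \<beta>)"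
      unfolding power2_powr[OF T, symmetric] using T Q by (simp add: powr_divide)
    finally have "\<delta> * T powr (2 * \<beta>) \<le> (real m - 1) ^ n * (K * Q powr \<beta>)" using T by (simp add: field_simps)
    then show ?thesis unfolding D1_def T_def using \<delta>(1) by (simp add: field_simps)
  qed
  \<comment> \<open>The second term covers the empty word, whose total growth is 2.\<close>
  define D where "D = max D1 (2 powr (2 * \<beta>))"
  have all: "total_growth w powr (2 * \<beta>) \<le> D * (real m - 1) ^ n" if "w \<in> words n" for w n
    using that
  proof (induction n arbitrary: w rule: less_induct)
    case (less n)
    show ?case
    proof (cases "distinct_adj w")
      case True
      show ?thesis
      proof (cases "w = []")
        case True
        then have "n = 0" "total_growth w = 2" using less(2) unfolding total_growth_def by auto
        then show ?thesis unfolding D_def by simp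
      next
        case False
        have "D1 * (real m - 1) ^ n \<le> D * (real m - 1) ^ n" unfolding D_def using m3 by (intro mult_right_mono) auto
        then show ?thesis using reduced[OF less(2) False True] by linarith
      qed
    next
      case False
      then obtain u a v where e: "w = u @ [a, a] @ v" by (rule not_distinct_adj_split)
      have a: "a < m" and v: "v \<in> words (length v)" and uv: "u @ v \<in> words (n - 2)" and n: "n \<ge> 2"
        using less(2) unfolding e words_def by auto
      have "total_growth w = total_growth (u @ v)"
        unfolding total_growth_def e using act_cancel(2)[OF v a] by simp
      then have "total_growth w powr (2 * \<beta>) \<le> D * (real m - 1) ^ (n - 2)" using less(1)[of "n - 2" "u @ v"] uv n by simp
      also have "\<dots> \<le> D * (real m - 1) ^ n" using m3 D1 unfolding D_def by (intro mult_left_mono power_increasing) auto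
      finally show ?thesis .
    qed
  qed
  show ?thesis
  proof (rule that)
    show "D > 0" unfolding D_def using D1 by simp
    show "P n powr (2 * \<beta>) \<le> D * (real m - 1) ^ n" for n by (rule P_attained[of n]) (metis all)
  qed
qed

end

context circle_growth
begin

text \<open>Inserted into \<open>holder_bounds_growth\<close>, an excess of \<beta> over \<alpha>
  would keep the powers of some q > 1 bounded.\<close>

lemma phi_holder_optimal:
  assumes \<beta>: "\<beta> > \<alpha>" shows "\<not> holder_continuous_on \<beta> {0..<1} phi"
proof
  assume h: "holder_continuous_on \<beta> {0..<1} phi"
  obtain D where D: "D > 0" "\<And>n. P n powr (2 * \<beta>) \<le> D * (real m - 1) ^ n" using holder_bounds_growth[OF h] by blast
  have b0: "\<beta> > 0" using \<beta> \<alpha>_pos by simp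
  define q where "q = \<rho> powr (2 * (\<beta> - \<alpha>))"
  have "q > 1" unfolding q_def using \<rho>_gt_1 \<beta> by (intro gr_one_powr) auto
  then obtain n where n: "C powr (2 * \<beta>) * D < q ^ n" using real_arch_pow by blast
  have "(\<rho> ^ n) powr (2 * \<beta>) \<le> (C * P n) powr (2 * \<beta>)" using P_ge[of n] \<rho>_gt_1 b0 by (intro powr_mono2) auto
  also have "\<dots> = C powr (2 * \<beta>) * P n powr (2 * \<beta>)" by (rule powr_mult)
  also have "\<dots> \<le> C powr (2 * \<beta>) * (D * (real m - 1) ^ n)" using D(2) by (intro mult_left_mono) auto
  also have "(\<rho> ^ n) powr (2 * \<beta>) = (\<rho> ^ n) powr (2 * \<alpha>) * (\<rho> ^ n) powr (2 * (\<beta> - \<alpha>))"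
    unfolding powr_add[symmetric] by (simp add: algebra_simps)
  also have "(\<rho> ^ n) powr (2 * (\<beta> - \<alpha>)) = q ^ n"
    unfolding q_def using \<rho>_gt_1 by (simp add: powr_powr mult.commute flip: powr_realpow)
  finally have "(real m - 1) ^ n * q ^ n \<le> (real m - 1) ^ n * (C powr (2 * \<beta>) * D)"
    unfolding \<rho>_power_\<alpha> by (simp add: mult_ac)
  then have "q ^ n \<le> C powr (2 * \<beta>) * D" using m3 by simp
  then show False using n by simp
qed

end

section \<open>The joint spectral radius\<close>

definition cayley_inv :: "complex^2^2" where
  "cayley_inv = (1 / sqrt 2) *\<^sub>R vector [vector [1, \<i>], vector [\<i>, 1]]"

text \<open>Homogeneous coordinates of z in the basis in which \<open>A_matrix\<close> acts.\<close>

definition circle_vector :: "complex \<Rightarrow> complex^2" where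
  "circle_vector z = cayley_inv *v vector [z, 1]"

lemma cayley_inverses: "cayley_matrix ** cayley_inv = mat 1" "cayley_inv ** cayley_matrix = mat 1"
proof -
  have s: "complex_of_real (sqrt 2) * complex_of_real (sqrt 2) = 2"
    by (metis of_real_mult of_real_numeral real_sqrt_mult_self abs_numeral)
  show "cayley_matrix ** cayley_inv = mat 1" "cayley_inv ** cayley_matrix = mat 1"
    unfolding cayley_matrix_def cayley_inv_def
    by (simp_all add: vec_eq_iff forall_2 matrix_matrix_mult_def sum_2 mat_def scaleR_conv_of_real[where 'a = complex] field_simps s)
qed

lemma matrix_inv_cayley: "matrix_inv cayley_matrix = cayley_inv"
proof -
  have "\<exists>B. cayley_matrix ** B = mat 1 \<and> B ** cayley_matrix = mat 1" using cayley_inverses by blast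
  then have i: "cayley_matrix ** matrix_inv cayley_matrix = mat 1"
    unfolding matrix_inv_def by (rule someI2_ex) simp
  have "matrix_inv cayley_matrix = (cayley_inv ** cayley_matrix) ** matrix_inv cayley_matrix"
    by (simp add: cayley_inverses)
  also have "\<dots> = cayley_inv" unfolding matrix_mul_assoc[symmetric] i by simp
  finally show ?thesis .
qed

lemma circle_vector_eq: "circle_vector z = (1 / sqrt 2) *\<^sub>R vector [z + \<i>, \<i> * z + 1]"
  unfolding circle_vector_def cayley_inv_def
  by (simp add: vec_eq_iff forall_2 matrix_vector_mult_def sum_2 scaleR_conv_of_real[where 'a = complex] add_divide_distrib algebra_simps)

text \<open>The Cayley matrix is unitary, so the norm is that of (z, 1). As it is the same for all
  z, growth factors are exact ratios of norms.\<close>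

lemma norm_circle_vector:
  assumes "cmod z = 1" shows "norm (circle_vector z) = sqrt 2"
proof -
  have "(Re z)\<^sup>2 + (Im z)\<^sup>2 = 1" using assms by (metis cmod_power2 one_power2)
  then have "(cmod (z + \<i>))\<^sup>2 + (cmod (\<i> * z + 1))\<^sup>2 = 4"
    unfolding cmod_power2 by (simp add: power2_eq_square algebra_simps)
  then have "norm (vector [z + \<i>, \<i> * z + 1] :: complex^2) = 2"
    by (simp add: norm_vec_def L2_set_def sum_2)
  then show ?thesis unfolding circle_vector_eq by (simp add: real_div_sqrt)
qed

lemma norm_vector_scalar: "norm (c *s v) = cmod c * norm v" for v :: "complex^2"
  by (simp add: norm_vec_def norm_mult L2_set_right_distrib)

lemma bounded_linear_matrix: "bounded_linear ((*v) A)" for A :: "complex^2^2"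
proof -
  have "linear ((*v) A)"
    by (rule linearI) (simp_all add: vec_eq_iff matrix_vector_mult_def sum.distrib distrib_left scaleR_sum_right)
  then show ?thesis by (simp add: linear_conv_bounded_linear)
qed

lemma circle_vector_basis:
  "x = (x $ 1 / (of_real (sqrt 2) * \<i>)) *s circle_vector \<i> + (x $ 2 / of_real (sqrt 2)) *s circle_vector (- \<i>)"
proof -
  have s: "complex_of_real (sqrt 2) * complex_of_real (sqrt 2) = 2"
    by (metis of_real_mult of_real_numeral real_sqrt_mult_self abs_numeral)
  show ?thesis
    unfolding circle_vector_eq by (simp add: vec_eq_iff forall_2 scaleR_conv_of_real[where 'a = complex] field_simps s)
qed

lemma set_power_finite: "finite S \<Longrightarrow> finite (set_power S k)"
proof (induction k)
  case (Suc k)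
  have "set_power S (Suc k) = (\<lambda>(A, B). A ** B) ` (S \<times> set_power S k)" by auto
  then show ?case using Suc by simp
qed simp

context ideal_geodesic
begin

text \<open>The reflection is the projective action of its matrix, and the scalar is the normalised
  denominator up to sign.\<close>

lemma reflection_matrix_circle_vector:
  assumes z: "cmod z = 1"
  obtains \<kappa> where "cmod \<kappa> = dilation p q z"
    "(matrix_inv cayley_matrix ** reflection_matrix p q ** cayley_matrix) *v circle_vector z = \<kappa> *s circle_vector (reflection p q z)"
proof
  define \<kappa> where "\<kappa> = - (2 * z - (p + q)) / (p - q)"
  show "cmod \<kappa> = dilation p q z" unfolding \<kappa>_def dilation_def by (simp add: norm_divide norm_minus_commute)
  have "reflection_matrix p q *v vector [z, 1] = \<kappa> *s vector [reflection p q z, 1]"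
    using denom[OF z] pq unfolding \<kappa>_def reflection_matrix_def reflection_def
    by (simp add: vec_eq_iff forall_2 matrix_vector_mult_def sum_2 divide_simps) (simp add: algebra_simps)
  then show "(matrix_inv cayley_matrix ** reflection_matrix p q ** cayley_matrix) *v circle_vector z = \<kappa> *s circle_vector (reflection p q z)"
    unfolding matrix_inv_cayley circle_vector_def
    by (metis matrix_vector_mul_assoc cayley_inverses(1) matrix_vector_mul_lid vector_scalar_commute)
qed

end

context circle_partition
begin

section \<open>Matrices of words\<close>

definition generators :: "(nat \<Rightarrow> real) \<Rightarrow> (complex^2^2) set" where
  "generators \<epsilon> = (\<lambda>a. \<epsilon> a *\<^sub>R (matrix_inv cayley_matrix ** reflection_matrix (\<theta> a) (\<theta> (Suc a)) ** cayley_matrix)) ` {..<m}"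

text \<open>A relation, because the signs of the generators and the phase of the scalar are left
  free; norms see only its modulus.\<close>

definition represents :: "complex^2^2 \<Rightarrow> nat list \<Rightarrow> bool" where
  "represents A w \<longleftrightarrow> (\<forall>z. cmod z = 1 \<longrightarrow> (\<exists>\<kappa>. cmod \<kappa> = growth w z \<and> A *v circle_vector z = \<kappa> *s circle_vector (act w z)))"

lemma represents_Cons:
  assumes a: "a < m" and \<epsilon>: "e \<in> {1, - 1 :: real}" and w: "w \<in> words n" and B: "represents B w"
  shows "represents ((e *\<^sub>R (matrix_inv cayley_matrix ** reflection_matrix (\<theta> a) (\<theta> (Suc a)) ** cayley_matrix)) ** B) (a # w)"
  unfolding represents_def
proof (intro allI impI)
  fix z :: complex assume z: "cmod z = 1"
  define G where "G = matrix_inv cayley_matrix ** reflection_matrix (\<theta> a) (\<theta> (Suc a)) ** cayley_matrix"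
  obtain k where k: "cmod k = growth w z" "B *v circle_vector z = k *s circle_vector (act w z)"
    using B z unfolding represents_def by blast
  obtain k' where k': "cmod k' = J a (act w z)" "G *v circle_vector (act w z) = k' *s circle_vector (R a (act w z))"
    unfolding G_def by (rule ideal_geodesic.reflection_matrix_circle_vector[OF geodesic[OF a] norm_act[OF w z]])
  have e: "(e *\<^sub>R M) *v v = of_real e *s (M *v v)" for M :: "complex^2^2" and v
    by (simp add: vec_eq_iff matrix_vector_mult_def scaleR_conv_of_real[where 'a = complex] sum_distrib_left mult_ac)
  have "((e *\<^sub>R G) ** B) *v circle_vector z = (of_real e * k' * k) *s circle_vector (R a (act w z))"
    unfolding matrix_vector_mul_assoc[symmetric] k(2) e vector_scalar_commute k'(2)
    by (simp add: vector_smult_assoc mult_ac)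
  moreover have "cmod (of_real e * k' * k) = growth (a # w) z" using \<epsilon> k(1) k'(1) by (auto simp: norm_mult)
  ultimately show "\<exists>\<kappa>. cmod \<kappa> = growth (a # w) z \<and>
      ((e *\<^sub>R (matrix_inv cayley_matrix ** reflection_matrix (\<theta> a) (\<theta> (Suc a)) ** cayley_matrix)) ** B) *v circle_vector z = \<kappa> *s circle_vector (act (a # w) z)"
    unfolding G_def[symmetric] by auto
qed

lemma represents_Nil: "represents (mat 1) []"
  unfolding represents_def by (auto intro!: exI[of _ 1])

lemma set_power_represents:
  assumes \<epsilon>: "\<And>a. a < m \<Longrightarrow> \<epsilon> a \<in> {1, -1}" and "A \<in> set_power (generators \<epsilon>) n"
  obtains w where "w \<in> words n" "represents A w"
proof -
  have "\<exists>w\<in>words n. represents A w" using assms(2)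
  proof (induction n arbitrary: A)
    case 0
    then show ?case using represents_Nil by auto
  next
    case (Suc n)
    then obtain a B where a: "a < m" and B: "B \<in> set_power (generators \<epsilon>) n"
      and A: "A = (\<epsilon> a *\<^sub>R (matrix_inv cayley_matrix ** reflection_matrix (\<theta> a) (\<theta> (Suc a)) ** cayley_matrix)) ** B"
      by (auto simp: generators_def)
    obtain w where "w \<in> words n" "represents B w" using Suc.IH[OF B] by blast
    then show ?case using represents_Cons[OF a \<epsilon>[OF a], of w n B] a unfolding A by (intro bexI[of _ "a # w"]) auto
  qed
  then show ?thesis using that by blast
qed

lemma words_represented:
  assumes \<epsilon>: "\<And>a. a < m \<Longrightarrow> \<epsilon> a \<in> {1, -1}" and "w \<in> words n"
  obtains A where "A \<in> set_power (generators \<epsilon>) n" "represents A w"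
proof -
  have "\<exists>A\<in>set_power (generators \<epsilon>) n. represents A w" using assms(2)
  proof (induction rule: words_induct)
    case Nil
    then show ?case using represents_Nil by auto
  next
    case (Cons n a w)
    then obtain B where B: "B \<in> set_power (generators \<epsilon>) n" "represents B w" by blast
    have "\<epsilon> a *\<^sub>R (matrix_inv cayley_matrix ** reflection_matrix (\<theta> a) (\<theta> (Suc a)) ** cayley_matrix) \<in> generators \<epsilon>"
      using Cons(1) unfolding generators_def by blast
    then show ?case using represents_Cons[OF Cons(1) \<epsilon>[OF Cons(1)] Cons(2) B(2)] B(1) by auto
  qed
  then show ?thesis using that by blast
qed

text \<open>The vectors of \<open>\<i>\<close> and \<open>- \<i>\<close> are multiples of the
  standard basis, so \<open>total_growth\<close> is the sum of the norms of the columns.\<close>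

lemma represents_onorm:
  assumes A: "represents A w" and w: "w \<in> words n"
  shows "onorm ((*v) A) \<le> total_growth w" "total_growth w \<le> 2 * onorm ((*v) A)"
proof -
  have n: "norm (A *v circle_vector z) = growth w z * sqrt 2" if "cmod z = 1" for z
    using A that norm_circle_vector[OF norm_act[OF w that]] unfolding represents_def by (auto simp: norm_vector_scalar)
  have "growth w z \<le> onorm ((*v) A)" if "cmod z = 1" for z
    using onorm[OF bounded_linear_matrix, of A "circle_vector z"] unfolding n[OF that] norm_circle_vector[OF that] by simp
  from this[of \<i>] this[of "- \<i>"] show "total_growth w \<le> 2 * onorm ((*v) A)" unfolding total_growth_def by simp
  show "onorm ((*v) A) \<le> total_growth w"
  proof (rule onorm_le)
    fix x :: "complex^2"
    let ?c = "x $ 1 / (of_real (sqrt 2) * \<i>)" and ?d = "x $ 2 / of_real (sqrt 2)"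
    have "A *v x = A *v (?c *s circle_vector \<i> + ?d *s circle_vector (- \<i>))" using circle_vector_basis[of x] by simp
    also have "\<dots> = ?c *s (A *v circle_vector \<i>) + ?d *s (A *v circle_vector (- \<i>))"
      by (simp add: matrix_vector_right_distrib vector_scalar_commute)
    finally have "norm (A *v x) \<le> norm (?c *s (A *v circle_vector \<i>)) + norm (?d *s (A *v circle_vector (- \<i>)))"
      by (metis norm_triangle_ineq)
    also have "\<dots> = cmod (x $ 1) * growth w \<i> + cmod (x $ 2) * growth w (- \<i>)"
      unfolding norm_vector_scalar by (simp add: n norm_mult norm_divide)
    also have "\<dots> \<le> norm x * growth w \<i> + norm x * growth w (- \<i>)"
      using growth_pos[OF w, of \<i>] growth_pos[OF w, of "- \<i>"]
      by (intro add_mono mult_right_mono) (auto intro: Finite_Cartesian_Product.norm_nth_le)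
    finally show "norm (A *v x) \<le> total_growth w * norm x" unfolding total_growth_def by (simp add: algebra_simps)
  qed
qed

end

context circle_growth
begin

text \<open>Maximal operator norms and \<open>\<rho> ^ k\<close> agree up to constant factors, whose
  k-th roots tend to 1.\<close>

lemma joint_spectral_radius_generators:
  assumes \<epsilon>: "\<And>a. a < m \<Longrightarrow> \<epsilon> a \<in> {1, -1}"
  shows "joint_spectral_radius (generators \<epsilon>) = \<rho>"
proof -
  define M where "M k = Max {root k (onorm ((*v) A)) | A. A \<in> set_power (generators \<epsilon>) k}" for k
  have fin: "finite {root k (onorm ((*v) A)) | A. A \<in> set_power (generators \<epsilon>) k}" for k
    using set_power_finite[of "generators \<epsilon>" k] by (simp add: generators_def)
  have \<rho>: "\<rho> > 0" using \<rho>_gt_1 by simp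
  have up: "M k \<le> root k C * \<rho>" if k: "k > 0" for k
  proof -
    have "v \<le> root k C * \<rho>" if v: "v \<in> {root k (onorm ((*v) A)) | A. A \<in> set_power (generators \<epsilon>) k}" for v
    proof -
      obtain A where A: "A \<in> set_power (generators \<epsilon>) k" "v = root k (onorm ((*v) A))" using v by blast
      obtain w where w: "w \<in> words k" "represents A w" by (rule set_power_represents[OF \<epsilon> A(1)])
      have "onorm ((*v) A) \<le> C * \<rho> ^ k"
        using represents_onorm(1)[OF w(2,1)] total_growth_le_P[OF w(1)] P_le[of k] by linarith
      then have "v \<le> root k (C * \<rho> ^ k)" unfolding A(2) using k by (intro real_root_le_mono)
      also have "\<dots> = root k C * \<rho>" using k \<rho> by (simp add: real_root_mult real_root_power_cancel)
      finally show ?thesis .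
    qed
    moreover obtain w where w: "w \<in> words k" using words_nonempty by blast
    obtain A where "A \<in> set_power (generators \<epsilon>) k" by (rule words_represented[OF \<epsilon> w])
    ultimately show ?thesis unfolding M_def using fin[of k] by (subst Max_le_iff) auto
  qed
  have low: "root k (1 / (2 * C)) * \<rho> \<le> M k" if k: "k > 0" for k
  proof -
    obtain w where w: "w \<in> words k" "total_growth w = P k" by (rule P_attained)
    obtain A where A: "A \<in> set_power (generators \<epsilon>) k" "represents A w" by (rule words_represented[OF \<epsilon> w(1)])
    have "C * P k \<le> C * (2 * onorm ((*v) A))"
      using represents_onorm(2)[OF A(2) w(1)] C_pos w(2) by (intro mult_left_mono) auto
    then have "\<rho> ^ k \<le> C * (2 * onorm ((*v) A))" using P_ge[of k] by linarith
    then have "1 / (2 * C) * \<rho> ^ k \<le> onorm ((*v) A)" using C_pos by (simp add: field_simps)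
    then have "root k (1 / (2 * C) * \<rho> ^ k) \<le> root k (onorm ((*v) A))" using k by (intro real_root_le_mono)
    also have "\<dots> \<le> M k" unfolding M_def using fin[of k] A(1) by (intro Max_ge) auto
    also have "root k (1 / (2 * C) * \<rho> ^ k) = root k (1 / (2 * C)) * \<rho>"
      unfolding real_root_mult using k \<rho> by (simp add: real_root_power_cancel)
    finally show ?thesis .
  qed
  have "M \<longlonglongrightarrow> \<rho>"
  proof (rule tendsto_sandwich)
    show "(\<lambda>k. root k (1 / (2 * C)) * \<rho>) \<longlonglongrightarrow> \<rho>"
      using tendsto_mult[OF LIMSEQ_root_const[of "1 / (2 * C)"] tendsto_const, of \<rho>] C_pos by simp
    show "(\<lambda>k. root k C * \<rho>) \<longlonglongrightarrow> \<rho>"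
      using tendsto_mult[OF LIMSEQ_root_const[of C] tendsto_const, of \<rho>] C_pos by simp
    show "\<forall>\<^sub>F k in sequentially. root k (1 / (2 * C)) * \<rho> \<le> M k"
      using eventually_gt_at_top[of 0] by eventually_elim (rule low)
    show "\<forall>\<^sub>F k in sequentially. M k \<le> root k C * \<rho>"
      using eventually_gt_at_top[of 0] by eventually_elim (rule up)
  qed
  then show ?thesis unfolding joint_spectral_radius_def M_def[abs_def] by (rule limI)
qed

end

section \<open>Partitions by pythagorean triples\<close>

lemma Arg2pi_to_circle_divide:
  assumes "0 \<le> u" "u < 1" "0 \<le> v" "v < 1"
  shows "Arg2pi (to_circle u / to_circle v) = 2 * pi * (if v \<le> u then u - v else u - v + 1)"
proof -
  have e: "to_circle u / to_circle v = to_circle (u - v)"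
    unfolding to_circle_def exp_diff[symmetric] by (simp add: algebra_simps)
  have e': "to_circle (u - v) = to_circle (u - v + 1)" using to_circle_add_int[of "u - v" 1] by simp
  show ?thesis
  proof (cases "v \<le> u")
    case True
    then show ?thesis unfolding e using Arg2pi_to_circle[of "u - v"] assms by simp
  next
    case False
    then show ?thesis unfolding e e' using Arg2pi_to_circle[of "u - v + 1"] assms by simp
  qed
qed

lemma norm_triple_point:
  assumes "pythagorean_triple t" shows "cmod (triple_point t) = 1"
proof -
  have t: "t $ 3 > 0" "(t $ 1)\<^sup>2 + (t $ 2)\<^sup>2 = (t $ 3)\<^sup>2" using assms unfolding pythagorean_triple_def by auto
  have "(cmod (of_int (t $ 1) + of_int (t $ 2) * \<i>))\<^sup>2 = (real_of_int (t $ 3))\<^sup>2"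
    unfolding cmod_power2 using t(2) by (simp flip: of_int_power of_int_add)
  then have "cmod (of_int (t $ 1) + of_int (t $ 2) * \<i>) = real_of_int (t $ 3)"
    using t(1) by (simp add: power2_eq_iff_nonneg)
  then show ?thesis unfolding triple_point_def norm_divide using t(1) by simp
qed

text \<open>The default value 1 closes the last arc at index \<open>m\<close>, where reduction
  modulo \<open>m\<close> would give the angle 0.\<close>

definition partition_angle :: "nat \<Rightarrow> (nat \<Rightarrow> int^3) \<Rightarrow> nat \<Rightarrow> real" where
  "partition_angle m t a = (if a < m then from_circle (triple_point (t a)) else 1)"

lemma circle_partition_partition_angle:
  assumes part: "unimodular_partition m t" and base: "triple_point (t 0) = 1"
  shows "circle_partition m (partition_angle m t)"
proof
  show "m \<ge> 3" using part unfolding unimodular_partition_def by simp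
  then show "partition_angle m t 0 = 0"
    unfolding partition_angle_def base using from_circle_to_circle[of 0] by simp
  show "partition_angle m t m = 1" unfolding partition_angle_def by simp
  show "partition_angle m t a < partition_angle m t (Suc a)" if a: "a < m" for a
  proof (cases "Suc a < m")
    case True
    have "Arg2pi (triple_point (t a) / triple_point (t 0)) < Arg2pi (triple_point (t (Suc a)) / triple_point (t 0))"
      using part a True unfolding unimodular_partition_def strict_mono_on_def by auto
    then show ?thesis using True a unfolding partition_angle_def base from_circle_def by (simp add: divide_strict_right_mono)
  next
    case False
    then show ?thesis using a from_circle_bounds(2) unfolding partition_angle_def by simp
  qed
qed

locale pythagorean_partition = circle_partition m "partition_angle m t" for m t +
  assumes triple: "\<And>a. a < m \<Longrightarrow> pythagorean_triple (t a)"
begin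

lemma \<theta>_triple_point: "a < m \<Longrightarrow> \<theta> a = triple_point (t a)"
  unfolding \<theta>_def using to_circle_from_circle[OF norm_triple_point[OF triple]] by (simp add: partition_angle_def)

lemma \<theta>_Suc_triple_point: "a < m \<Longrightarrow> \<theta> (Suc a) = triple_point (t (Suc a mod m))"
  using \<theta>_mod[of a] \<theta>_triple_point[of "Suc a mod m"] m_pos by simp

text \<open>The base point is itself a partition endpoint, so no arc crosses it and counterclockwise
  arcs become intervals. The last arc, whose right endpoint has angle 0, is the case that wraps
  around.\<close>

lemma part_arc_iff:
  assumes a: "a < m" and x: "0 \<le> x" "x < 1"
  shows "to_circle x \<in> part_arc m t a \<longleftrightarrow> partition_angle m t a \<le> x \<and> x < partition_angle m t (Suc a)"
proof -
  let ?\<tau> = "partition_angle m t"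
  define b where "b = Suc a mod m"
  have b: "b < m" unfolding b_def using m_pos by simp
  have "to_circle x \<in> part_arc m t a \<longleftrightarrow>
      Arg2pi (to_circle x / to_circle (?\<tau> a)) < Arg2pi (to_circle (?\<tau> b) / to_circle (?\<tau> a))"
    using \<theta>_triple_point[OF a] \<theta>_triple_point[OF b] unfolding part_arc_def ccw_arc_def \<theta>_def b_def by simp
  also have "\<dots> \<longleftrightarrow> (if ?\<tau> a \<le> x then x - ?\<tau> a else x - ?\<tau> a + 1) < (if ?\<tau> a \<le> ?\<tau> b then ?\<tau> b - ?\<tau> a else ?\<tau> b - ?\<tau> a + 1)"
    using a b x by (simp only: Arg2pi_to_circle_divide \<tau>_ge_0 \<tau>_less_1 less_imp_le) simp
  also have "\<dots> \<longleftrightarrow> ?\<tau> a \<le> x \<and> x < ?\<tau> (Suc a)"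
  proof (cases "Suc a = m")
    case True
    then have "?\<tau> b = 0" "?\<tau> (Suc a) = 1" "?\<tau> a > 0" using \<tau>_less[of 0 a] m3 a unfolding b_def by auto
    then show ?thesis using x by auto
  next
    case False
    then have "b = Suc a" using a unfolding b_def by simp
    then show ?thesis using \<tau>_Suc[OF a] \<tau>_le_1[of "Suc a"] a x by auto
  qed
  finally show ?thesis .
qed

lemma part_arc_index:
  assumes "0 \<le> x" "x < 1" shows "(THE a. a < m \<and> to_circle x \<in> part_arc m t a) = letter x"
  unfolding letter_def using part_arc_iff[OF _ assms] by (intro arg_cong[of _ _ The]) auto

lemma interval_map_step:
  assumes x: "0 \<le> x" "x < 1" shows "interval_map m t x = step x"
  unfolding interval_map_def circle_map_def part_arc_index[OF x] step_def Let_def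
  using \<theta>_triple_point[OF letter_less[OF x]] \<theta>_Suc_triple_point[OF letter_less[OF x]] by simp

lemma B_coding_code:
  assumes x: "0 \<le> x" "x < 1" shows "B_coding m t x = code x"
proof
  fix n
  have "(interval_map m t ^^ n) x = (step ^^ n) x"
    by (induction n) (auto simp: interval_map_step orbit_bounds[OF x])
  then show "B_coding m t x n = code x n"
    unfolding B_coding_def code_def using part_arc_index[OF orbit_bounds[OF x]] by simp
qed

lemma Phi_phi: "0 \<le> x \<Longrightarrow> x < 1 \<Longrightarrow> Phi m t x = phi x"
  unfolding Phi_def phi_def B_coding_code ..

lemma Sigma_set_generators: "Sigma_set m t \<epsilon> = generators \<epsilon>"
  unfolding Sigma_set_def generators_def A_matrix_def
  by (intro image_cong refl) (simp add: \<theta>_triple_point \<theta>_Suc_triple_point)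

end

lemma holder_continuous_on_cong:
  assumes "\<And>x. x \<in> S \<Longrightarrow> f x = g x"
  shows "holder_continuous_on \<alpha> S f \<longleftrightarrow> holder_continuous_on \<alpha> S g"
  unfolding holder_continuous_on_def using assms by simp

theorem theorem10p5:
  fixes m :: nat and t :: "nat \<Rightarrow> int^3" and \<epsilon> :: "nat \<Rightarrow> real"
    and \<Sigma> :: "(complex^2^2) set" and \<alpha> :: real
  assumes part: "unimodular_partition m t"
    and base: "triple_point (t 0) = 1"
    and signs: "\<And>a. a < m \<Longrightarrow> \<epsilon> a \<in> {1, -1}"
    and Sigma: "\<Sigma> = Sigma_set m t \<epsilon>"
    and alpha: "\<alpha> = ln (real m - 1) / (2 * ln (joint_spectral_radius \<Sigma>))"
  shows "holder_continuous_on \<alpha> {0..<1} (Phi m t) \<and>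
         (finiteness_property \<Sigma> \<longrightarrow> (\<forall>\<beta>>\<alpha>. \<not> holder_continuous_on \<beta> {0..<1} (Phi m t)))"
proof -
  interpret circle_partition m "partition_angle m t"
    by (rule circle_partition_partition_angle[OF part base])
  interpret pythagorean_partition m t
    by unfold_locales (use part in \<open>simp add: unimodular_partition_def\<close>)
  obtain \<rho> C where "\<rho> > 1" "C > 0" "\<And>n. P n \<le> C * \<rho> ^ n" "\<And>n. \<rho> ^ n \<le> C * P n"
    by (rule P_exponential) blast
  then interpret g: circle_growth m "partition_angle m t" \<rho> C by unfold_locales
  have "joint_spectral_radius \<Sigma> = \<rho>"
    unfolding Sigma Sigma_set_generators by (rule g.joint_spectral_radius_generators[OF signs])
  then have \<alpha>: "\<alpha> = g.\<alpha>" unfolding alpha g.\<alpha>_def by simp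
  have cong: "holder_continuous_on \<beta> {0..<1} (Phi m t) \<longleftrightarrow> holder_continuous_on \<beta> {0..<1} phi" for \<beta>
    by (rule holder_continuous_on_cong) (simp add: Phi_phi)
  show ?thesis unfolding cong \<alpha> using g.phi_holder g.phi_holder_optimal by blast
qed

end
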